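(* Let $N,P\in\mathbb{N}$, $T>0$, $Q_T:=\mathbb{R}^N\times(0,T)$, and let $\sigma=(\sigma_1,\dots,\sigma_P)\in\mathbb{R}^{N\times P}$ (with columns $\sigma_i\in\mathbb{R}^N$). Let $\mu$ be a nonnegative symmetric Radon measure on $\mathbb{R}^N\setminus\{0\}$ satisfying $\int_{|z|>0}\min\{|z|^2,1\}\,\mathrm{d}\mu(z)<\infty$. Let $\varphi:\mathbb{R}\to\mathbb{R}$ be nondecreasing and continuous, let $g\in L^1_{\mathrm{loc}}(Q_T)$ and $u_0\in L^\infty(\mathbb{R}^N)$. Then there is at most one distributional solution $u$ of $$\partial_t u-\mathfrak{L}^{\sigma,\mu}[\varphi(u)]=g\ \text{ in } Q_T,\qquad u(\cdot,0)=u_0\ \text{ on }\mathbb{R}^N,$$ such that $u\in L^\infty(Q_T)$ and $u-u_0\in L^1(Q_T)$.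
   Context: For $\psi\in C_c^\infty(\mathbb{R}^N)$ the operator is $\mathfrak{L}^{\sigma,\mu}[\psi]:=L^\sigma[\psi]+\mathcal{L}^\mu[\psi]$, where $L^\sigma[\psi](x):=\mathrm{tr}(\sigma\sigma^T D^2\psi(x))=\sum_{i=1}^P(\sigma_i\cdot D)^2\psi(x)$ and $\mathcal{L}^\mu[\psi](x):=\int_{\mathbb{R}^N\setminus\{0\}}\big(\psi(x+z)-\psi(x)-z\cdot D\psi(x)\mathbf{1}_{|z|\le 1}\big)\,\mathrm{d}\mu(z)$; for functions $\psi(x,t)$ it acts in the $x$ variable. A distributional solution (with $u_0\in L^1_{\mathrm{loc}}(\mathbb{R}^N)$, $g\in L^1_{\mathrm{loc}}(Q_T)$) is a function $u\in L^\infty(Q_T)$ such that $\int_0^T\int_{\mathbb{R}^N}\big(u\,\partial_t\psi+\varphi(u)\,\mathfrak{L}^{\sigma,\mu}[\psi]+g\,\psi\big)\,\mathrm{d}x\,\mathrm{d}t=0$ for all $\psi\in C_c^\infty(Q_T)$, and $\operatorname{ess\,lim}_{t\to0^+}\int_{\mathbb{R}^N}u(x,t)\psi(x,t)\,\mathrm{d}x=\int_{\mathbb{R}^N}u_0(x)\psi(x,0)\,\mathrm{d}x$ for all $\psi\in C_c^\infty(\mathbb{R}^N\times[0,T))$. *)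

theory Defs
  imports "HOL-Analysis.Analysis"
begin

type_synonym 'n pt = "(real^'n) \<times> real"

definition dirderiv :: "('a::real_normed_vector \<Rightarrow> real) \<Rightarrow> 'a \<Rightarrow> 'a \<Rightarrow> real" where
  "dirderiv f v x = frechet_derivative f (at x) v"

fun iter_deriv :: "('a::real_normed_vector \<Rightarrow> real) \<Rightarrow> 'a list \<Rightarrow> 'a \<Rightarrow> real" where
  "iter_deriv f [] = f"
| "iter_deriv f (v # vs) = dirderiv (iter_deriv f vs) v"

definition smooth_fun :: "('a::real_normed_vector \<Rightarrow> real) \<Rightarrow> bool" where
  "smooth_fun f \<longleftrightarrow> (\<forall>vs x. iter_deriv f vs differentiable (at x))"

definition tsupp :: "('a::real_normed_vector \<Rightarrow> real) \<Rightarrow> 'a set" where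
  "tsupp f = closure {x. f x \<noteq> 0}"

definition test_fun :: "'a::real_normed_vector set \<Rightarrow> ('a \<Rightarrow> real) \<Rightarrow> bool" where
  "test_fun S f \<longleftrightarrow> smooth_fun f \<and> compact (tsupp f) \<and> tsupp f \<subseteq> S"

definition QT :: "real \<Rightarrow> 'n::finite pt set" where
  "QT T = UNIV \<times> {0<..<T}"

definition Linf :: "'a::euclidean_space set \<Rightarrow> ('a \<Rightarrow> real) \<Rightarrow> bool" where
  "Linf S f \<longleftrightarrow> f \<in> borel_measurable (lebesgue_on S) \<and> (\<exists>C. AE x in lebesgue_on S. \<bar>f x\<bar> \<le> C)"

definition L1loc :: "'a::euclidean_space set \<Rightarrow> ('a \<Rightarrow> real) \<Rightarrow> bool" where
  "L1loc S f \<longleftrightarrow> f \<in> borel_measurable (lebesgue_on S) \<and>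
     (\<forall>K. compact K \<and> K \<subseteq> S \<longrightarrow> integrable (lebesgue_on K) f)"

definition levy_measure :: "(real^'n::finite) measure \<Rightarrow> bool" where
  "levy_measure mu \<longleftrightarrow> sets mu = sets borel \<and> emeasure mu {0} = 0 \<and>
     (\<forall>K. compact K \<and> 0 \<notin> K \<longrightarrow> emeasure mu K < \<infinity>) \<and>
     (\<forall>A \<in> sets borel. emeasure mu (uminus ` A) = emeasure mu A) \<and>
     (\<integral>\<^sup>+ z. ennreal (min ((norm z)\<^sup>2) 1) \<partial>mu) < \<infinity>"

definition local_op :: "real^'p::finite^'n::finite \<Rightarrow> ('n pt \<Rightarrow> real) \<Rightarrow> 'n pt \<Rightarrow> real" where
  "local_op Sg psi p = (\<Sum>i\<in>UNIV. dirderiv (dirderiv psi (column i Sg, 0)) (column i Sg, 0) p)"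

text \<open>Nonlocal part acting in the x variable (mu has no mass at 0).\<close>
definition nonlocal_op :: "(real^'n::finite) measure \<Rightarrow> ('n pt \<Rightarrow> real) \<Rightarrow> 'n pt \<Rightarrow> real" where
  "nonlocal_op mu psi p = (\<integral>z. psi (fst p + z, snd p) - psi p
       - (if norm z \<le> 1 then dirderiv psi (z, 0) p else 0) \<partial>mu)"

definition frakL :: "real^'p::finite^'n::finite \<Rightarrow> (real^'n) measure \<Rightarrow> ('n pt \<Rightarrow> real) \<Rightarrow> 'n pt \<Rightarrow> real" where
  "frakL Sg mu psi p = local_op Sg psi p + nonlocal_op mu psi p"

definition ess_lim_0 :: "(real \<Rightarrow> real) \<Rightarrow> real \<Rightarrow> bool" where
  "ess_lim_0 F L \<longleftrightarrow> (\<forall>e>0. \<exists>d>0. AE t in lborel. 0 < t \<and> t < d \<longrightarrow> \<bar>F t - L\<bar> < e)"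

definition dist_sol ::
  "real^'p::finite^'n::finite \<Rightarrow> (real^'n) measure \<Rightarrow> (real \<Rightarrow> real) \<Rightarrow> ('n pt \<Rightarrow> real)
     \<Rightarrow> (real^'n \<Rightarrow> real) \<Rightarrow> real \<Rightarrow> ('n pt \<Rightarrow> real) \<Rightarrow> bool" where
  "dist_sol Sg mu phi g u0 T u \<longleftrightarrow>
     Linf (QT T) u \<and>
     (\<forall>psi. test_fun (QT T) psi \<longrightarrow>
        (\<integral>p. u p * dirderiv psi (0, 1) p + phi (u p) * frakL Sg mu psi p + g p * psi p
           \<partial>(lebesgue_on (QT T))) = 0) \<and>
     (\<forall>psi. test_fun (UNIV \<times> {..<T}) psi \<longrightarrow>
        ess_lim_0 (\<lambda>t. \<integral>x. u (x, t) * psi (x, t) \<partial>lebesgue) (\<integral>x. u0 x * psi (x, 0) \<partial>lebesgue))"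

end

theory Submission
  imports Defs
begin

text \<open>For two solutions put \<open>U = u - v\<close>, \<open>W = \<phi>(u) - \<phi>(v)\<close>, so \<open>U W \<ge> 0\<close> and \<open>\<partial>\<^sub>t U = L W\<close> with vanishing initial
  trace. After mollification \<open>V(t) = \<integral>\<^sub>0\<^sup>t W\<close> satisfies \<open>U(t) = L V(t)\<close>, hence formally
  \<open>2 \<integral>\<integral> W U = 2 \<integral>\<integral> (\<partial>\<^sub>t V) L V = \<integral> V(T) L V(T) \<le> 0\<close>, which forces \<open>W U = 0\<close>, then \<open>W = 0\<close> and \<open>U = 0\<close>.
  The symmetry and the sign of the pairing \<open>\<integral> V\<^sub>1 L V\<^sub>2\<close> are not immediate, as \<open>V\<close> is merely bounded while \<open>L V\<close> is
  integrable. They follow by applying an approximate resolvent of a bounded discretisation of \<open>L\<close> to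
  \<open>V\<^sub>1\<close>; the remainder disappears because \<open>V\<close> is, up to a uniformly small error, integrable.\<close>

section \<open>Smooth functions and test functions\<close>

text \<open>\<open>W\<close> need not be integrable, since \<open>phi\<close> is merely continuous:
  integrability of \<open>u - v\<close> and uniform continuity of \<open>phi\<close> on the range of
  the solutions only give finite measure to \<open>{|W| > \<delta>}\<close>. So Fubini cannot
  symmetrise \<open>\<integral> V1 (L V2)\<close>. In \<open>V1 = J V1 - B (L V1)\<close> the
  operator \<open>B\<close> acts on the integrable \<open>L V1\<close>, where it is symmetric and
  positive. The discretisation is made on the mollifying kernel: an error small in \<open>L1\<close>
  there becomes uniformly small after convolution with a bounded function. The formal time
  derivative of the energy is replaced by backward difference quotients, in which the sign of the
  form turns the chain rule into an inequality in the right direction. Mollification destroys the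
  sign of \<open>U W\<close>, and only the mollified \<open>U\<close> is known to converge in
  \<open>L1\<close>; the kernel on \<open>W\<close> is therefore moved onto \<open>U\<close> before
  the scale tends to \<open>0\<close>. Finally, \<open>W = 0\<close> says nothing about
  \<open>U\<close> where \<open>phi\<close> is constant, and \<open>U = 0\<close> is read off from
  the mollified equation \<open>U = L V\<close>.\<close>

lemma dirderiv_eqI: "(f has_derivative f') (at x) \<Longrightarrow> dirderiv f v x = f' v"
  by (simp add: dirderiv_def frechet_derivative_at[symmetric])

lemma has_derivative_dirderiv:
  "f differentiable (at x) \<Longrightarrow> (f has_derivative (\<lambda>v. dirderiv f v x)) (at x)"
  unfolding dirderiv_def by (metis frechet_derivative_works)

text \<open>All iterated derivatives of a member stay in \<open>C\<close>. Smoothness thus reduces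
  to choosing a class that is visibly closed under \<open>dirderiv\<close>, and no formula for
  higher derivatives is ever needed.\<close>

lemma smooth_fun_coinduct:
  assumes "f \<in> C"
    and "\<And>f x. f \<in> C \<Longrightarrow> f differentiable (at x)"
    and "\<And>f v. f \<in> C \<Longrightarrow> dirderiv f v \<in> C"
  shows "smooth_fun f"
proof -
  have "iter_deriv f vs \<in> C" for vs
    by (induction vs) (use assms in auto)
  then show ?thesis
    using assms(2) by (auto simp: smooth_fun_def)
qed

lemma iter_deriv_append: "iter_deriv f (vs @ ws) = iter_deriv (iter_deriv f ws) vs"
  by (induction vs) auto

lemma smooth_fun_iter_deriv: "smooth_fun f \<Longrightarrow> smooth_fun (iter_deriv f vs)"
  by (metis iter_deriv_append smooth_fun_def)

lemma smooth_fun_dirderiv: "smooth_fun f \<Longrightarrow> smooth_fun (dirderiv f v)"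
  using smooth_fun_iter_deriv[of f "[v]"] by simp

lemma smooth_fun_differentiable: "smooth_fun f \<Longrightarrow> f differentiable (at x)"
  by (metis iter_deriv.simps(1) smooth_fun_def)

lemma smooth_fun_has_derivative:
  "smooth_fun f \<Longrightarrow> (f has_derivative (\<lambda>v. dirderiv f v x)) (at x)"
  by (simp add: has_derivative_dirderiv smooth_fun_differentiable)

lemma smooth_fun_continuous: "smooth_fun f \<Longrightarrow> continuous_on S f"
  by (meson continuous_at_imp_continuous_on differentiable_imp_continuous_within smooth_fun_differentiable)

lemma smooth_fun_borel:
  fixes f :: "'a::euclidean_space \<Rightarrow> real"
  shows "smooth_fun f \<Longrightarrow> f \<in> borel_measurable borel"
  by (rule borel_measurable_continuous_onI) (rule smooth_fun_continuous)

lemma dirderiv_add: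
  "f differentiable (at x) \<Longrightarrow> g differentiable (at x) \<Longrightarrow>
    dirderiv (\<lambda>x. f x + g x) v x = dirderiv f v x + dirderiv g v x"
  by (rule dirderiv_eqI) (intro has_derivative_add has_derivative_dirderiv)

lemma dirderiv_mult:
  "f differentiable (at x) \<Longrightarrow> g differentiable (at x) \<Longrightarrow>
    dirderiv (\<lambda>x. f x * g x) v x = f x * dirderiv g v x + dirderiv f v x * g x"
  by (rule dirderiv_eqI) (intro has_derivative_mult has_derivative_dirderiv)

lemma has_derivative_affine_comp:
  assumes "f differentiable (at (A x + c))" "bounded_linear A"
  shows "((\<lambda>x. f (A x + c)) has_derivative (\<lambda>v. dirderiv f (A v) (A x + c))) (at x)"
proof -
  have "((\<lambda>x. A x + c) has_derivative A) (at x)"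
    using assms(2) by (auto intro!: derivative_eq_intros bounded_linear_imp_has_derivative)
  from has_derivative_compose[OF this has_derivative_dirderiv[OF assms(1)]]
  show ?thesis by simp
qed

lemma dirderiv_affine_comp:
  assumes "f differentiable (at (A x + c))" "bounded_linear A"
  shows "dirderiv (\<lambda>x. f (A x + c)) v x = dirderiv f (A v) (A x + c)"
  by (rule dirderiv_eqI[OF has_derivative_affine_comp[OF assms]])

text \<open>By the Leibniz rule the derivative of a product is a sum of products, so products alone
  are not closed under \<open>dirderiv\<close>. Closing under both operations gives a class fit for
  \<open>smooth_fun_coinduct\<close>.\<close>

inductive_set smooth_alg :: "('a::real_normed_vector \<Rightarrow> real) set" where
  base: "smooth_fun f \<Longrightarrow> f \<in> smooth_alg"
| add: "f \<in> smooth_alg \<Longrightarrow> g \<in> smooth_alg \<Longrightarrow> (\<lambda>x. f x + g x) \<in> smooth_alg"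
| mult: "f \<in> smooth_alg \<Longrightarrow> g \<in> smooth_alg \<Longrightarrow> (\<lambda>x. f x * g x) \<in> smooth_alg"

lemma smooth_alg_smooth:
  assumes "f \<in> smooth_alg" shows "smooth_fun f"
proof -
  have D: "f differentiable (at x)" if "f \<in> smooth_alg" for f :: "'a \<Rightarrow> real" and x
    using that by induction (auto simp: smooth_fun_differentiable)
  have "dirderiv f v \<in> smooth_alg" if "f \<in> smooth_alg" for f :: "'a \<Rightarrow> real" and v
    using that
  proof induction
    case (add f g)
    then have "dirderiv (\<lambda>x. f x + g x) v = (\<lambda>x. dirderiv f v x + dirderiv g v x)"
      by (auto simp: dirderiv_add D)
    then show ?case using add by (auto intro: smooth_alg.intros)
  next
    case (mult f g)
    then have "dirderiv (\<lambda>x. f x * g x) v = (\<lambda>x. f x * dirderiv g v x + dirderiv f v x * g x)"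
      by (auto simp: dirderiv_mult D)
    then show ?case using mult by (auto intro!: smooth_alg.add smooth_alg.mult)
  qed (auto intro: smooth_alg.base smooth_fun_dirderiv)
  with assms D show ?thesis by (intro smooth_fun_coinduct[of f smooth_alg])
qed

lemma smooth_fun_mult: "smooth_fun f \<Longrightarrow> smooth_fun g \<Longrightarrow> smooth_fun (\<lambda>x. f x * g x)"
  by (rule smooth_alg_smooth[OF smooth_alg.mult[OF smooth_alg.base smooth_alg.base]])

lemma smooth_fun_const: "smooth_fun (\<lambda>x. c)"
proof (rule smooth_fun_coinduct[of _ "range (\<lambda>c x. c)"])
  fix f :: "'a \<Rightarrow> real" and v assume "f \<in> range (\<lambda>c x. c)"
  then obtain c where "f = (\<lambda>x. c)" by auto
  then have "dirderiv f v = (\<lambda>x. 0)"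
    by (auto intro!: dirderiv_eqI[where f'="\<lambda>_. 0"])
  then show "dirderiv f v \<in> range (\<lambda>c x. c)" by auto
qed auto

lemma smooth_fun_prod:
  "finite I \<Longrightarrow> (\<And>i. i \<in> I \<Longrightarrow> smooth_fun (f i)) \<Longrightarrow> smooth_fun (\<lambda>x. \<Prod>i\<in>I. f i x)"
  by (induction I rule: finite_induct) (auto intro: smooth_fun_const smooth_fun_mult)

lemma smooth_fun_affine_comp:
  assumes "smooth_fun f" "bounded_linear A"
  shows "smooth_fun (\<lambda>x. f (A x + c))"
proof (rule smooth_fun_coinduct[of _ "{\<lambda>x. f (A x + c) |f. smooth_fun f}"])
  fix g x assume "g \<in> {\<lambda>x. f (A x + c) |f. smooth_fun f}"
  then obtain f where f: "g = (\<lambda>x. f (A x + c))" "smooth_fun f" by auto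
  then show "g differentiable (at x)"
    using has_derivative_affine_comp[OF smooth_fun_differentiable assms(2)]
    by (auto simp: differentiable_def)
next
  fix g v assume "g \<in> {\<lambda>x. f (A x + c) |f. smooth_fun f}"
  then obtain f where f: "g = (\<lambda>x. f (A x + c))" "smooth_fun f" by auto
  then have "dirderiv g v = (\<lambda>x. dirderiv f (A v) (A x + c))"
    using dirderiv_affine_comp[OF smooth_fun_differentiable assms(2)] by auto
  then show "dirderiv g v \<in> {\<lambda>x. f (A x + c) |f. smooth_fun f}"
    using f smooth_fun_dirderiv by auto
qed (use assms in auto)

lemma dirderiv_real: "(f has_real_derivative D) (at x) \<Longrightarrow> dirderiv f v x = D * v"
  unfolding has_field_derivative_def by (rule dirderiv_eqI)

text \<open>Adjoining \<open>F\<close> to the smooth functions gives a class closed under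
  \<open>dirderiv\<close>, because the derivative of \<open>F\<close> in direction \<open>v\<close>
  is \<open>f * v\<close>.\<close>

lemma smooth_fun_primitive:
  assumes "smooth_fun f" "\<And>x. (F has_real_derivative f x) (at x)"
  shows "smooth_fun F"
proof (rule smooth_fun_coinduct[of _ "insert F {f. smooth_fun f}"])
  fix g :: "real \<Rightarrow> real" and v assume "g \<in> insert F {f. smooth_fun f}"
  moreover have "dirderiv F v = (\<lambda>x. f x * v)"
    by (auto intro!: dirderiv_real assms)
  ultimately show "dirderiv g v \<in> insert F {f. smooth_fun f}"
    using smooth_fun_mult[OF assms(1) smooth_fun_const[of v]] by (auto intro: smooth_fun_dirderiv)
next
  fix g :: "real \<Rightarrow> real" and x :: real assume "g \<in> insert F {f. smooth_fun f}"
  then show "g differentiable (at x)"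
    by (metis assms(2) insert_iff mem_Collect_eq real_differentiable_def smooth_fun_differentiable)
qed auto

section \<open>Flat functions, test functions and bumps\<close>

definition flat_exp :: "real poly \<Rightarrow> real \<Rightarrow> real" where
  "flat_exp p t = (if t > 0 then poly p (1 / t) * exp (- 1 / t) else 0)"

lemma poly_exp_tendsto_0: "((\<lambda>s. poly p s * exp (- s)) \<longlongrightarrow> (0::real)) at_top"
proof -
  have 1: "((\<lambda>s::real. s ^ i * exp (- s)) \<longlongrightarrow> 0) at_top" for i
    using tendsto_power_div_exp_0[of i] by (simp add: exp_minus divide_inverse)
  have "((\<lambda>s. \<Sum>i\<le>degree p. coeff p i * (s ^ i * exp (- s))) \<longlongrightarrow>
     (\<Sum>i\<le>degree p. coeff p i * 0)) at_top"
    by (intro tendsto_sum tendsto_mult tendsto_const 1)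
  then show ?thesis
    by (simp add: poly_altdef sum_distrib_right mult.assoc)
qed

text \<open>With \<open>s = 1 / t\<close>, differentiating \<open>p(s) exp(-s)\<close> in
  \<open>t\<close> gives \<open>s^2 (p(s) - p'(s)) exp(-s)\<close>; \<open>[:0,0,1:]\<close> is the
  factor \<open>s^2\<close>. The polynomial is carried along because it makes the family closed
  under differentiation.\<close>

lemma flat_exp_has_derivative:
  "(flat_exp p has_real_derivative flat_exp ([:0,0,1:] * (p - pderiv p)) t) (at t)"
proof (cases t "0::real" rule: linorder_cases)
  case less
  have "((\<lambda>t. 0) has_real_derivative 0) (at t)" by simp
  then have "(flat_exp p has_real_derivative 0) (at t)"
    by (rule has_field_derivative_transform_within_open[where S="{..<0}"])
       (use less in \<open>auto simp: flat_exp_def\<close>)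
  then show ?thesis using less by (simp add: flat_exp_def)
next
  case greater
  have "((\<lambda>t. poly p (1/t) * exp (-1/t)) has_real_derivative
      poly (pderiv p) (1/t) * (- (1/t^2)) * exp (-1/t) + poly p (1/t) * (exp (-1/t) * (1/t^2))) (at t)"
    using greater
    by (auto intro!: derivative_eq_intros DERIV_chain2[OF poly_DERIV]
        simp: power2_eq_square field_simps)
  then have "(flat_exp p has_real_derivative
      poly (pderiv p) (1/t) * (- (1/t^2)) * exp (-1/t) + poly p (1/t) * (exp (-1/t) * (1/t^2))) (at t)"
    by (rule has_field_derivative_transform_within_open[where S="{0<..}"])
       (use greater in \<open>auto simp: flat_exp_def\<close>)
  then show ?thesis using greater 
    by (simp add: flat_exp_def power2_eq_square algebra_simps)
next
  case equal
  have "((\<lambda>h. flat_exp p h / h) \<longlongrightarrow> 0) (at_right 0)"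
  proof -
    \<comment> \<open>Under \<open>h = 1 / s\<close> the quotient \<open>flat_exp p h / h\<close>
      becomes \<open>s p(s) exp(-s)\<close>; \<open>pCons 0 p\<close> supplies the extra factor
      \<open>s\<close>.\<close>
    have "((\<lambda>s. poly (pCons 0 p) s * exp (- s)) \<longlongrightarrow> (0::real)) at_top"
      by (rule poly_exp_tendsto_0)
    then have "((\<lambda>h. poly (pCons 0 p) (inverse h) * exp (- inverse h)) \<longlongrightarrow> (0::real)) (at_right 0)"
      by (rule filterlim_compose) (rule filterlim_inverse_at_top_right)
    then show ?thesis
      by (rule Lim_transform_eventually)
         (auto simp: eventually_at_right_field flat_exp_def field_simps intro!: exI[of _ 1])
  qed
  moreover have "((\<lambda>h. flat_exp p h / h) \<longlongrightarrow> 0) (at_left 0)"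
    by (rule Lim_transform_eventually[OF tendsto_const])
       (auto simp: eventually_at_left_field flat_exp_def intro!: exI[of _ "-1"])
  ultimately have "((\<lambda>h. flat_exp p h / h) \<longlongrightarrow> 0) (at 0)"
    by (rule filterlim_split_at[rotated])
  then show ?thesis
    using equal by (simp add: has_field_derivative_iff flat_exp_def)
qed

lemma smooth_flat_exp: "smooth_fun (flat_exp p)"
proof (rule smooth_fun_coinduct[of _ "{\<lambda>t. flat_exp p t * c |p c. True}"])
  fix f :: "real \<Rightarrow> real" and v assume "f \<in> {\<lambda>t. flat_exp p t * c |p c. True}"
  then obtain p c where f: "f = (\<lambda>t. flat_exp p t * c)" by auto
  have "dirderiv f v = (\<lambda>t. flat_exp ([:0,0,1:] * (p - pderiv p)) t * (c * v))"
    unfolding f using DERIV_cmult_right[OF flat_exp_has_derivative, THEN dirderiv_real]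
    by (auto simp: fun_eq_iff)
  then show "dirderiv f v \<in> {\<lambda>t. flat_exp p t * c |p c. True}" by auto
next
  fix f :: "real \<Rightarrow> real" and x assume "f \<in> {\<lambda>t. flat_exp p t * c |p c. True}"
  then show "f differentiable (at x)"
    using DERIV_cmult_right[OF flat_exp_has_derivative] real_differentiable_def by blast
next
  have "flat_exp p = (\<lambda>t. flat_exp p t * 1)" by auto
  then show "flat_exp p \<in> {\<lambda>t. flat_exp p t * c |p c. True}" by blast
qed

lemma test_funI:
  assumes "smooth_fun f" "\<And>x. f x \<noteq> 0 \<Longrightarrow> x \<in> K" "compact K" "K \<subseteq> S"
  shows "test_fun S f"
proof -
  have "tsupp f \<subseteq> K"
    unfolding tsupp_def using assms by (intro closure_minimal compact_imp_closed) auto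
  moreover have "closed (tsupp f)" by (simp add: tsupp_def)
  ultimately have "compact (tsupp f)"
    using compact_Int_closed[OF assms(3), of "tsupp f"] by (simp add: Int_absorb1)
  with \<open>tsupp f \<subseteq> K\<close> show ?thesis using assms by (auto simp: test_fun_def)
qed

lemma not_in_tsupp: "x \<notin> tsupp f \<Longrightarrow> f x = 0"
  using closure_subset[of "{x. f x \<noteq> 0}"] by (auto simp: tsupp_def)

lemma dirderiv_not_in_tsupp:
  assumes "x \<notin> tsupp f" shows "dirderiv f v x = 0"
proof -
  have "((\<lambda>x. 0) has_derivative (\<lambda>v. 0)) (at x)" by simp
  then have "(f has_derivative (\<lambda>v. 0)) (at x)"
  proof (rule has_derivative_transform_within_open)
    show "open (- tsupp f)" by (simp add: tsupp_def open_Compl)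
  qed (use assms not_in_tsupp[of _ f] in auto)
  then show ?thesis by (rule dirderiv_eqI)
qed

lemma test_fun_dirderiv: "test_fun S f \<Longrightarrow> test_fun S (dirderiv f v)"
  by (rule test_funI[where K="tsupp f"])
    (use dirderiv_not_in_tsupp[of _ f v] in \<open>auto simp: test_fun_def smooth_fun_dirderiv\<close>)

lemma test_fun_smooth: "test_fun S f \<Longrightarrow> smooth_fun f"
  by (simp add: test_fun_def)

lemma test_fun_support:
  assumes "test_fun S f" obtains R where "R > 0" "\<And>x. norm x > R \<Longrightarrow> f x = 0"
proof -
  have "bounded (tsupp f)" using assms by (auto simp: test_fun_def compact_imp_bounded)
  then obtain R where "R > 0" "\<forall>x\<in>tsupp f. norm x \<le> R" by (auto simp: bounded_pos)
  show ?thesis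
  proof (rule that[OF \<open>R > 0\<close>])
    show "f x = 0" if "norm x > R" for x
    proof (rule not_in_tsupp[of x f])
      show "x \<notin> tsupp f" using \<open>\<forall>x\<in>tsupp f. norm x \<le> R\<close> that by (auto simp: not_le[symmetric])
    qed
  qed
qed

lemma test_fun_bounded:
  assumes "test_fun S f" obtains C where "C > 0" "\<And>x. \<bar>f x\<bar> \<le> C"
proof -
  have "compact (f ` tsupp f)"
    using assms by (intro compact_continuous_image smooth_fun_continuous) (auto simp: test_fun_def)
  then obtain C where C: "C > 0" "\<forall>y\<in>f ` tsupp f. norm y \<le> C"
    using compact_imp_bounded[of "f ` tsupp f"] unfolding bounded_pos by auto
  have "\<bar>f x\<bar> \<le> C" for x
    using C not_in_tsupp[of x f] by (cases "x \<in> tsupp f") auto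
  then show ?thesis using C that by blast
qed

lemma test_fun_integrable:
  fixes f :: "'a::euclidean_space \<Rightarrow> real"
  assumes "test_fun S f" shows "integrable lborel f"
proof -
  have "integrable lborel (\<lambda>x. indicator (tsupp f) x *\<^sub>R f x)"
    using assms by (intro borel_integrable_compact smooth_fun_continuous) (auto simp: test_fun_def)
  moreover have "(\<lambda>x. indicator (tsupp f) x *\<^sub>R f x) = f"
    by (auto simp: fun_eq_iff indicator_def not_in_tsupp[of _ f])
  ultimately show ?thesis by simp
qed

lemma bump_function_exists:
  assumes "(\<eta>::real) > 0"
  obtains \<rho> :: "'a::euclidean_space \<Rightarrow> real"
  where "test_fun UNIV \<rho>" "\<And>x. \<rho> x \<ge> 0" "\<And>x. norm x \<ge> \<eta> \<Longrightarrow> \<rho> x = 0" "integral\<^sup>L lborel \<rho> = 1"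
proof -
  \<comment> \<open>The bump lives on a cube of half-side \<open>r\<close>; bounding the norm by the
    sum of the coordinates puts this cube inside the ball of radius \<open>\<eta>\<close>.\<close>
  define r where "r = \<eta> / DIM('a)"
  have r: "r > 0" using assms by (simp add: r_def)
  define B :: "'a \<Rightarrow> real" where
    "B x = (\<Prod>i\<in>Basis. flat_exp 1 (- (x \<bullet> i) + r) * flat_exp 1 ((x \<bullet> i) + r))" for x
  have "smooth_fun (\<lambda>x. flat_exp 1 (- (x \<bullet> i) + r))" "smooth_fun (\<lambda>x. flat_exp 1 ((x \<bullet> i) + r))" for i :: 'a
    by (rule smooth_fun_affine_comp[where A="\<lambda>x. - (x \<bullet> i)" and c=r and f="flat_exp 1"]
          smooth_fun_affine_comp[where A="\<lambda>x. x \<bullet> i" and c=r and f="flat_exp 1"];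
        intro smooth_flat_exp bounded_linear_minus bounded_linear_inner_left)+
  then have sm: "smooth_fun B"
    unfolding B_def by (intro smooth_fun_prod smooth_fun_mult finite_Basis)
  have nn: "B x \<ge> 0" for x
    unfolding B_def by (intro prod_nonneg mult_nonneg_nonneg) (auto simp: flat_exp_def)
  have z: "B x = 0" if "norm x \<ge> \<eta>" for x
  proof -
    have "\<exists>i\<in>Basis. \<bar>x \<bullet> i\<bar> \<ge> r"
    proof (rule ccontr)
      assume "\<not> ?thesis"
      then have "(\<Sum>i\<in>Basis. \<bar>x \<bullet> i\<bar>) < (\<Sum>i\<in>(Basis::'a set). r)"
        by (intro sum_strict_mono) auto
      then show False using norm_le_l1[of x] that by (simp add: r_def)
    qed
    then obtain i where i: "i \<in> Basis" "\<bar>x \<bullet> i\<bar> \<ge> r" by auto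
    then have "- (x \<bullet> i) + r \<le> 0 \<or> (x \<bullet> i) + r \<le> 0" by linarith
    then have "flat_exp 1 (- (x \<bullet> i) + r) * flat_exp 1 ((x \<bullet> i) + r) = 0"
      by (auto simp: flat_exp_def)
    with i(1) show ?thesis unfolding B_def by (intro prod_zero) auto
  qed
  have t: "test_fun UNIV B"
  proof (rule test_funI[where K="cball 0 \<eta>"])
    show "x \<in> cball 0 \<eta>" if "B x \<noteq> 0" for x
      using z[of x] that by (cases "norm x \<ge> \<eta>") auto
  qed (use sm in auto)
  have i: "integrable lborel B" by (rule test_fun_integrable[OF t])
  have "integral\<^sup>L lborel B \<noteq> 0"
  proof
    assume "integral\<^sup>L lborel B = 0"
    then have "AE x in lborel. B x = 0"
      using integral_nonneg_eq_0_iff_AE[OF i] nn by auto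
    then have "{x. B x \<noteq> 0} \<in> null_sets lborel"
      using smooth_fun_borel[OF sm] by (subst AE_iff_null_sets) auto
    then have "negligible {x. B x \<noteq> 0}"
      by (simp add: negligible_iff_null_sets null_sets_completionI)
    moreover have "open {x. B x \<noteq> 0}"
      by (intro open_Collect_neq smooth_fun_continuous sm continuous_on_const)
    moreover have "B 0 > 0"
      unfolding B_def using r by (intro prod_pos) (auto simp: flat_exp_def)
    then have "0 \<in> {x. B x \<noteq> 0}" by simp
    then have "{x. B x \<noteq> 0} \<noteq> {}" by blast
    ultimately show False using open_not_negligible by blast
  qed
  moreover have "integral\<^sup>L lborel B \<ge> 0" using nn by simp
  ultimately have p: "integral\<^sup>L lborel B > 0" by simp
  show ?thesis
  proof
    show "test_fun UNIV (\<lambda>x. inverse (integral\<^sup>L lborel B) * B x)"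
    proof (rule test_funI[where K="cball 0 \<eta>"])
      show "x \<in> cball 0 \<eta>" if "inverse (integral\<^sup>L lborel B) * B x \<noteq> 0" for x
        using z[of x] that by (cases "norm x \<ge> \<eta>") auto
    qed (use smooth_fun_mult[OF smooth_fun_const sm] in auto)
  qed (use nn z p i in auto)
qed

section \<open>Taylor expansion along lines and difference quotients\<close>

lemma line_derivative:
  assumes "smooth_fun f"
  shows "((\<lambda>s. f (x + s *\<^sub>R v)) has_real_derivative dirderiv f v (x + s *\<^sub>R v)) (at s)"
proof -
  have "((\<lambda>s. x + s *\<^sub>R v) has_derivative (\<lambda>s. s *\<^sub>R v)) (at s)"
    by (auto intro!: derivative_eq_intros)
  from has_derivative_compose[OF this smooth_fun_has_derivative[OF assms]]
  have "((\<lambda>s. f (x + s *\<^sub>R v)) has_derivative (\<lambda>h. dirderiv f (h *\<^sub>R v) (x + s *\<^sub>R v))) (at s)" .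
  moreover have "dirderiv f (h *\<^sub>R v) y = h * dirderiv f v y" for h y
    using linear_cmul[OF has_derivative_linear[OF smooth_fun_has_derivative[OF assms]]] by auto
  ultimately show ?thesis by (simp add: has_field_derivative_def mult_commute_abs)
qed

lemma line_taylor:
  assumes "smooth_fun f"
  obtains \<xi> where "f (x + s *\<^sub>R v) = (\<Sum>m<n. iter_deriv f (replicate m v) x / fact m * s ^ m) +
    iter_deriv f (replicate n v) (x + \<xi> *\<^sub>R v) / fact n * s ^ n"
proof -
  have "\<exists>t. \<bar>t\<bar> \<le> \<bar>s\<bar> \<and> f (x + s *\<^sub>R v) =
      (\<Sum>m<n. (iter_deriv f (replicate m v) (x + 0 *\<^sub>R v) / fact m) * s ^ m) + (iter_deriv f (replicate n v) (x + t *\<^sub>R v) / fact n) * s ^ n"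
    by (rule Maclaurin_all_le[where diff = "\<lambda>m s. iter_deriv f (replicate m v) (x + s *\<^sub>R v)"])
       (auto intro!: line_derivative smooth_fun_iter_deriv assms)
  then show ?thesis using that by auto
qed

lemma dirderiv_basis_expansion:
  fixes f :: "'a::euclidean_space \<Rightarrow> real"
  assumes "smooth_fun f"
  shows "dirderiv f v x = (\<Sum>i\<in>Basis. (v \<bullet> i) * dirderiv f i x)"
proof -
  have l: "linear (\<lambda>v. dirderiv f v x)"
    using has_derivative_linear[OF smooth_fun_has_derivative[OF assms]] .
  have "dirderiv f v x = dirderiv f (\<Sum>i\<in>Basis. (v \<bullet> i) *\<^sub>R i) x"
    by (simp add: euclidean_representation)
  also have "\<dots> = (\<Sum>i\<in>Basis. (v \<bullet> i) * dirderiv f i x)"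
    by (subst linear_sum[OF l]) (simp add: linear_cmul[OF l])
  finally show ?thesis .
qed

text \<open>The direction becomes the jump \<open>z\<close> over which the Levy measure integrates,
  so the constant has to be uniform in it. Expanding in a basis reduces the Hessian form to finitely
  many bounded test functions.\<close>

lemma second_derivative_bound:
  fixes f :: "'a::euclidean_space \<Rightarrow> real"
  assumes "test_fun S f"
  obtains C where "C > 0" "\<And>v x. \<bar>dirderiv (dirderiv f v) v x\<bar> \<le> C * (norm v)\<^sup>2"
proof -
  note sm = test_fun_smooth[OF assms]
  have "\<exists>C>0. \<forall>x. \<bar>dirderiv (dirderiv f i) j x\<bar> \<le> C" for i j
    using test_fun_bounded[OF test_fun_dirderiv[OF test_fun_dirderiv[OF assms]]] by metis
  then obtain C where C: "\<And>i j. C i j > 0" "\<And>i j x. \<bar>dirderiv (dirderiv f i) j x\<bar> \<le> C i j"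
    by metis
  define D where "D = (\<Sum>i\<in>Basis. \<Sum>j\<in>Basis. C j i)"
  have "\<bar>dirderiv (dirderiv f v) v x\<bar> \<le> D * (norm v)\<^sup>2" for v x
  proof -
    have "dirderiv (dirderiv f v) v x = (\<Sum>i\<in>Basis. (v \<bullet> i) * dirderiv (dirderiv f v) i x)"
      by (rule dirderiv_basis_expansion) (intro smooth_fun_dirderiv sm)
    also have "\<dots> = (\<Sum>i\<in>Basis. (v \<bullet> i) * (\<Sum>j\<in>Basis. (v \<bullet> j) * dirderiv (dirderiv f j) i x))"
    proof (intro sum.cong refl arg_cong2[where f="(*)"])
      fix i :: 'a
      have d: "((\<lambda>x. \<Sum>j\<in>Basis. (v \<bullet> j) * dirderiv f j x) has_derivative
          (\<lambda>i. \<Sum>j\<in>Basis. (v \<bullet> j) * dirderiv (dirderiv f j) i x)) (at x)"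
        by (intro has_derivative_sum has_derivative_mult_right smooth_fun_has_derivative
            smooth_fun_dirderiv sm)
      have eq: "dirderiv f v = (\<lambda>x. \<Sum>j\<in>Basis. (v \<bullet> j) * dirderiv f j x)"
        by (rule ext) (rule dirderiv_basis_expansion[OF sm])
      show "dirderiv (dirderiv f v) i x = (\<Sum>j\<in>Basis. (v \<bullet> j) * dirderiv (dirderiv f j) i x)"
        by (subst eq) (rule dirderiv_eqI[OF d])
    qed
    finally have eq: "dirderiv (dirderiv f v) v x =
      (\<Sum>i\<in>Basis. (v \<bullet> i) * (\<Sum>j\<in>Basis. (v \<bullet> j) * dirderiv (dirderiv f j) i x))" .
    have "\<bar>\<Sum>j\<in>Basis. (v \<bullet> j) * dirderiv (dirderiv f j) i x\<bar> \<le> (\<Sum>j\<in>Basis. norm v * C j i)" for i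
      by (rule order_trans[OF sum_abs], rule sum_mono)
         (auto simp: abs_mult intro!: mult_mono Basis_le_norm C)
    then have "\<bar>(v \<bullet> i) * (\<Sum>j\<in>Basis. (v \<bullet> j) * dirderiv (dirderiv f j) i x)\<bar>
        \<le> norm v * (\<Sum>j\<in>Basis. norm v * C j i)" if "i \<in> Basis" for i
      unfolding abs_mult using that by (intro mult_mono Basis_le_norm) auto
    then have "\<bar>dirderiv (dirderiv f v) v x\<bar> \<le> (\<Sum>i\<in>Basis. norm v * (\<Sum>j\<in>Basis. norm v * C j i))"
      unfolding eq by (intro order_trans[OF sum_abs] sum_mono) auto
    also have "\<dots> = D * (norm v)\<^sup>2"
      by (simp add: D_def sum_distrib_left sum_distrib_right power2_eq_square mult_ac)
    finally show ?thesis .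
  qed
  moreover have "D > 0" unfolding D_def by (intro sum_pos C) auto
  ultimately show ?thesis using that by blast
qed

lemma taylor_remainder_bound:
  fixes f :: "'a::euclidean_space \<Rightarrow> real"
  assumes "test_fun S f"
  obtains C where "C > 0" "\<And>x z. \<bar>f (x + z) - f x - dirderiv f z x\<bar> \<le> C * (norm z)\<^sup>2"
proof -
  obtain C where C: "C > 0" "\<And>v x. \<bar>dirderiv (dirderiv f v) v x\<bar> \<le> C * (norm v)\<^sup>2"
    using second_derivative_bound[OF assms] by metis
  have "\<bar>f (x + z) - f x - dirderiv f z x\<bar> \<le> C * (norm z)\<^sup>2" for x z
  proof -
    obtain \<xi> where "f (x + 1 *\<^sub>R z) = (\<Sum>m<2. iter_deriv f (replicate m z) x / fact m * 1 ^ m) +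
        iter_deriv f (replicate 2 z) (x + \<xi> *\<^sub>R z) / fact 2 * 1 ^ 2"
      by (rule line_taylor[OF test_fun_smooth[OF assms]])
    then have "\<bar>f (x + z) - f x - dirderiv f z x\<bar> = \<bar>dirderiv (dirderiv f z) z (x + \<xi> *\<^sub>R z)\<bar> / 2"
      by (simp add: numeral_2_eq_2)
    also have "\<dots> \<le> C * (norm z)\<^sup>2" using C(2)[of z "x + \<xi> *\<^sub>R z"] by simp
    finally show ?thesis .
  qed
  then show ?thesis using C that by blast
qed

text \<open>In the Taylor expansions at \<open>h\<close> and \<open>-h\<close> the first-order terms
  cancel, and the third-order remainders leave an error of order \<open>h\<close>, uniform in
  \<open>x\<close>. This is what turns the local part of the operator into translations.\<close>

lemma second_difference_quotient:
  fixes f :: "'a::euclidean_space \<Rightarrow> real"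
  assumes "test_fun S f"
  obtains C where "C > 0" "\<And>x h. h > 0 \<Longrightarrow>
     \<bar>(f (x + h *\<^sub>R v) + f (x - h *\<^sub>R v) - 2 * f x) / h\<^sup>2 - dirderiv (dirderiv f v) v x\<bar> \<le> C * h"
proof -
  obtain C where C: "C > 0" "\<And>x. \<bar>dirderiv (dirderiv (dirderiv f v) v) v x\<bar> \<le> C"
    using test_fun_bounded[OF test_fun_dirderiv[OF test_fun_dirderiv[OF test_fun_dirderiv[OF assms]]]] by metis
  have "\<bar>(f (x + h *\<^sub>R v) + f (x - h *\<^sub>R v) - 2 * f x) / h\<^sup>2 - dirderiv (dirderiv f v) v x\<bar> \<le> C * h"
    if "h > 0" for x h
  proof -
    let ?D = "dirderiv (dirderiv (dirderiv f v) v) v"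
    obtain a where "f (x + h *\<^sub>R v) = (\<Sum>m<3. iter_deriv f (replicate m v) x / fact m * h ^ m) +
        iter_deriv f (replicate 3 v) (x + a *\<^sub>R v) / fact 3 * h ^ 3"
      by (rule line_taylor[OF test_fun_smooth[OF assms]])
    then have a: "f (x + h *\<^sub>R v) = f x + dirderiv f v x * h + dirderiv (dirderiv f v) v x / 2 * h\<^sup>2
        + ?D (x + a *\<^sub>R v) / 6 * h ^ 3"
      by (simp add: numeral_3_eq_3 numeral_2_eq_2)
    obtain b where "f (x + (- h) *\<^sub>R v) = (\<Sum>m<3. iter_deriv f (replicate m v) x / fact m * (- h) ^ m) +
        iter_deriv f (replicate 3 v) (x + b *\<^sub>R v) / fact 3 * (- h) ^ 3"
      by (rule line_taylor[OF test_fun_smooth[OF assms]])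
    then have b: "f (x - h *\<^sub>R v) = f x - dirderiv f v x * h + dirderiv (dirderiv f v) v x / 2 * h\<^sup>2
        - ?D (x + b *\<^sub>R v) / 6 * h ^ 3"
      by (simp add: numeral_3_eq_3 numeral_2_eq_2)
    have eq: "(f (x + h *\<^sub>R v) + f (x - h *\<^sub>R v) - 2 * f x) / h\<^sup>2 - dirderiv (dirderiv f v) v x
        = (?D (x + a *\<^sub>R v) - ?D (x + b *\<^sub>R v)) / 6 * h"
      unfolding a b using that by (simp add: field_simps power2_eq_square power3_eq_cube)
    have "\<bar>(?D (x + a *\<^sub>R v) - ?D (x + b *\<^sub>R v)) / 6 * h\<bar> = \<bar>?D (x + a *\<^sub>R v) - ?D (x + b *\<^sub>R v)\<bar> / 6 * h"
      using that by (simp add: abs_mult)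
    also have "\<dots> \<le> C * h"
      using C(1) C(2)[of "x + a *\<^sub>R v"] C(2)[of "x + b *\<^sub>R v"] that
      by (intro mult_right_mono) auto
    finally show ?thesis unfolding eq .
  qed
  then show ?thesis using C that by blast
qed

lemma smooth_step_exists:
  fixes \<beta> :: "real \<Rightarrow> real"
  assumes "test_fun UNIV \<beta>" "\<And>x. \<beta> x \<ge> 0" "\<And>x. \<bar>x\<bar> \<ge> \<kappa> \<Longrightarrow> \<beta> x = 0" "integral\<^sup>L lborel \<beta> = 1" "\<kappa> > 0"
  obtains \<Theta> where "\<And>r. (\<Theta> has_real_derivative \<beta> r) (at r)" "smooth_fun \<Theta>"
    "\<And>r. r \<le> - \<kappa> \<Longrightarrow> \<Theta> r = 0" "\<And>r. r \<ge> \<kappa> \<Longrightarrow> \<Theta> r = 1" "\<And>r. 0 \<le> \<Theta> r" "\<And>r. \<Theta> r \<le> 1"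
proof -
  \<comment> \<open>Starting one unit left of \<open>-\<kappa>\<close> keeps every
    \<open>r >= -\<kappa>\<close> in the interior of \<open>{- \<kappa> - 1..r + 1}\<close>, where
    the derivative within the interval is the full derivative.\<close>
  define \<Theta> where "\<Theta> r = integral {- \<kappa> - 1..r} \<beta>" for r
  have c: "continuous_on A \<beta>" for A
    using assms(1) by (intro smooth_fun_continuous test_fun_smooth)
  have z: "\<Theta> r = 0" if "r \<le> - \<kappa>" for r
  proof -
    have "integral {- \<kappa> - 1..r} \<beta> = integral {- \<kappa> - 1..r} (\<lambda>_. 0)"
      by (rule integral_cong) (use assms(3) that assms(5) in auto)
    then show ?thesis by (simp add: \<Theta>_def)
  qed
  have d: "(\<Theta> has_real_derivative \<beta> r) (at r)" for r
  proof (cases "r < - \<kappa>")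
    case True
    have "((\<lambda>_. 0) has_real_derivative 0) (at r)" by simp
    then have "(\<Theta> has_real_derivative 0) (at r)"
      by (rule has_field_derivative_transform_within_open[where S="{..<-\<kappa>}"]) (use True z in auto)
    then show ?thesis using True assms(3)[of r] assms(5) by simp
  next
    case False
    have "(\<Theta> has_real_derivative \<beta> r) (at r within {- \<kappa> - 1..r + 1})"
      unfolding \<Theta>_def by (rule integral_has_real_derivative) (use False c in auto)
    moreover have "r \<in> interior {- \<kappa> - 1..r + 1}" using False by auto
    ultimately show ?thesis by (metis at_within_interior)
  qed
  have mono: "\<Theta> a \<le> \<Theta> b" if "a \<le> b" for a b
    by (rule DERIV_nonneg_imp_nondecreasing[OF that]) (use d assms(2) in blast)
  have i: "integrable lborel \<beta>" by (rule test_fun_integrable[OF assms(1)])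
  have one: "\<Theta> r = 1" if "r \<ge> \<kappa>" for r
  proof -
    have "(\<beta> has_integral 1) UNIV"
      using has_integral_integral_lborel[OF i] assms(4) by simp
    moreover have "(\<lambda>x. if x \<in> {- \<kappa> - 1..r} then \<beta> x else 0) = \<beta>"
      using assms(3,5) that by (auto simp: fun_eq_iff)
    ultimately have "(\<beta> has_integral 1) {- \<kappa> - 1..r}"
      by (metis has_integral_restrict_UNIV)
    then show ?thesis by (simp add: \<Theta>_def integral_unique)
  qed
  show ?thesis
  proof
    show "smooth_fun \<Theta>" by (rule smooth_fun_primitive[OF test_fun_smooth[OF assms(1)] d])
    show "0 \<le> \<Theta> r" for r
      using mono[of "- \<kappa>" r] mono[of r "-\<kappa>"] z[of r] z[of "-\<kappa>"] by (cases "r \<le> - \<kappa>") auto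
    show "\<Theta> r \<le> 1" for r
      using mono[of r "\<kappa>"] one[of r] one[of "\<kappa>"] by (cases "r \<ge> \<kappa>") auto
  qed (use d z one in auto)
qed

section \<open>Symmetric translation-invariant operators\<close>

lemma lborel_distr_shift: "distr lborel borel (\<lambda>x. t + x) = (lborel :: 'a::euclidean_space measure)"
  using lborel_affine[of 1 t] by (simp add: density_1)

lemma lborel_distr_reflect: "distr lborel borel (\<lambda>x. t - x) = (lborel :: 'a::euclidean_space measure)"
  using lborel_affine[of "-1" t] by (simp add: density_1)

lemma
  fixes f :: "'a::euclidean_space \<Rightarrow> real"
  assumes [measurable]: "f \<in> borel_measurable borel"
  shows integral_shift: "(LBINT x. f (t + x)) = integral\<^sup>L lborel f"
    and integrable_shift: "integrable lborel (\<lambda>x. f (t + x)) \<longleftrightarrow> integrable lborel f"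
    and integral_reflect: "(LBINT x. f (t - x)) = integral\<^sup>L lborel f"
    and integrable_reflect: "integrable lborel (\<lambda>x. f (t - x)) \<longleftrightarrow> integrable lborel f"
proof -
  show "(LBINT x. f (t + x)) = integral\<^sup>L lborel f"
    by (subst (2) lborel_distr_shift[of t, symmetric]) (simp add: integral_distr)
  show "integrable lborel (\<lambda>x. f (t + x)) \<longleftrightarrow> integrable lborel f"
    by (subst (2) lborel_distr_shift[of t, symmetric]) (simp add: integrable_distr_eq)
  show "(LBINT x. f (t - x)) = integral\<^sup>L lborel f"
    by (subst (2) lborel_distr_reflect[of t, symmetric]) (simp add: integral_distr)
  show "integrable lborel (\<lambda>x. f (t - x)) \<longleftrightarrow> integrable lborel f"
    by (subst (2) lborel_distr_reflect[of t, symmetric]) (simp add: integrable_distr_eq)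
qed

text \<open>Bounds hold at every point, not almost everywhere: the operators below act on functions
  rather than classes, and their values are compared pointwise in sup norm.\<close>

definition bounded_borel :: "('a::euclidean_space \<Rightarrow> real) \<Rightarrow> bool" where
  "bounded_borel f \<longleftrightarrow> f \<in> borel_measurable borel \<and> (\<exists>C. \<forall>x. \<bar>f x\<bar> \<le> C)"

lemma bounded_borelI: "f \<in> borel_measurable borel \<Longrightarrow> (\<And>x. \<bar>f x\<bar> \<le> C) \<Longrightarrow> bounded_borel f"
  by (auto simp: bounded_borel_def)

lemma bounded_borelE:
  assumes "bounded_borel f" obtains C where "C \<ge> 0" "\<And>x. \<bar>f x\<bar> \<le> C"
proof -
  obtain C where "\<And>x. \<bar>f x\<bar> \<le> C" using assms by (auto simp: bounded_borel_def)
  moreover from this[of undefined] have "C \<ge> 0" by linarith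
  ultimately show ?thesis using that by blast
qed

lemma bounded_borel_measurable [measurable_dest]: "bounded_borel f \<Longrightarrow> f \<in> borel_measurable borel"
  by (simp add: bounded_borel_def)

lemma bounded_borel_lincomb:
  assumes "bounded_borel f" "bounded_borel g"
  shows "bounded_borel (\<lambda>x. a * f x + b * g x)"
proof -
  obtain C where C: "\<And>x. \<bar>f x\<bar> \<le> C" using assms(1) by (auto simp: bounded_borel_def)
  obtain D where D: "\<And>x. \<bar>g x\<bar> \<le> D" using assms(2) by (auto simp: bounded_borel_def)
  show ?thesis
  proof (rule bounded_borelI)
    show "(\<lambda>x. a * f x + b * g x) \<in> borel_measurable borel" using assms by measurable
    show "\<bar>a * f x + b * g x\<bar> \<le> \<bar>a\<bar> * C + \<bar>b\<bar> * D" for x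
      by (rule order_trans[OF abs_triangle_ineq])
         (auto simp: abs_mult intro!: add_mono mult_left_mono C D)
  qed
qed

lemma bounded_borel_diff: "bounded_borel f \<Longrightarrow> bounded_borel g \<Longrightarrow> bounded_borel (\<lambda>x. f x - g x)"
  using bounded_borel_lincomb[of f g 1 "-1"] by simp

lemma bounded_borel_cmult: "bounded_borel f \<Longrightarrow> bounded_borel (\<lambda>x. a * f x)"
  using bounded_borel_lincomb[of f f a 0] by simp

lemma integrable_mult_bounded:
  assumes f: "integrable lborel f" and g: "bounded_borel g"
  shows "integrable lborel (\<lambda>x. f x * g x)" "integrable lborel (\<lambda>x. g x * f x)"
proof -
  obtain C where C: "C \<ge> 0" "\<And>x. \<bar>g x\<bar> \<le> C" using g by (auto elim: bounded_borelE)
  have [measurable]: "g \<in> borel_measurable borel" using g by measurable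
  show "integrable lborel (\<lambda>x. f x * g x)"
    by (rule Bochner_Integration.integrable_bound[where f="\<lambda>x. C * \<bar>f x\<bar>"])
       (use f C in \<open>auto simp: abs_mult mult.commute[of "\<bar>f _\<bar>"] intro!: mult_right_mono AE_I2\<close>)
  then show "integrable lborel (\<lambda>x. g x * f x)" by (simp add: mult.commute)
qed

lemma abs_integral_mult_le:
  assumes f: "integrable lborel f" and g: "bounded_borel g" "\<And>x. \<bar>g x\<bar> \<le> C"
  shows "\<bar>LBINT x. f x * g x\<bar> \<le> C * (LBINT x. \<bar>f x\<bar>)"
proof -
  have i: "integrable lborel (\<lambda>x. \<bar>f x * g x\<bar>)" "integrable lborel (\<lambda>x. C * \<bar>f x\<bar>)"
    using f integrable_mult_bounded(1)[OF f g(1)] by auto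
  have "\<bar>LBINT x. f x * g x\<bar> \<le> (LBINT x. C * \<bar>f x\<bar>)"
    by (rule integral_abs_bound[THEN order_trans], rule integral_mono[OF i])
       (use g(2) in \<open>auto simp: abs_mult mult.commute[of "\<bar>f _\<bar>"] intro!: mult_right_mono\<close>)
  then show ?thesis by simp
qed

section \<open>Convolution with integrable kernels\<close>

definition conv :: "('a::euclidean_space \<Rightarrow> real) \<Rightarrow> ('a \<Rightarrow> real) \<Rightarrow> 'a \<Rightarrow> real" where
  "conv w k y = (LBINT x. w x * k (y - x))"

lemma borel_measurable_conv [measurable]:
  assumes [measurable]: "w \<in> borel_measurable borel" "k \<in> borel_measurable borel"
  shows "conv w k \<in> borel_measurable borel"
  unfolding conv_def by measurable

lemma conv_bound:
  assumes w: "bounded_borel w" "\<And>x. \<bar>w x\<bar> \<le> C" and k: "integrable lborel k"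
  shows "\<bar>conv w k y\<bar> \<le> C * (LBINT x. \<bar>k x\<bar>)"
proof -
  have [measurable]: "k \<in> borel_measurable borel" using k by simp
  have "\<bar>LBINT x. k (y - x) * w x\<bar> \<le> C * (LBINT x. \<bar>k (y - x)\<bar>)"
    by (rule abs_integral_mult_le) (use w k in \<open>auto simp: integrable_reflect\<close>)
  then show ?thesis
    unfolding conv_def using integral_reflect[of "\<lambda>x. \<bar>k x\<bar>" y] by (simp add: mult.commute)
qed

lemma bounded_borel_conv:
  assumes "bounded_borel w" "integrable lborel k"
  shows "bounded_borel (conv w k)"
proof -
  have [measurable]: "k \<in> borel_measurable borel" "w \<in> borel_measurable borel"
    using assms by auto
  obtain C where "\<And>x. \<bar>w x\<bar> \<le> C" using assms by (auto simp: bounded_borel_def)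
  then show ?thesis by (intro bounded_borelI[OF _ conv_bound] assms) auto
qed

lemma integrable_conv_kernel:
  fixes w k :: "'a::euclidean_space \<Rightarrow> real"
  assumes w: "integrable lborel w" and k: "integrable lborel k"
  shows "integrable (lborel \<Otimes>\<^sub>M lborel) (\<lambda>(x, y). w x * k (y - x))"
proof (rule lborel_pair.Fubini_integrable)
  have [measurable]: "k \<in> borel_measurable borel" "w \<in> borel_measurable borel"
    using assms by auto
  show "(\<lambda>(x, y). w x * k (y - x)) \<in> borel_measurable (lborel \<Otimes>\<^sub>M lborel)"
    by measurable
  have 1: "integrable lborel (\<lambda>y. k (y - x))" for x
    using integrable_shift[of k "-x"] k by simp
  have 2: "(LBINT y. \<bar>k (y - x)\<bar>) = (LBINT y. \<bar>k y\<bar>)" for x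
    using integral_shift[of "\<lambda>y. \<bar>k y\<bar>" "-x"] by simp
  show "integrable lborel (\<lambda>x. LBINT y. norm (case (x, y) of (x, y) \<Rightarrow> w x * k (y - x)))"
    using w 1 by (simp add: abs_mult 2)
  show "AE x in lborel. integrable lborel (\<lambda>y. case (x, y) of (x, y) \<Rightarrow> w x * k (y - x))"
    using 1 by auto
qed

lemma
  fixes w k :: "'a::euclidean_space \<Rightarrow> real"
  assumes w: "integrable lborel w" and k: "integrable lborel k"
  shows integrable_conv: "integrable lborel (conv w k)"
    and conv_norm_le: "(LBINT y. \<bar>conv w k y\<bar>) \<le> (LBINT x. \<bar>w x\<bar>) * (LBINT x. \<bar>k x\<bar>)"
proof -
  have [measurable]: "k \<in> borel_measurable borel" "w \<in> borel_measurable borel"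
    using assms by auto
  note K = integrable_conv_kernel[OF w k]
  have K': "integrable (lborel \<Otimes>\<^sub>M lborel) (\<lambda>(x, y). \<bar>w x\<bar> * \<bar>k (y - x)\<bar>)"
    using integrable_conv_kernel[of "\<lambda>x. \<bar>w x\<bar>" "\<lambda>x. \<bar>k x\<bar>"] w k by simp
  show 1: "integrable lborel (conv w k)"
    unfolding conv_def using lborel_pair.integrable_snd[OF K] by simp
  have 2: "(LBINT y. \<bar>k (y - x)\<bar>) = (LBINT y. \<bar>k y\<bar>)" for x
    using integral_shift[of "\<lambda>y. \<bar>k y\<bar>" "-x"] by simp
  have "(LBINT y. \<bar>conv w k y\<bar>) \<le> (LBINT y. LBINT x. \<bar>w x\<bar> * \<bar>k (y - x)\<bar>)"
  proof (rule integral_mono)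
    show "integrable lborel (\<lambda>y. LBINT x. \<bar>w x\<bar> * \<bar>k (y - x)\<bar>)"
      using lborel_pair.integrable_snd[OF K'] by simp
    show "\<bar>conv w k y\<bar> \<le> (LBINT x. \<bar>w x\<bar> * \<bar>k (y - x)\<bar>)" for y
      unfolding conv_def abs_mult[symmetric] by (rule integral_abs_bound)
  qed (use 1 in auto)
  also have "\<dots> = (LBINT x. LBINT y. \<bar>w x\<bar> * \<bar>k (y - x)\<bar>)"
    by (rule lborel_pair.Fubini_integral[OF K'])
  also have "\<dots> = (LBINT x. \<bar>w x\<bar>) * (LBINT x. \<bar>k x\<bar>)"
    by (simp add: 2)
  finally show "(LBINT y. \<bar>conv w k y\<bar>) \<le> (LBINT x. \<bar>w x\<bar>) * (LBINT x. \<bar>k x\<bar>)" .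
qed

text \<open>Abstracts \<open>f \<mapsto> (\<lambda>x. \<integral> f (x + z) + f (x - z) d\<nu>(z))\<close> for a finite measure \<open>\<nu>\<close> of mass \<open>m / 2\<close>; in this
  form the class is visibly stable under nonnegative combinations and powers.\<close>

locale sym_op =
  fixes T :: "('a::euclidean_space \<Rightarrow> real) \<Rightarrow> 'a \<Rightarrow> real" and m :: real
  assumes mass_nonneg: "0 \<le> m"
    and borel: "bounded_borel f \<Longrightarrow> T f \<in> borel_measurable borel"
    and bound: "bounded_borel f \<Longrightarrow> (\<And>x. \<bar>f x\<bar> \<le> C) \<Longrightarrow> \<bar>T f x\<bar> \<le> m * C"
    and lincomb: "bounded_borel f \<Longrightarrow> bounded_borel g \<Longrightarrow>
      T (\<lambda>x. a * f x + b * g x) y = a * T f y + b * T g y"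
    and integrable: "bounded_borel f \<Longrightarrow> integrable lborel f \<Longrightarrow> integrable lborel (T f)"
    and norm_le: "bounded_borel f \<Longrightarrow> integrable lborel f \<Longrightarrow>
      (LBINT x. \<bar>T f x\<bar>) \<le> m * (LBINT x. \<bar>f x\<bar>)"
    and symmetric: "bounded_borel f \<Longrightarrow> integrable lborel f \<Longrightarrow> bounded_borel g \<Longrightarrow>
      (LBINT x. T f x * g x) = (LBINT x. f x * T g x)"
    and lower: "bounded_borel f \<Longrightarrow> integrable lborel f \<Longrightarrow>
      - m * (LBINT x. f x * f x) \<le> (LBINT x. f x * T f x)"
    and conv: "bounded_borel w \<Longrightarrow> bounded_borel k \<Longrightarrow> integrable lborel k \<Longrightarrow>
      T (conv w k) y = conv w (T k) y"
begin

lemma bounded_borel: "bounded_borel f \<Longrightarrow> bounded_borel (T f)"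
  by (metis borel bound bounded_borelE bounded_borelI)

end

lemma sym_op_lincomb:
  assumes "sym_op T m" "sym_op S n" "a \<ge> 0" "b \<ge> 0"
  shows "sym_op (\<lambda>f x. a * T f x + b * S f x) (a * m + b * n)"
proof -
  interpret T: sym_op T m by fact
  interpret S: sym_op S n by fact
  show ?thesis
  proof
    show "0 \<le> a * m + b * n" using assms(3,4) T.mass_nonneg S.mass_nonneg by simp
  next
    fix f :: "'a \<Rightarrow> real" assume f: "bounded_borel f"
    then show "(\<lambda>x. a * T f x + b * S f x) \<in> borel_measurable borel"
      using T.borel S.borel by measurable
    fix C x assume C: "\<And>x. \<bar>f x\<bar> \<le> C"
    have "\<bar>a * T f x + b * S f x\<bar> \<le> a * \<bar>T f x\<bar> + b * \<bar>S f x\<bar>"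
      using assms(3,4) abs_triangle_ineq[of "a * T f x" "b * S f x"] by (simp add: abs_mult)
    also have "\<dots> \<le> a * (m * C) + b * (n * C)"
      by (intro add_mono mult_left_mono T.bound S.bound f C assms(3,4))
    finally show "\<bar>a * T f x + b * S f x\<bar> \<le> (a * m + b * n) * C" by (simp add: algebra_simps)
  next
    fix f g :: "'a \<Rightarrow> real" and c d y assume "bounded_borel f" "bounded_borel g"
    then show "a * T (\<lambda>x. c * f x + d * g x) y + b * S (\<lambda>x. c * f x + d * g x) y =
       c * (a * T f y + b * S f y) + d * (a * T g y + b * S g y)"
      by (simp add: T.lincomb S.lincomb algebra_simps)
  next
    fix f :: "'a \<Rightarrow> real" assume f: "bounded_borel f" "integrable lborel f"
    note i = T.integrable[OF f] S.integrable[OF f]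
    show "integrable lborel (\<lambda>x. a * T f x + b * S f x)" using i by simp
    have "(LBINT x. \<bar>a * T f x + b * S f x\<bar>) \<le> (LBINT x. a * \<bar>T f x\<bar> + b * \<bar>S f x\<bar>)"
    proof (rule integral_mono)
      show "\<bar>a * T f x + b * S f x\<bar> \<le> a * \<bar>T f x\<bar> + b * \<bar>S f x\<bar>" for x
        using assms(3,4) abs_triangle_ineq[of "a * T f x" "b * S f x"] by (simp add: abs_mult)
    qed (use i in auto)
    also have "\<dots> = a * (LBINT x. \<bar>T f x\<bar>) + b * (LBINT x. \<bar>S f x\<bar>)"
      using i by simp
    also have "\<dots> \<le> a * (m * (LBINT x. \<bar>f x\<bar>)) + b * (n * (LBINT x. \<bar>f x\<bar>))"
      by (intro add_mono mult_left_mono T.norm_le S.norm_le f assms(3,4))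
    finally show "(LBINT x. \<bar>a * T f x + b * S f x\<bar>) \<le> (a * m + b * n) * (LBINT x. \<bar>f x\<bar>)"
      by (simp add: algebra_simps)
    note j = integrable_mult_bounded(1)[OF f(2) T.bounded_borel] integrable_mult_bounded(1)[OF f(2) S.bounded_borel]
    have "(LBINT x. f x * (a * T f x + b * S f x))
        = (LBINT x. a * (f x * T f x) + b * (f x * S f x))"
      by (simp add: algebra_simps)
    also have "\<dots> = a * (LBINT x. f x * T f x) + b * (LBINT x. f x * S f x)"
      using j f by simp
    also have "\<dots> \<ge> a * (- m * (LBINT x. f x * f x)) + b * (- n * (LBINT x. f x * f x))"
      by (intro add_mono mult_left_mono T.lower S.lower f assms(3,4))
    finally show "- (a * m + b * n) * (LBINT x. f x * f x) \<le> (LBINT x. f x * (a * T f x + b * S f x))"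
      by (simp add: algebra_simps)
    fix g :: "'a \<Rightarrow> real" assume g: "bounded_borel g"
    have "(LBINT x. (a * T f x + b * S f x) * g x)
        = (LBINT x. a * (T f x * g x) + b * (S f x * g x))"
      by (simp add: algebra_simps)
    also have "\<dots> = a * (LBINT x. T f x * g x) + b * (LBINT x. S f x * g x)"
      using integrable_mult_bounded(1)[OF i(1) g] integrable_mult_bounded(1)[OF i(2) g] by simp
    also have "\<dots> = a * (LBINT x. f x * T g x) + b * (LBINT x. f x * S g x)"
      using T.symmetric S.symmetric f g by simp
    also have "\<dots> = (LBINT x. a * (f x * T g x) + b * (f x * S g x))"
      using j f g by simp
    also have "\<dots> = (LBINT x. f x * (a * T g x + b * S g x))"
      by (simp add: algebra_simps)
    finally show "(LBINT x. (a * T f x + b * S f x) * g x) = (LBINT x. f x * (a * T g x + b * S g x))" .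
  next
    fix w k :: "'a \<Rightarrow> real" and y assume w: "bounded_borel w" and k: "bounded_borel k" "integrable lborel k"
    note i = T.integrable[OF k] S.integrable[OF k]
    then have [measurable]: "T k \<in> borel_measurable borel" "S k \<in> borel_measurable borel" by auto
    have c: "integrable lborel (\<lambda>x. w x * T k (y - x))" "integrable lborel (\<lambda>x. w x * S k (y - x))"
      by (intro integrable_mult_bounded(2)[OF _ w]; use i in \<open>simp add: integrable_reflect\<close>)+
    have "conv w (\<lambda>x. a * T k x + b * S k x) y
        = (LBINT x. a * (w x * T k (y - x)) + b * (w x * S k (y - x)))"
      unfolding conv_def by (simp add: algebra_simps)
    also have "\<dots> = a * conv w (T k) y + b * conv w (S k) y"
      unfolding conv_def using c by simp
    finally have "conv w (\<lambda>x. a * T k x + b * S k x) y = a * conv w (T k) y + b * conv w (S k) y" .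
    then show "a * T (conv w k) y + b * S (conv w k) y = conv w (\<lambda>x. a * T k x + b * S k x) y"
      by (simp add: T.conv[OF w k] S.conv[OF w k])
  qed
qed

lemma sym_op_id: "sym_op (\<lambda>f. f) 1"
  by standard (auto simp: bounded_borel_def)

lemma sym_op_sum:
  assumes "finite I" "\<And>i. i \<in> I \<Longrightarrow> sym_op (T i) (m i)"
  shows "sym_op (\<lambda>f x. \<Sum>i\<in>I. T i f x) (\<Sum>i\<in>I. m i)"
  using assms
proof (induction I rule: finite_induct)
  case empty
  show ?case using sym_op_lincomb[OF sym_op_id sym_op_id, of 0 0] by simp
next
  case (insert i I)
  then show ?case using sym_op_lincomb[of "T i" "m i" "\<lambda>f x. \<Sum>i\<in>I. T i f x" "\<Sum>i\<in>I. m i" 1 1] by simp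
qed

lemma integrable_finite_pairI:
  fixes F :: "'b \<times> 'a::euclidean_space \<Rightarrow> real"
  assumes "finite_measure \<nu>" and [measurable]: "F \<in> borel_measurable (\<nu> \<Otimes>\<^sub>M lborel)"
    and i: "\<And>z. integrable lborel (\<lambda>x. F (z, x))" and D: "\<And>z. (LBINT x. \<bar>F (z, x)\<bar>) \<le> D"
  shows "integrable (\<nu> \<Otimes>\<^sub>M lborel) F"
proof -
  interpret finite_measure \<nu> by fact
  interpret pair_sigma_finite \<nu> lborel ..
  show ?thesis
  proof (rule Fubini_integrable)
    show "integrable \<nu> (\<lambda>z. LBINT x. norm (F (z, x)))"
      by (rule integrable_const_bound[where B=D]) (use D in auto)
  qed (use i in auto)
qed

lemma abs_integral_finite_le:
  assumes "finite_measure \<nu>" "sets \<nu> = sets borel" "\<And>z. \<bar>g z\<bar> \<le> C" "C \<ge> 0"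
  shows "\<bar>\<integral>z. g z \<partial>\<nu>\<bar> \<le> measure \<nu> UNIV * (C::real)"
proof -
  interpret finite_measure \<nu> by fact
  have s: "space \<nu> = UNIV" using sets_eq_imp_space_eq[OF assms(2)] by simp
  have "\<bar>\<integral>z. g z \<partial>\<nu>\<bar> \<le> (\<integral>z. C \<partial>\<nu>)"
  proof (cases "integrable \<nu> g")
    case True
    then show ?thesis
      by (intro integral_abs_bound[THEN order_trans] integral_mono) (use assms(3) in auto)
  qed (use assms(4) in \<open>simp add: not_integrable_integral_eq\<close>)
  then show ?thesis by (simp add: s)
qed

text \<open>Translations by \<open>z\<close> and by \<open>-z\<close> are adjoint, so summing both
  makes the average symmetric whatever \<open>\<nu>\<close> is. The rest is Fubini, which the finite
  mass of \<open>\<nu>\<close> makes available.\<close>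

lemma sym_op_translations:
  fixes \<nu> :: "'a::euclidean_space measure"
  assumes fin: "finite_measure \<nu>" and sets: "sets \<nu> = sets borel"
  shows "sym_op (\<lambda>f x. \<integral>z. f (x + z) + f (x - z) \<partial>\<nu>) (2 * measure \<nu> UNIV)"
proof -
  interpret finite_measure \<nu> by fact
  interpret pair_sigma_finite \<nu> lborel ..
  note [measurable_cong] = sets
  have s: "space \<nu> = UNIV" using sets_eq_imp_space_eq[OF sets] by simp
  let ?T = "\<lambda>f x. \<integral>z. f (x + z) + f (x - z) \<partial>\<nu>"
  have bnd: "\<bar>?T f x\<bar> \<le> 2 * measure \<nu> UNIV * C" if "\<And>x. \<bar>f x\<bar> \<le> C" for f :: "'a \<Rightarrow> real" and C x
  proof -
    have "C \<ge> 0" using that[of x] by linarith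
    have "\<bar>f (x + z) + f (x - z)\<bar> \<le> 2 * C" for z
      using that[of "x + z"] that[of "x - z"] by linarith
    then have "\<bar>?T f x\<bar> \<le> measure \<nu> UNIV * (2 * C)"
      using \<open>C \<ge> 0\<close> by (intro abs_integral_finite_le[OF fin sets]) auto
    then show ?thesis by (simp add: mult.assoc mult.left_commute)
  qed
  have iz: "integrable \<nu> (\<lambda>z. f (x + z))" "integrable \<nu> (\<lambda>z. f (x - z))"
    if "bounded_borel f" for f :: "'a \<Rightarrow> real" and x
  proof -
    have [measurable]: "f \<in> borel_measurable borel" using that by measurable
    from that obtain C where "\<And>x. \<bar>f x\<bar> \<le> C" by (auto simp: bounded_borel_def)
    then show "integrable \<nu> (\<lambda>z. f (x + z))" "integrable \<nu> (\<lambda>z. f (x - z))"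
      by (auto intro!: integrable_const_bound[where B=C])
  qed
  have borel: "?T f \<in> borel_measurable borel" if "bounded_borel f" for f :: "'a \<Rightarrow> real"
  proof -
    have [measurable]: "f \<in> borel_measurable borel" using that by measurable
    show ?thesis by measurable
  qed
  have tr: "integrable lborel (\<lambda>x. f (x + z))" "integrable lborel (\<lambda>x. f (x - z))"
    "(LBINT x. f (x + z)) = integral\<^sup>L lborel f"
    "(LBINT x. f (x - z)) = integral\<^sup>L lborel f"
    if "integrable lborel f" for f :: "'a \<Rightarrow> real" and z
  proof -
    have [measurable]: "f \<in> borel_measurable borel" using that by simp
    show "integrable lborel (\<lambda>x. f (x + z))" "integrable lborel (\<lambda>x. f (x - z))"
    "(LBINT x. f (x + z)) = integral\<^sup>L lborel f"
    "(LBINT x. f (x - z)) = integral\<^sup>L lborel f"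
      using integrable_shift[of f z] integrable_shift[of f "-z"] integral_shift[of f z] integral_shift[of f "-z"] that
      by (simp_all add: add.commute)
  qed
  have pr: "integrable (\<nu> \<Otimes>\<^sub>M lborel) (\<lambda>(z, x). (f (x + z) + f (x - z)) * g x)"
    if f: "integrable lborel f" and g: "bounded_borel g" for f g :: "'a \<Rightarrow> real"
  proof -
    have [measurable]: "f \<in> borel_measurable borel" using f by simp
    have [measurable]: "g \<in> borel_measurable borel" using g by measurable
    obtain C where C: "C \<ge> 0" "\<And>x. \<bar>g x\<bar> \<le> C" using g by (auto elim: bounded_borelE)
    show ?thesis
    proof (rule integrable_finite_pairI[OF fin, where D="2 * C * (LBINT x. \<bar>f x\<bar>)"])
    show "(\<lambda>(z, x). (f (x + z) + f (x - z)) * g x) \<in> borel_measurable (\<nu> \<Otimes>\<^sub>M lborel)" by measurable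
    have i: "integrable lborel (\<lambda>x. f (x + z) + f (x - z))" for z using tr[OF f] by simp
    then show i2: "integrable lborel (\<lambda>x. case (z, x) of (z, x) \<Rightarrow> (f (x + z) + f (x - z)) * g x)" for z
      using integrable_mult_bounded(1)[OF i g] by simp
    show "(LBINT x. \<bar>case (z, x) of (z, x) \<Rightarrow> (f (x + z) + f (x - z)) * g x\<bar>) \<le> 2 * C * (LBINT x. \<bar>f x\<bar>)" for z
    proof -
      have f': "integrable lborel (\<lambda>x. \<bar>f x\<bar>)" using f by simp
      have "(LBINT x. \<bar>(f (x + z) + f (x - z)) * g x\<bar>) \<le> (LBINT x. C * (\<bar>f (x + z)\<bar> + \<bar>f (x - z)\<bar>))"
      proof (rule integral_mono)
        show "\<bar>(f (x + z) + f (x - z)) * g x\<bar> \<le> C * (\<bar>f (x + z)\<bar> + \<bar>f (x - z)\<bar>)" for x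
          unfolding abs_mult by (subst mult.commute) (intro mult_mono C, auto)
      qed (use i2[of z] tr[OF f'] in auto)
      also have "\<dots> = 2 * C * (LBINT x. \<bar>f x\<bar>)"
        using tr[OF f'] by simp
      finally show ?thesis by simp
    qed
    qed
  qed
  show ?thesis
  proof
    fix f :: "'a \<Rightarrow> real" assume f: "bounded_borel f"
    show "?T f \<in> borel_measurable borel" by (rule borel[OF f])
    fix C x assume "\<And>x. \<bar>f x\<bar> \<le> C"
    then show "\<bar>?T f x\<bar> \<le> 2 * measure \<nu> UNIV * C" by (rule bnd)
  next
    fix f g :: "'a \<Rightarrow> real" and a b y assume f: "bounded_borel f" and g: "bounded_borel g"
    show "?T (\<lambda>x. a * f x + b * g x) y = a * ?T f y + b * ?T g y"
    proof -
      have "?T (\<lambda>x. a * f x + b * g x) y =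
          (\<integral>z. a * (f (y + z) + f (y - z)) + b * (g (y + z) + g (y - z)) \<partial>\<nu>)"
        by (simp add: algebra_simps)
      also have "\<dots> = a * ?T f y + b * ?T g y"
        using iz[OF f] iz[OF g] by simp
      finally show ?thesis .
    qed
  next
    fix f :: "'a \<Rightarrow> real" assume f: "bounded_borel f" "integrable lborel f"
    have one: "bounded_borel (\<lambda>_::'a. 1::real)" by (rule bounded_borelI[where C=1]) auto
    have "integrable (\<nu> \<Otimes>\<^sub>M lborel) (\<lambda>(z, x). (f (x + z) + f (x - z)) * 1)"
      by (rule pr[OF f(2) one])
    then have p: "integrable (\<nu> \<Otimes>\<^sub>M lborel) (\<lambda>(z, x). f (x + z) + f (x - z))" by simp
    show i: "integrable lborel (?T f)" using integrable_snd[OF p] .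
    have f': "integrable lborel (\<lambda>x. \<bar>f x\<bar>)" "bounded_borel (\<lambda>x. \<bar>f x\<bar>)"
      using f by (auto simp: bounded_borel_def)
    have "integrable (\<nu> \<Otimes>\<^sub>M lborel) (\<lambda>(z, x). (\<bar>f (x + z)\<bar> + \<bar>f (x - z)\<bar>) * 1)"
      by (rule pr[OF f'(1) one])
    then have p': "integrable (\<nu> \<Otimes>\<^sub>M lborel) (\<lambda>(z, x). \<bar>f (x + z)\<bar> + \<bar>f (x - z)\<bar>)" by simp
    have "(LBINT x. \<bar>?T f x\<bar>) \<le> (LBINT x. \<integral>z. \<bar>f (x + z)\<bar> + \<bar>f (x - z)\<bar> \<partial>\<nu>)"
    proof (rule integral_mono)
      show "integrable lborel (\<lambda>x. \<integral>z. \<bar>f (x + z)\<bar> + \<bar>f (x - z)\<bar> \<partial>\<nu>)" using integrable_snd[OF p'] .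
      show "\<bar>?T f x\<bar> \<le> (\<integral>z. \<bar>f (x + z)\<bar> + \<bar>f (x - z)\<bar> \<partial>\<nu>)" for x
        using iz[OF f(1), of x] iz[OF f'(2), of x]
        by (intro integral_abs_bound[THEN order_trans] integral_mono) auto
    qed (use i in simp)
    also have "\<dots> = (\<integral>z. (LBINT x. \<bar>f (x + z)\<bar> + \<bar>f (x - z)\<bar>) \<partial>\<nu>)"
      by (rule Fubini_integral[OF p'])
    also have "\<dots> = 2 * measure \<nu> UNIV * (LBINT x. \<bar>f x\<bar>)"
      using tr[OF f'(1)] by (simp add: s)
    finally show "(LBINT x. \<bar>?T f x\<bar>) \<le> 2 * measure \<nu> UNIV * (LBINT x. \<bar>f x\<bar>)" .
    note pf = pr[OF f(2) f(1)]
    have ff: "integrable lborel (\<lambda>x. f x * f x)" by (rule integrable_mult_bounded(1)[OF f(2,1)])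
    have "- 2 * (LBINT x. f x * f x) \<le> (LBINT x. (f (x + z) + f (x - z)) * f x)" for z
    proof -
      \<comment> \<open>Translation invariance spreads \<open>2 f^2\<close> over
        \<open>f(x + z)^2 / 2\<close>, \<open>f(x - z)^2 / 2\<close> and \<open>f(x)^2\<close>,
        after which the pointwise bound amounts to
        \<open>(f(x + z) + f(x))^2 + (f(x - z) + f(x))^2 >= 0\<close>.\<close>
      have "- 2 * (LBINT x. f x * f x) =
        (LBINT x. - ((1/2) * (f (x + z) * f (x + z)) + (1/2) * (f (x - z) * f (x - z)) + f x * f x))"
        using tr[OF ff, of z] ff by simp
      also have "\<dots> \<le> (LBINT x. (f (x + z) + f (x - z)) * f x)"
      proof (rule integral_mono)
        show "integrable lborel (\<lambda>x. (f (x + z) + f (x - z)) * f x)"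
          using integrable_mult_bounded(1)[OF _ f(1)] tr[OF f(2)] by simp
        show "- ((1/2) * (f (x + z) * f (x + z)) + (1/2) * (f (x - z) * f (x - z)) + f x * f x) \<le> (f (x + z) + f (x - z)) * f x" for x
          using zero_le_power2[of "f (x + z) + f x"] zero_le_power2[of "f (x - z) + f x"]
          by (simp add: power2_eq_square algebra_simps)
      qed (use tr[OF ff, of z] ff in simp)
      finally show ?thesis .
    qed
    then have "(\<integral>z. - 2 * (LBINT x. f x * f x) \<partial>\<nu>) \<le> (\<integral>z. (LBINT x. (f (x + z) + f (x - z)) * f x) \<partial>\<nu>)"
      by (intro integral_mono) (use integrable_fst[OF pf] in auto)
    also have "\<dots> = (LBINT x. \<integral>z. (f (x + z) + f (x - z)) * f x \<partial>\<nu>)"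
      by (rule Fubini_integral[OF pf, symmetric])
    finally show "- (2 * measure \<nu> UNIV) * (LBINT x. f x * f x) \<le> (LBINT x. f x * ?T f x)"
      by (simp add: s mult.commute)
    fix g :: "'a \<Rightarrow> real" assume g: "bounded_borel g"
    note pg = pr[OF f(2) g]
    have pg': "integrable (\<nu> \<Otimes>\<^sub>M lborel) (\<lambda>(z, x). f x * (g (x + z) + g (x - z)))"
    proof -
      have [measurable]: "f \<in> borel_measurable borel" "g \<in> borel_measurable borel" using f g by measurable
      obtain C where C: "\<And>x. \<bar>g x\<bar> \<le> C" using g by (auto simp: bounded_borel_def)
      show ?thesis
      proof (rule integrable_finite_pairI[OF fin, where D="2 * C * (LBINT x. \<bar>f x\<bar>)"])
      show "(\<lambda>(z, x). f x * (g (x + z) + g (x - z))) \<in> borel_measurable (\<nu> \<Otimes>\<^sub>M lborel)" by measurable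
      have b2: "\<bar>g (x + z) + g (x - z)\<bar> \<le> 2 * C" for x z
        using C[of "x + z"] C[of "x - z"] by linarith
      then have b1: "bounded_borel (\<lambda>x. g (x + z) + g (x - z))" for z
        by (intro bounded_borelI[where C="2*C"]) auto
      note b = b1 b2
      show "integrable lborel (\<lambda>x. case (z, x) of (z, x) \<Rightarrow> f x * (g (x + z) + g (x - z)))" for z
        using integrable_mult_bounded(1)[OF f(2) b(1)] by simp
      show "(LBINT x. \<bar>case (z, x) of (z, x) \<Rightarrow> f x * (g (x + z) + g (x - z))\<bar>) \<le> 2 * C * (LBINT x. \<bar>f x\<bar>)" for z
      proof -
        have "bounded_borel (\<lambda>x. \<bar>g (x + z) + g (x - z)\<bar>)" using b(1)[of z] by (auto simp: bounded_borel_def)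
        from abs_integral_mult_le[OF f'(1) this, of "2 * C"] b(2)[of _ z]
        show ?thesis by (simp add: abs_mult)
      qed
      qed
    qed
    have eq: "(LBINT x. (f (x + z) + f (x - z)) * g x) = (LBINT x. f x * (g (x + z) + g (x - z)))" for z
    proof -
      have [measurable]: "f \<in> borel_measurable borel" "g \<in> borel_measurable borel" using f g by measurable
      have sg: "bounded_borel (\<lambda>x. g (x + c))" for c using g by (auto simp: bounded_borel_def)
      have *: "integrable lborel (\<lambda>x. f x * g (x + c))" "integrable lborel (\<lambda>x. f (x + c) * g x)"
        "(LBINT x. f (x + c) * g x) = (LBINT x. f x * g (x - c))" for c
      proof -
        show "integrable lborel (\<lambda>x. f x * g (x + c))"
          by (rule integrable_mult_bounded(1)[OF f(2) sg])
        show "integrable lborel (\<lambda>x. f (x + c) * g x)"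
          by (rule integrable_mult_bounded(1)[OF tr(1)[OF f(2)] g])
        show "(LBINT x. f (x + c) * g x) = (LBINT x. f x * g (x - c))"
          using integral_shift[of "\<lambda>x. f x * g (x - c)" c] by (simp add: add.commute)
      qed
      show ?thesis using *[of z] *[of "-z"] by (simp add: algebra_simps)
    qed
    have "(LBINT x. ?T f x * g x) = (LBINT x. \<integral>z. (f (x + z) + f (x - z)) * g x \<partial>\<nu>)" by simp
    also have "\<dots> = (\<integral>z. (LBINT x. (f (x + z) + f (x - z)) * g x) \<partial>\<nu>)"
      by (rule Fubini_integral[OF pg])
    also have "\<dots> = (\<integral>z. (LBINT x. f x * (g (x + z) + g (x - z))) \<partial>\<nu>)" by (simp only: eq)
    also have "\<dots> = (LBINT x. \<integral>z. f x * (g (x + z) + g (x - z)) \<partial>\<nu>)"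
      by (rule Fubini_integral[OF pg', symmetric])
    also have "\<dots> = (LBINT x. f x * ?T g x)" by simp
    finally show "(LBINT x. ?T f x * g x) = (LBINT x. f x * ?T g x)" .
  next
    fix w k :: "'a \<Rightarrow> real" and y assume w: "bounded_borel w" and k: "bounded_borel k" "integrable lborel k"
    have [measurable]: "w \<in> borel_measurable borel" "k \<in> borel_measurable borel" using w k by measurable
    \<comment> \<open>Reflecting the kernel turns the convolutions at \<open>y + z\<close> and
      \<open>y - z\<close> into translates of one integrable function paired with \<open>w\<close>,
      so that \<open>pr\<close> provides the integrability for Fubini.\<close>
    define k' where "k' x = k (y - x)" for x
    have k': "integrable lborel k'" using k by (simp add: k'_def[abs_def] integrable_reflect)
    have wk: "integrable lborel (\<lambda>x. w x * k (c - x))" for c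
      by (rule integrable_mult_bounded(2)[OF _ w]) (use k in \<open>simp add: integrable_reflect\<close>)
    have "?T (conv w k) y = (\<integral>z. (LBINT x. (k' (x + z) + k' (x - z)) * w x) \<partial>\<nu>)"
    proof (rule Bochner_Integration.integral_cong[OF refl])
      fix z
      have "conv w k (y + z) + conv w k (y - z) = (LBINT x. w x * k (y + z - x) + w x * k (y - z - x))"
        unfolding conv_def using wk by simp
      also have "\<dots> = (LBINT x. (k' (x + z) + k' (x - z)) * w x)"
        by (simp add: k'_def algebra_simps)
      finally show "conv w k (y + z) + conv w k (y - z) = (LBINT x. (k' (x + z) + k' (x - z)) * w x)" .
    qed
    also have "\<dots> = (LBINT x. \<integral>z. (k' (x + z) + k' (x - z)) * w x \<partial>\<nu>)"
      by (rule Fubini_integral[OF pr[OF k' w], symmetric])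
    also have "\<dots> = conv w (?T k) y"
    proof -
      have "(k' (x + z) + k' (x - z)) * w x = w x * (k (y - x + z) + k (y - x - z))" for x z
        by (simp add: k'_def algebra_simps)
      then have "(\<integral>z. (k' (x + z) + k' (x - z)) * w x \<partial>\<nu>) = w x * ?T k (y - x)" for x
        by (simp only: Bochner_Integration.integral_mult_right_zero)
      then show ?thesis by (simp only: conv_def)
    qed
    finally show "?T (conv w k) y = conv w (?T k) y" .
  qed simp
qed

section \<open>Approximate resolvents and the energy pairing\<close>

lemma integral_mult_lincomb:
  fixes f g h :: "'a::euclidean_space \<Rightarrow> real"
  assumes f: "integrable lborel f" and "bounded_borel g" "bounded_borel h"
  shows "(LBINT x. f x * (a * g x + b * h x)) =
    a * (LBINT x. f x * g x) + b * (LBINT x. f x * h x)"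
proof -
  have "(LBINT x. f x * (a * g x + b * h x)) = (LBINT x. a * (f x * g x) + b * (f x * h x))"
    by (simp add: algebra_simps)
  then show ?thesis
    using integrable_mult_bounded(1)[OF f assms(2)] integrable_mult_bounded(1)[OF f assms(3)] by simp
qed

text \<open>Positivity advances two powers at a time: by symmetry one factor \<open>K\<close> moves
  to the left, leaving \<open>\<integral> (K f) (K ^^ n) (K f)\<close>. Positivity is also what
  yields the field \<open>lower\<close> for the powers.\<close>

lemma
  fixes f :: "'a::euclidean_space \<Rightarrow> real"
  assumes "sym_op K 1"
    and psd: "\<And>f :: 'a \<Rightarrow> real. bounded_borel f \<Longrightarrow> integrable lborel f \<Longrightarrow> 0 \<le> (LBINT x. f x * K f x)"
  shows sym_op_funpow: "sym_op (K ^^ k) 1"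
    and psd_funpow: "bounded_borel f \<Longrightarrow> integrable lborel f \<Longrightarrow> 0 \<le> (LBINT x. f x * (K ^^ k) f x)"
proof -
  interpret K: sym_op K 1 by fact
  have bb: "bounded_borel ((K ^^ k) f)" if "bounded_borel f" for f k
    using that by (induction k) (auto intro: K.bounded_borel)
  have P: "0 \<le> (LBINT x. f x * (K ^^ k) f x)"
    if "bounded_borel f" "integrable lborel f" for f k
    using that
  proof (induction k arbitrary: f rule: induct_nat_012)
    case (ge2 n)
    have "(LBINT x. f x * (K ^^ Suc (Suc n)) f x) = (LBINT x. f x * K ((K ^^ n) (K f)) x)"
      by (simp add: funpow_swap1)
    also have "\<dots> = (LBINT x. K f x * (K ^^ n) (K f) x)"
      by (rule K.symmetric[symmetric]) (use ge2 in \<open>auto intro!: bb K.bounded_borel\<close>)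
    also have "\<dots> \<ge> 0"
      by (rule ge2.IH(1)) (use ge2 in \<open>auto intro!: K.bounded_borel K.integrable\<close>)
    finally show ?case .
  qed (use psd in auto)
  show "bounded_borel f \<Longrightarrow> integrable lborel f \<Longrightarrow> 0 \<le> (LBINT x. f x * (K ^^ k) f x)" by (rule P)
  show "sym_op (K ^^ k) 1"
  proof (induction k)
    case 0
    have "K ^^ 0 = (\<lambda>f. f)" by (simp add: fun_eq_iff)
    with sym_op_id show ?case by metis
  next
    case (Suc k)
    interpret S: sym_op "K ^^ k" 1 by fact
    show ?case
    proof
      fix f :: "'a \<Rightarrow> real" and C x assume f: "bounded_borel f" and C: "\<And>x. \<bar>f x\<bar> \<le> C"
      show "\<bar>(K ^^ Suc k) f x\<bar> \<le> 1 * C"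
        using K.bound[OF bb[OF f], of k C x] S.bound[OF f C] by simp
    next
      fix f g :: "'a \<Rightarrow> real" and a b y assume fg: "bounded_borel f" "bounded_borel g"
      have "(K ^^ k) (\<lambda>x. a * f x + b * g x) = (\<lambda>y. a * (K ^^ k) f y + b * (K ^^ k) g y)"
        using S.lincomb[OF fg] by auto
      then show "(K ^^ Suc k) (\<lambda>x. a * f x + b * g x) y = a * (K ^^ Suc k) f y + b * (K ^^ Suc k) g y"
        using K.lincomb[OF bb bb] fg by simp
    next
      fix f :: "'a \<Rightarrow> real" assume f: "bounded_borel f" "integrable lborel f"
      show "integrable lborel ((K ^^ Suc k) f)"
        using K.integrable[OF bb[OF f(1)] S.integrable[OF f]] by simp
      show "(LBINT x. \<bar>(K ^^ Suc k) f x\<bar>) \<le> 1 * (LBINT x. \<bar>f x\<bar>)"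
        using K.norm_le[OF bb[OF f(1)] S.integrable[OF f]] S.norm_le[OF f] by simp
      have "0 \<le> (LBINT x. f x * f x)" by simp
      then show "- 1 * (LBINT x. f x * f x) \<le> (LBINT x. f x * (K ^^ Suc k) f x)"
        using P[OF f, of "Suc k"] by linarith
      fix g :: "'a \<Rightarrow> real" assume g: "bounded_borel g"
      show "(LBINT x. (K ^^ Suc k) f x * g x) = (LBINT x. f x * (K ^^ Suc k) g x)"
        using K.symmetric[OF bb[OF f(1)] S.integrable[OF f] g] S.symmetric[OF f K.bounded_borel[OF g]]
        by (simp add: funpow_swap1)
    next
      fix w k' :: "'a \<Rightarrow> real" and y assume w: "bounded_borel w" and k: "bounded_borel k'" "integrable lborel k'"
      have "(K ^^ k) (conv w k') = conv w ((K ^^ k) k')" using S.conv[OF w k] by auto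
      then show "(K ^^ Suc k) (conv w k') y = conv w ((K ^^ Suc k) k') y"
        using K.conv[OF w bb[OF k(1)] S.integrable[OF k]] by simp
    next
      fix f :: "'a \<Rightarrow> real" assume "bounded_borel f"
      then show "(K ^^ Suc k) f \<in> borel_measurable borel" using K.borel[OF bb] by simp
    qed simp
  qed
qed

text \<open>A bounded substitute for the resolvent of the generator \<open>L f = T f - m f\<close>: with
  \<open>K = 1 + L / M\<close> take the Cesaro mean \<open>J\<close> of the powers of \<open>K\<close>. Both \<open>1 - J = - B L\<close> and
  the smallness of \<open>J L\<close> are telescoping sums.\<close>

lemma approximate_resolvent:
  fixes T :: "('a::euclidean_space \<Rightarrow> real) \<Rightarrow> 'a \<Rightarrow> real"
  assumes "sym_op T m" "\<epsilon> > 0"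
  obtains J B b where "sym_op J 1" "sym_op B b" "b \<le> 1 / \<epsilon> + 1"
    "\<And>f. bounded_borel f \<Longrightarrow> integrable lborel f \<Longrightarrow> 0 \<le> (LBINT x. f x * B f x)"
    "\<And>f x. bounded_borel f \<Longrightarrow> f x - J f x = - B (\<lambda>x. T f x - m * f x) x"
    "\<And>f C x. bounded_borel f \<Longrightarrow> (\<And>x. \<bar>f x\<bar> \<le> C) \<Longrightarrow> \<bar>J (\<lambda>x. T f x - m * f x) x\<bar> \<le> 2 * \<epsilon> * C"
proof -
  interpret T: sym_op T m by fact
  \<comment> \<open>\<open>M >= 2 m\<close> makes \<open>K\<close> positive semidefinite, since then
    \<open>1 - 2 m / M >= 0\<close>. Below, \<open>n >= M / \<epsilon>\<close> controls
    \<open>J L\<close>, while \<open>n <= M / \<epsilon> + 1\<close> together with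
    \<open>M >= 1\<close> controls the mass of \<open>B\<close>.\<close>
  define M where "M = max 1 (2 * m)"
  define n where "n = nat \<lceil>M / \<epsilon>\<rceil>"
  have M: "M \<ge> 1" "M \<ge> 2 * m" by (auto simp: M_def)
  then have q: "M / \<epsilon> > 0" using assms(2) by simp
  have n: "real n \<ge> M / \<epsilon>" "real n \<le> M / \<epsilon> + 1" "n > 0"
    using q unfolding n_def by linarith+
  define K where "K f x = (1 - m / M) * f x + (1 / M) * T f x" for f x
  have mM: "m / M \<le> 1 / 2" "0 \<le> m / M" using M T.mass_nonneg by (auto simp: field_simps)
  have "sym_op K ((1 - m / M) * 1 + (1 / M) * m)"
    unfolding K_def[abs_def] by (rule sym_op_lincomb[OF sym_op_id assms(1)]) (use mM M in auto)
  then have K: "sym_op K 1" by simp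
  then interpret K: sym_op K 1 .
  have psd: "0 \<le> (LBINT x. f x * K f x)" if f: "bounded_borel f" "integrable lborel f" for f
  proof -
    have ge: "0 \<le> (LBINT x. f x * f x)" by simp
    have "(LBINT x. f x * K f x) = (1 - m / M) * (LBINT x. f x * f x) + (1 / M) * (LBINT x. f x * T f x)"
      unfolding K_def by (rule integral_mult_lincomb[OF f(2,1) T.bounded_borel[OF f(1)]])
    also have "\<dots> \<ge> (1 - m / M) * (LBINT x. f x * f x) + (1 / M) * (- m * (LBINT x. f x * f x))"
      by (intro add_left_mono mult_left_mono T.lower f) (use M in auto)
    also have "(1 - m / M) * (LBINT x. f x * f x) + (1 / M) * (- m * (LBINT x. f x * f x)) = (1 - 2 * (m / M)) * (LBINT x. f x * f x)"
      by (simp add: algebra_simps)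
    moreover have "(1 - 2 * (m / M)) * (LBINT x. f x * f x) \<ge> 0"
      using mM(1) ge by (intro mult_nonneg_nonneg) linarith+
    ultimately show ?thesis by linarith
  qed
  have Kk: "sym_op (K ^^ k) 1" for k
    by (rule sym_op_funpow[OF K]) (rule psd)
  have Kp: "0 \<le> (LBINT x. f x * (K ^^ k) f x)"
    if "bounded_borel f" "integrable lborel f" for f k
    by (rule psd_funpow[OF K _ that]) (rule psd)
  \<comment> \<open>Since \<open>L = M (K - 1)\<close>, applying the sum of \<open>K ^^ j\<close>
    over \<open>j < k\<close> to \<open>L\<close> telescopes to \<open>M (K ^^ k - 1)\<close>;
    averaging over \<open>k < n\<close> then requires the weight \<open>1 / (M n)\<close>.\<close>
  define c where "c = 1 / (M * n)"
  have c: "c \<ge> 0" "c * M = 1 / n" using M n by (auto simp: c_def)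
  \<comment> \<open>The summand \<open>0 * f x\<close> gives each term the shape expected by
    \<open>sym_op_lincomb\<close>.\<close>
  define J where "J f x = (\<Sum>k<n. (1 / n) * (K ^^ k) f x + 0 * f x)" for f x
  define B where "B f x = (\<Sum>k<n. \<Sum>j<k. c * (K ^^ j) f x + 0 * f x)" for f x
  have "sym_op J (\<Sum>k<n. (1 / n) * 1 + 0 * 1)"
    unfolding J_def[abs_def] by (intro sym_op_sum sym_op_lincomb Kk sym_op_id) auto
  then have J: "sym_op J 1" using n by simp
  have B: "sym_op B (\<Sum>k<n. \<Sum>j<k. c * 1 + 0 * 1)"
    unfolding B_def[abs_def] by (intro sym_op_sum sym_op_lincomb Kk sym_op_id c) auto
  have "(\<Sum>k<n. \<Sum>j<k. c * 1 + 0 * 1) \<le> (\<Sum>k<n. real n * c)"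
    using c by (intro sum_mono) (auto intro!: mult_right_mono)
  also have "\<dots> = n / M" using n by (simp add: c_def)
  also have "\<dots> \<le> 1 / \<epsilon> + 1 / M" using n M by (simp add: field_simps)
  also have "\<dots> \<le> 1 / \<epsilon> + 1" using M by simp
  finally have b: "(\<Sum>k<n. \<Sum>j<k. c * 1 + 0 * 1) \<le> 1 / \<epsilon> + 1" .
  have KL: "(K ^^ j) (\<lambda>x. T f x - m * f x) x = M * ((K ^^ Suc j) f x - (K ^^ j) f x)"
    if f: "bounded_borel f" for f j x
  proof -
    interpret S: sym_op "K ^^ j" 1 by (rule Kk)
    have eq: "(\<lambda>x. T f x - m * f x) = (\<lambda>x. M * K f x + (- M) * f x)"
      using M by (auto simp: K_def algebra_simps)
    show ?thesis
      unfolding eq S.lincomb[OF K.bounded_borel[OF f] f] by (simp add: funpow_swap1 algebra_simps)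
  qed
  show ?thesis
  proof (rule that[OF J B b])
    fix f :: "'a \<Rightarrow> real" assume f: "bounded_borel f" "integrable lborel f"
    have i: "integrable lborel (\<lambda>x. f x * (K ^^ j) f x)" for j
      by (rule integrable_mult_bounded(1)[OF f(2) sym_op.bounded_borel[OF Kk f(1)]])
    have "(LBINT x. f x * B f x) = (LBINT x. (\<Sum>k<n. \<Sum>j<k. c * (f x * (K ^^ j) f x)))"
      by (simp add: B_def sum_distrib_left mult_ac)
    also have "\<dots> = (\<Sum>k<n. \<Sum>j<k. c * (LBINT x. f x * (K ^^ j) f x))"
      using i by (simp add: Bochner_Integration.integral_sum)
    also have "\<dots> \<ge> 0" using Kp[OF f] c by (intro sum_nonneg mult_nonneg_nonneg) auto
    finally show "0 \<le> (LBINT x. f x * B f x)" .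
  next
    fix f :: "'a \<Rightarrow> real" and x assume f: "bounded_borel f"
    have tel: "(\<Sum>j<k. (K ^^ Suc j) f x - (K ^^ j) f x) = (K ^^ k) f x - f x" for k
      using sum_lessThan_telescope[of "\<lambda>j. (K ^^ j) f x" k] by simp
    have "B (\<lambda>x. T f x - m * f x) x = (\<Sum>k<n. \<Sum>j<k. (1 / n) * ((K ^^ Suc j) f x - (K ^^ j) f x))"
      unfolding B_def KL[OF f] by (simp only: mult.assoc[symmetric] c) simp
    also have "\<dots> = (\<Sum>k<n. (1 / n) * ((K ^^ k) f x - f x))"
      by (simp only: sum_distrib_left[symmetric] tel)
    also have "\<dots> = J f x - f x"
      using n(3) by (simp add: J_def sum_subtractf right_diff_distrib)
    finally show "f x - J f x = - B (\<lambda>x. T f x - m * f x) x" by simp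
    fix C assume C: "\<And>x. \<bar>f x\<bar> \<le> C"
    then have "C \<ge> 0" by (meson abs_ge_zero order_trans)
    have "J (\<lambda>x. T f x - m * f x) x = (M / n) * (\<Sum>k<n. (K ^^ Suc k) f x - (K ^^ k) f x)"
      unfolding J_def KL[OF f] by (simp add: sum_distrib_left)
    also have "\<dots> = (M / n) * ((K ^^ n) f x - f x)"
      by (simp only: tel)
    finally have "\<bar>J (\<lambda>x. T f x - m * f x) x\<bar> = (M / n) * \<bar>(K ^^ n) f x - f x\<bar>"
      using M by (simp add: abs_mult)
    also have "\<dots> \<le> \<epsilon> * (2 * C)"
    proof (intro mult_mono)
      show "M / n \<le> \<epsilon>" using n assms(2) by (simp add: field_simps)
      show "\<bar>(K ^^ n) f x - f x\<bar> \<le> 2 * C"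
        using sym_op.bound[OF Kk f C, of n x] C[of x] by linarith
    qed (use assms(2) in auto)
    finally show "\<bar>J (\<lambda>x. T f x - m * f x) x\<bar> \<le> 2 * \<epsilon> * C" by simp
  qed
qed

text \<open>Pair \<open>V1 = J V1 - B (L V1)\<close> with \<open>U2\<close>, where
  \<open>L V1\<close> and \<open>L V2\<close> are \<open>U1\<close> and \<open>U2\<close> up to
  remainders of size \<open>e\<close>. Symmetry moves \<open>J\<close> from \<open>V1\<close> to
  \<open>U2\<close>. Now \<open>J U2\<close> is uniformly small, because \<open>U2\<close> is nearly
  \<open>L V2\<close>, and its \<open>L1\<close> norm is at most that of \<open>U2\<close>; the
  first fact is used against the integrable part \<open>a\<close>, the second against the small part
  \<open>r\<close>. The error terms come from \<open>B R1\<close>, from \<open>r\<close> and from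
  \<open>a\<close>, in this order.\<close>

lemma resolvent_pairing:
  fixes T J B :: "('a::euclidean_space \<Rightarrow> real) \<Rightarrow> 'a \<Rightarrow> real"
  assumes "sym_op T m" "sym_op J 1" "sym_op B b"
    and JB: "\<And>f x. bounded_borel f \<Longrightarrow> f x - J f x = - B (\<lambda>x. T f x - m * f x) x"
    and JL: "\<And>f C x. bounded_borel f \<Longrightarrow> (\<And>x. \<bar>f x\<bar> \<le> C) \<Longrightarrow> \<bar>J (\<lambda>x. T f x - m * f x) x\<bar> \<le> \<epsilon> * C"
    and V: "bounded_borel V1" "bounded_borel V2" "\<And>x. \<bar>V2 x\<bar> \<le> C"
    and U: "bounded_borel U1" "bounded_borel U2" "integrable lborel U2"
    and e: "\<And>x. \<bar>U1 x - (T V1 x - m * V1 x)\<bar> \<le> e" "\<And>x. \<bar>U2 x - (T V2 x - m * V2 x)\<bar> \<le> e"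
    and ab: "\<And>x. V1 x = a x + r x" "bounded_borel a" "integrable lborel a" "bounded_borel r" "\<And>x. \<bar>r x\<bar> \<le> \<delta>"
  shows "\<bar>(LBINT x. U2 x * V1 x) + (LBINT x. U2 x * B U1 x)\<bar>
    \<le> b * e * (LBINT x. \<bar>U2 x\<bar>) + \<delta> * (LBINT x. \<bar>U2 x\<bar>) + (\<epsilon> * C + e) * (LBINT x. \<bar>a x\<bar>)"
proof -
  interpret T: sym_op T m by fact
  interpret J: sym_op J 1 by fact
  interpret B: sym_op B b by fact
  define L where "L f x = T f x - m * f x" for f x
  have L: "bounded_borel (L f)" if "bounded_borel f" for f
    using bounded_borel_lincomb[OF T.bounded_borel[OF that] that, of 1 "-m"] by (simp add: L_def[abs_def])
  define R1 where "R1 x = U1 x - L V1 x" for x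
  define R2 where "R2 x = U2 x - L V2 x" for x
  have R: "bounded_borel R1" "bounded_borel R2"
    unfolding R1_def[abs_def] R2_def[abs_def] by (intro bounded_borel_diff U L V)+
  have Re: "\<bar>R1 x\<bar> \<le> e" "\<bar>R2 x\<bar> \<le> e" for x using e by (auto simp: R1_def R2_def L_def)
  have "L V1 = (\<lambda>x. 1 * U1 x + (-1) * R1 x)" "L V2 = (\<lambda>x. 1 * U2 x + (-1) * R2 x)"
    by (auto simp: R1_def R2_def)
  then have BL: "B (L V1) x = 1 * B U1 x + (-1) * B R1 x" and "J (L V2) x = 1 * J U2 x + (-1) * J R2 x" for x
    using B.lincomb[OF U(1) R(1), of 1 "-1"] J.lincomb[OF U(2) R(2), of 1 "-1"] by simp_all
  then have JU: "J U2 x = J (L V2) x + J R2 x" for x by simp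
  have JU_le: "\<bar>J U2 x\<bar> \<le> \<epsilon> * C + e" for x
    using JL[OF V(2,3), of x] J.bound[OF R(2) Re(2), of x] by (simp add: JU L_def[abs_def])
  note BB = B.bounded_borel[OF U(1)] B.bounded_borel[OF R(1)] J.bounded_borel[OF V(1)] J.bounded_borel[OF U(2)]
  note JUi = J.integrable[OF U(2,3)]
  have V1: "V1 x = J V1 x + (- B U1 x + B R1 x)" for x
    using JB[OF V(1), of x] BL[of x] by (simp add: L_def[abs_def])
  have "(LBINT x. U2 x * V1 x) = (LBINT x. U2 x * (1 * J V1 x + 1 * ((-1) * B U1 x + 1 * B R1 x)))"
    by (subst V1) simp
  also have "\<dots> = (LBINT x. U2 x * J V1 x) + (- (LBINT x. U2 x * B U1 x) + (LBINT x. U2 x * B R1 x))"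
    by (subst integral_mult_lincomb[OF U(3)] | intro BB bounded_borel_lincomb)+ simp
  finally have 1: "(LBINT x. U2 x * V1 x) + (LBINT x. U2 x * B U1 x) =
      (LBINT x. U2 x * J V1 x) + (LBINT x. U2 x * B R1 x)" by simp
  have 2: "\<bar>LBINT x. U2 x * B R1 x\<bar> \<le> b * e * (LBINT x. \<bar>U2 x\<bar>)"
    by (rule abs_integral_mult_le[OF U(3) BB(2) B.bound[OF R(1) Re(1)]])
  have "(LBINT x. U2 x * J V1 x) = (LBINT x. J U2 x * V1 x)"
    by (rule J.symmetric[OF U(2,3) V(1), symmetric])
  also have "\<dots> = (LBINT x. J U2 x * (1 * a x + 1 * r x))" by (simp add: ab(1))
  also have "\<dots> = (LBINT x. a x * J U2 x) + (LBINT x. J U2 x * r x)"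
    by (subst integral_mult_lincomb[OF JUi ab(2,4)]) (simp add: mult.commute)
  finally have 3: "(LBINT x. U2 x * J V1 x) = (LBINT x. a x * J U2 x) + (LBINT x. J U2 x * r x)" .
  have 4: "\<bar>LBINT x. a x * J U2 x\<bar> \<le> (\<epsilon> * C + e) * (LBINT x. \<bar>a x\<bar>)"
    by (rule abs_integral_mult_le[OF ab(3) BB(4) JU_le])
  have "0 \<le> \<delta>" using ab(5)[of undefined] by linarith
  have "\<bar>LBINT x. J U2 x * r x\<bar> \<le> \<delta> * (LBINT x. \<bar>J U2 x\<bar>)"
    by (rule abs_integral_mult_le[OF JUi ab(4,5)])
  also have "\<dots> \<le> \<delta> * (LBINT x. \<bar>U2 x\<bar>)"
    using J.norm_le[OF U(2,3)] \<open>0 \<le> \<delta>\<close> by (intro mult_left_mono) auto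
  finally show ?thesis using 1 2 3 4 by linarith
qed

text \<open>The uniform closure of the bounded integrable functions. This is a form of decay at
  infinity which, unlike integrability, is available for the mollified time integral of
  \<open>W\<close>.\<close>

definition vanishing :: "('a::euclidean_space \<Rightarrow> real) \<Rightarrow> bool" where
  "vanishing V \<longleftrightarrow> (\<forall>\<delta>>0. \<exists>a r. bounded_borel a \<and> integrable lborel a \<and> bounded_borel r \<and>
     (\<forall>x. V x = a x + r x \<and> \<bar>r x\<bar> \<le> \<delta>))"

lemma vanishing_diff:
  assumes "vanishing V" "vanishing W" shows "vanishing (\<lambda>x. V x - W x)"
  unfolding vanishing_def
proof (intro allI impI)
  fix \<delta> :: real assume "\<delta> > 0"
  then have h: "\<delta> / 2 > 0" by simp
  obtain a r where 1: "bounded_borel a" "integrable lborel a" "bounded_borel r" "\<And>x. V x = a x + r x" "\<And>x. \<bar>r x\<bar> \<le> \<delta> / 2"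
    using assms(1) h unfolding vanishing_def by metis
  obtain b s where 2: "bounded_borel b" "integrable lborel b" "bounded_borel s" "\<And>x. W x = b x + s x" "\<And>x. \<bar>s x\<bar> \<le> \<delta> / 2"
    using assms(2) h unfolding vanishing_def by metis
  have "\<bar>r x - s x\<bar> \<le> \<delta>" for x using 1(5)[of x] 2(5)[of x] by linarith
  then show "\<exists>a r. bounded_borel a \<and> integrable lborel a \<and> bounded_borel r \<and> (\<forall>x. V x - W x = a x + r x \<and> \<bar>r x\<bar> \<le> \<delta>)"
    using 1 2 by (intro exI[of _ "\<lambda>x. a x - b x"] exI[of _ "\<lambda>x. r x - s x"])
      (auto intro!: bounded_borel_diff)
qed

text \<open>Modulo a small error the pairing \<open>\<integral> U\<^sub>j V\<^sub>i\<close> equals \<open>- \<integral> U\<^sub>j B U\<^sub>i\<close> with \<open>B\<close> symmetric and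
  positive; the error budget is fixed in the order \<open>\<delta>\<close>, \<open>\<epsilon>\<close>, \<open>e\<close>.\<close>

lemma approximate_pairing:
  fixes V U :: "bool \<Rightarrow> 'a::euclidean_space \<Rightarrow> real"
  assumes V: "\<And>i. bounded_borel (V i)" "\<And>i. vanishing (V i)"
    and U: "\<And>i. bounded_borel (U i)" "\<And>i. integrable lborel (U i)"
    and approx: "\<And>e. e > 0 \<Longrightarrow> \<exists>T m. sym_op T m \<and> (\<forall>i x. \<bar>U i x - (T (V i) x - m * V i x)\<bar> \<le> e)"
    and "\<xi> > 0"
  obtains B b where "sym_op B b"
    "\<And>f. bounded_borel f \<Longrightarrow> integrable lborel f \<Longrightarrow> 0 \<le> (LBINT x. f x * B f x)"
    "\<And>i j. \<bar>(LBINT x. U j x * V i x) + (LBINT x. U j x * B (U i) x)\<bar> \<le> \<xi>"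
proof -
  define D where "D = 1 + (LBINT x. \<bar>U True x\<bar>) + (LBINT x. \<bar>U False x\<bar>)"
  have Unn: "0 \<le> (LBINT x. \<bar>U i x\<bar>)" for i by simp
  have D1: "D > 0" using Unn[of True] Unn[of False] unfolding D_def by linarith
  have D2: "(LBINT x. \<bar>U i x\<bar>) \<le> D" for i
    using Unn[of True] Unn[of False] unfolding D_def by (induct i rule: bool.induct) linarith+
  note D = D1 D2
  define \<delta> where "\<delta> = \<xi> / (4 * D)"
  have \<delta>: "\<delta> > 0" using D \<open>\<xi> > 0\<close> by (simp add: \<delta>_def)
  obtain a r where ar: "\<And>i. bounded_borel (a i)" "\<And>i. integrable lborel (a i)" "\<And>i. bounded_borel (r i)"
      "\<And>i x. V i x = a i x + r i x" "\<And>i x. \<bar>r i x\<bar> \<le> \<delta>"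
  proof -
    have "\<forall>i. \<exists>p. bounded_borel (fst p) \<and> integrable lborel (fst p) \<and> bounded_borel (snd p) \<and>
        (\<forall>x. V i x = fst p x + snd p x \<and> \<bar>snd p x\<bar> \<le> \<delta>)"
      using V(2) \<delta> unfolding vanishing_def by auto
    from choice[OF this] obtain p where "\<forall>i. bounded_borel (fst (p i)) \<and> integrable lborel (fst (p i)) \<and>
        bounded_borel (snd (p i)) \<and> (\<forall>x. V i x = fst (p i) x + snd (p i) x \<and> \<bar>snd (p i) x\<bar> \<le> \<delta>)" ..
    then show thesis using that[of "\<lambda>i. fst (p i)" "\<lambda>i. snd (p i)"] by simp
  qed
  define A where "A = 1 + (LBINT x. \<bar>a True x\<bar>) + (LBINT x. \<bar>a False x\<bar>)"
  have Ann: "0 \<le> (LBINT x. \<bar>a i x\<bar>)" for i by simp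
  have A1: "A > 0" using Ann[of True] Ann[of False] unfolding A_def by linarith
  have A2: "(LBINT x. \<bar>a i x\<bar>) \<le> A" for i
    using Ann[of True] Ann[of False] unfolding A_def by (induct i rule: bool.induct) linarith+
  note A = A1 A2
  obtain c where c: "\<And>i. c i \<ge> 0" "\<And>i x. \<bar>V i x\<bar> \<le> c i"
  proof -
    have "\<forall>i. \<exists>c. 0 \<le> c \<and> (\<forall>x. \<bar>V i x\<bar> \<le> c)" by (metis V(1) bounded_borelE)
    from choice[OF this] show thesis using that by blast
  qed
  define C where "C = c True + c False"
  have C1: "C \<ge> 0" using c(1)[of True] c(1)[of False] unfolding C_def by linarith
  have C2: "\<bar>V i x\<bar> \<le> C" for i x
    using c(1)[of True] c(1)[of False] c(2)[of i x] unfolding C_def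
    by (induct i rule: bool.induct) linarith+
  note C = C1 C2
  define \<epsilon> where "\<epsilon> = \<xi> / (8 * A * (C + 1))"
  have \<epsilon>: "\<epsilon> > 0" using A C(1) \<open>\<xi> > 0\<close> by (simp add: \<epsilon>_def)
  \<comment> \<open>\<open>E\<close> collects the factors of \<open>e\<close> in the error: the
    bound \<open>1 / \<epsilon> + 1\<close> on the mass of \<open>B\<close> times the
    \<open>L1\<close> norm of \<open>U\<close>, plus the \<open>L1\<close> norm of \<open>a\<close>.
    The discretisation, and with it \<open>B\<close>, is chosen only after \<open>e\<close>; this is
    why the mass of \<open>B\<close> had to be bounded in terms of \<open>\<epsilon>\<close> alone,
    independently of \<open>m\<close>.\<close>
  define E where "E = (1 / \<epsilon> + 1) * D + A"
  have E: "E > 0" unfolding E_def using \<epsilon> D(1) A(1) by (intro add_pos_pos mult_pos_pos) auto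
  define e where "e = \<xi> / (4 * E)"
  have e: "e > 0" using E \<open>\<xi> > 0\<close> by (simp add: e_def)
  obtain T m where T: "sym_op T m" "\<And>i x. \<bar>U i x - (T (V i) x - m * V i x)\<bar> \<le> e"
    using approx[OF e] by blast
  obtain J B b where JB: "sym_op J 1" "sym_op B b" "b \<le> 1 / \<epsilon> + 1"
    "\<And>f. bounded_borel f \<Longrightarrow> integrable lborel f \<Longrightarrow> 0 \<le> (LBINT x. f x * B f x)"
    "\<And>f x. bounded_borel f \<Longrightarrow> f x - J f x = - B (\<lambda>x. T f x - m * f x) x"
    "\<And>f C x. bounded_borel f \<Longrightarrow> (\<And>x. \<bar>f x\<bar> \<le> C) \<Longrightarrow> \<bar>J (\<lambda>x. T f x - m * f x) x\<bar> \<le> 2 * \<epsilon> * C"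
    by (rule approximate_resolvent[OF T(1) \<epsilon>]) blast
  have b: "b \<ge> 0" using sym_op.mass_nonneg[OF JB(2)] .
  have "\<bar>(LBINT x. U j x * V i x) + (LBINT x. U j x * B (U i) x)\<bar> \<le> \<xi>" for i j
  proof -
    have "\<bar>(LBINT x. U j x * V i x) + (LBINT x. U j x * B (U i) x)\<bar> \<le>
      b * e * (LBINT x. \<bar>U j x\<bar>) + \<delta> * (LBINT x. \<bar>U j x\<bar>) + (2 * \<epsilon> * C + e) * (LBINT x. \<bar>a i x\<bar>)"
      by (rule resolvent_pairing[OF T(1) JB(1,2,5,6) V(1) V(1) C(2) U(1) U(1,2) T(2) T(2) ar(4,1,2,3,5)])
    also have "\<dots> \<le> (1 / \<epsilon> + 1) * e * D + \<delta> * D + (2 * \<epsilon> * C + e) * A"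
      using b e \<delta> \<epsilon> C(1) D A JB(3) by (intro add_mono mult_mono mult_nonneg_nonneg) auto
    also have "\<dots> = e * E + \<delta> * D + 2 * \<epsilon> * C * A" by (simp add: E_def algebra_simps)
    also have "\<dots> \<le> \<xi> / 4 + \<xi> / 4 + \<xi> / 4"
    proof (intro add_mono)
      show "e * E \<le> \<xi> / 4" "\<delta> * D \<le> \<xi> / 4" using E D(1) by (simp_all add: e_def \<delta>_def)
      have "2 * \<epsilon> * C * A = (\<xi> / 4) * (C / (C + 1))"
      proof -
        have "A \<noteq> 0" "C + 1 \<noteq> 0" using A(1) C(1) by auto
        then show ?thesis by (simp add: \<epsilon>_def divide_simps)
      qed
      also have "\<dots> \<le> (\<xi> / 4) * 1" using C(1) \<open>\<xi> > 0\<close> by (intro mult_left_mono) auto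
      finally show "2 * \<epsilon> * C * A \<le> \<xi> / 4" by simp
    qed
    also have "\<dots> \<le> \<xi>" using \<open>\<xi> > 0\<close> by simp
    finally show ?thesis .
  qed
  then show ?thesis using that JB(2,4) by blast
qed

text \<open>Indexing by \<open>bool\<close> lets one discretisation and one \<open>B\<close> serve
  both functions, hence all four pairings at once. Up to \<open>\<xi>\<close> the pairings are those
  of \<open>-B\<close>, whose sign and symmetry survive as \<open>\<xi>\<close> tends to
  \<open>0\<close> although \<open>B\<close> depends on \<open>\<xi>\<close>.\<close>

lemma
  fixes V U :: "bool \<Rightarrow> 'a::euclidean_space \<Rightarrow> real"
  assumes V: "\<And>i. bounded_borel (V i)" "\<And>i. vanishing (V i)"
    and U: "\<And>i. bounded_borel (U i)" "\<And>i. integrable lborel (U i)"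
    and approx: "\<And>e. e > 0 \<Longrightarrow> \<exists>T m. sym_op T m \<and> (\<forall>i x. \<bar>U i x - (T (V i) x - m * V i x)\<bar> \<le> e)"
  shows pairing_nonpos: "(LBINT x. U i x * V i x) \<le> 0"
    and pairing_symmetric: "(LBINT x. U i x * V j x) = (LBINT x. U j x * V i x)"
proof -
  show "(LBINT x. U i x * V i x) \<le> 0"
  proof (rule field_le_epsilon)
    fix \<xi> :: real assume "\<xi> > 0"
    obtain B b where B: "sym_op B b"
    "\<And>f. bounded_borel f \<Longrightarrow> integrable lborel f \<Longrightarrow> 0 \<le> (LBINT x. f x * B f x)"
    "\<And>i j. \<bar>(LBINT x. U j x * V i x) + (LBINT x. U j x * B (U i) x)\<bar> \<le> \<xi>"
      by (rule approximate_pairing[OF V U approx \<open>\<xi> > 0\<close>]) auto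
    show "(LBINT x. U i x * V i x) \<le> 0 + \<xi>"
      using B(2)[OF U, of i] B(3)[of i i] by linarith
  qed
  have le: "(LBINT x. U i x * V j x) \<le> (LBINT x. U j x * V i x)" for i j
  proof (rule field_le_epsilon)
    fix \<xi> :: real assume "\<xi> > 0"
    then have "\<xi> / 2 > 0" by simp
    obtain B b where B: "sym_op B b"
    "\<And>f. bounded_borel f \<Longrightarrow> integrable lborel f \<Longrightarrow> 0 \<le> (LBINT x. f x * B f x)"
    "\<And>i j. \<bar>(LBINT x. U j x * V i x) + (LBINT x. U j x * B (U i) x)\<bar> \<le> \<xi> / 2"
      by (rule approximate_pairing[OF V U approx \<open>\<xi> / 2 > 0\<close>]) auto
    have "(LBINT x. U i x * B (U j) x) = (LBINT x. U j x * B (U i) x)"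
      using sym_op.symmetric[OF B(1) U(1,2,1), of i j] by (simp add: mult.commute)
    then show "(LBINT x. U i x * V j x) \<le> (LBINT x. U j x * V i x) + \<xi>"
      using B(3)[of i j] B(3)[of j i] by linarith
  qed
  show "(LBINT x. U i x * V j x) = (LBINT x. U j x * V i x)"
    by (rule antisym[OF le le])
qed

text \<open>For a symmetric form with \<open>Q(a, a) <= 0\<close> one has
  \<open>2 Q(a, a - b) = Q(a, a) - Q(b, b) + Q(a - b, a - b)\<close>. This is the discrete chain
  rule for the energy, with an error term of the favourable sign.\<close>

lemma pairing_increment:
  fixes V U :: "bool \<Rightarrow> 'a::euclidean_space \<Rightarrow> real"
  assumes V: "\<And>i. bounded_borel (V i)" "\<And>i. vanishing (V i)"
    and U: "\<And>i. bounded_borel (U i)" "\<And>i. integrable lborel (U i)"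
    and approx: "\<And>e. e > 0 \<Longrightarrow> \<exists>T m. sym_op T m \<and> (\<forall>i x. \<bar>U i x - (T (V i) x - m * V i x)\<bar> \<le> e)"
  shows "(LBINT x. U True x * (V True x - V False x)) \<le>
    ((LBINT x. U True x * V True x) - (LBINT x. U False x * V False x)) / 2"
proof -
  define V' U' where "V' i x = V True x - V False x" and "U' i x = U True x - U False x" for i :: bool and x
  have 1: "(LBINT x. U i x * (V True x - V False x)) = (LBINT x. U i x * V True x) - (LBINT x. U i x * V False x)" for i
    using integral_mult_lincomb[OF U(2)[of i] V(1)[of True] V(1)[of False], of 1 "-1"] by simp
  have "(LBINT x. U' True x * V' True x) \<le> 0"
  proof (rule pairing_nonpos)
    show "bounded_borel (V' i)" "vanishing (V' i)" "bounded_borel (U' i)" "integrable lborel (U' i)" for i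
      unfolding V'_def[abs_def] U'_def[abs_def]
      by (intro bounded_borel_diff V U vanishing_diff Bochner_Integration.integrable_diff)+
    fix e :: real assume "e > 0"
    then have "e / 2 > 0" by simp
    from approx[OF this] obtain T m where T: "sym_op T m" "\<And>i x. \<bar>U i x - (T (V i) x - m * V i x)\<bar> \<le> e / 2" by blast
    have eq: "T (V' i) x = T (V True) x - T (V False) x" for i x
      using sym_op.lincomb[OF T(1) V(1)[of True] V(1)[of False], of 1 "-1"] by (simp add: V'_def[abs_def])
    have "\<bar>U' i x - (T (V' i) x - m * V' i x)\<bar> \<le> e" for i x
      using T(2)[of True x] T(2)[of False x] unfolding eq U'_def V'_def right_diff_distrib by linarith
    with T(1) show "\<exists>T m. sym_op T m \<and> (\<forall>i x. \<bar>U' i x - (T (V' i) x - m * V' i x)\<bar> \<le> e)" by blast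
  qed
  also have "(LBINT x. U' True x * V' True x) =
     (LBINT x. U True x * (V True x - V False x) - U False x * (V True x - V False x))"
    by (simp add: U'_def V'_def algebra_simps)
  also have "\<dots> = (LBINT x. U True x * (V True x - V False x)) - (LBINT x. U False x * (V True x - V False x))"
    by (intro Bochner_Integration.integral_diff integrable_mult_bounded bounded_borel_diff V U)
  finally show ?thesis
    using pairing_symmetric[OF V U approx, of True False] unfolding 1 by (simp add: field_simps)
qed

section \<open>The Levy operator on test functions\<close>

text \<open>A form without compensator: for symmetric \<open>mu\<close> the gradient term cancels in
  the second difference, which is bounded by a multiple of \<open>min (|z|^2) 1\<close> and consists
  of translations only. \<open>frakL_product\<close> links it to \<open>frakL\<close>.\<close>

definition levy_op :: "real^'p::finite^'n::finite \<Rightarrow> (real^'n) measure \<Rightarrow> (real^'n \<Rightarrow> real) \<Rightarrow> real^'n \<Rightarrow> real" where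
  "levy_op Sg mu f x = (\<Sum>i\<in>UNIV. dirderiv (dirderiv f (column i Sg)) (column i Sg) x) +
     (\<integral>z. f (x + z) + f (x - z) - 2 * f x \<partial>mu) / 2"

lemma dirderiv_uminus_direction:
  assumes "smooth_fun f" shows "dirderiv f (- v) x = - dirderiv f v x"
  using linear_neg[OF has_derivative_linear[OF smooth_fun_has_derivative[OF assms]]] .

lemma levy_measure_sets: "levy_measure mu \<Longrightarrow> sets mu = sets borel"
  by (simp add: levy_measure_def)

lemma levy_measure_space: "levy_measure mu \<Longrightarrow> space mu = UNIV"
  using sets_eq_imp_space_eq[OF levy_measure_sets] by simp

lemma levy_measure_integrable:
  assumes "levy_measure mu" shows "integrable mu (\<lambda>z. min ((norm z)\<^sup>2) 1)"
proof (rule integrableI_nonneg)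
  have [measurable_cong]: "sets mu = sets borel" using assms by (rule levy_measure_sets)
  show "(\<lambda>z. min ((norm z)\<^sup>2) 1) \<in> borel_measurable mu" by measurable
  show "(\<integral>\<^sup>+ z. ennreal (min ((norm z)\<^sup>2) 1) \<partial>mu) < \<infinity>"
    using assms by (simp add: levy_measure_def)
qed auto

text \<open>Invariance on Borel sets says that \<open>mu\<close> is its own image under
  \<open>uminus\<close>; the change of variables formula does the rest.\<close>

lemma levy_measure_reflect:
  assumes "levy_measure mu" and [measurable]: "f \<in> borel_measurable borel"
  shows "(\<integral>z. f (- z) \<partial>mu) = (\<integral>z. f z \<partial>mu)"
    and "integrable mu (\<lambda>z. f (- z)) \<longleftrightarrow> integrable mu (f :: _ \<Rightarrow> real)"
proof -
  have [measurable_cong]: "sets mu = sets borel" using assms(1) by (rule levy_measure_sets)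
  have eq: "distr mu borel uminus = mu"
  proof (rule measure_eqI)
    fix A assume "A \<in> sets (distr mu borel uminus)"
    then have A: "A \<in> sets borel" by simp
    have "uminus -` A = uminus ` A"
      by (auto simp: image_iff) (metis minus_minus)
    moreover have "emeasure mu (uminus ` A) = emeasure mu A"
      using assms(1) A by (simp add: levy_measure_def)
    ultimately show "emeasure (distr mu borel uminus) A = emeasure mu A"
      using A by (simp add: emeasure_distr levy_measure_space[OF assms(1)])
  qed (simp add: levy_measure_sets[OF assms(1)])
  show "(\<integral>z. f (- z) \<partial>mu) = (\<integral>z. f z \<partial>mu)"
    by (subst (2) eq[symmetric]) (simp add: integral_distr)
  show "integrable mu (\<lambda>z. f (- z)) \<longleftrightarrow> integrable mu f"
    by (subst (2) eq[symmetric]) (simp add: integrable_distr_eq)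
qed

text \<open>On \<open>|z| > h\<close> the weight \<open>min (|z|^2) 1\<close> is bounded below, so
  the finite Levy integral bounds the mass there. The factor \<open>1 / 2\<close> matches the one in
  front of the second difference in \<open>levy_op\<close>.\<close>

lemma truncated_levy_measure:
  assumes "levy_measure mu" "h > 0"
  defines "\<nu> \<equiv> density mu (\<lambda>z. ennreal (indicator {z. norm z > h} z / 2))"
  shows "finite_measure \<nu>" "sets \<nu> = sets borel"
    "\<And>f :: _ \<Rightarrow> real. f \<in> borel_measurable borel \<Longrightarrow> (\<integral>z. f z \<partial>\<nu>) = (\<integral>z. indicator {z. norm z > h} z * f z \<partial>mu) / 2"
proof -
  have [measurable_cong]: "sets mu = sets borel" using assms(1) by (rule levy_measure_sets)
  show "sets \<nu> = sets borel" by (simp add: \<nu>_def levy_measure_sets[OF assms(1)])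
  define c where "c = 1 / min (h\<^sup>2) 1"
  have c: "c > 0" using assms(2) by (simp add: c_def)
  have "emeasure \<nu> (space \<nu>) = (\<integral>\<^sup>+z. ennreal (indicator {z. norm z > h} z / 2) \<partial>mu)"
    by (simp add: \<nu>_def emeasure_density levy_measure_space[OF assms(1)])
  also have "\<dots> \<le> (\<integral>\<^sup>+z. ennreal (c * min ((norm z)\<^sup>2) 1) \<partial>mu)"
  proof (intro nn_integral_mono ennreal_leI)
    fix z :: "real^'a"
    show "indicator {z. norm z > h} z / 2 \<le> c * min ((norm z)\<^sup>2) 1"
    proof (cases "norm z > h")
      case True
      then have "h\<^sup>2 \<le> (norm z)\<^sup>2" using assms(2) by (intro power_mono) auto
      then have "min (h\<^sup>2) 1 \<le> min ((norm z)\<^sup>2) 1" by simp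
      moreover have "min (h\<^sup>2) 1 > 0" using assms(2) by simp
      ultimately have "1 \<le> c * min ((norm z)\<^sup>2) 1" by (simp add: c_def field_simps)
      then show ?thesis using True by simp
    qed (use c in auto)
  qed
  also have "\<dots> < \<infinity>"
  proof -
    have "integrable mu (\<lambda>z. c * min ((norm z)\<^sup>2) 1)" using levy_measure_integrable[OF assms(1)] by simp
    then show ?thesis using c by (subst nn_integral_eq_integral) auto
  qed
  finally show "finite_measure \<nu>" by (intro finite_measureI) auto
  fix f :: "real^'a \<Rightarrow> real" assume [measurable]: "f \<in> borel_measurable borel"
  show "(\<integral>z. f z \<partial>\<nu>) = (\<integral>z. indicator {z. norm z > h} z * f z \<partial>mu) / 2"
    unfolding \<nu>_def by (subst integral_density) auto
qed

text \<open>Taylor expansion controls \<open>|z| <= 1\<close>, the sup norm controls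
  \<open>|z| > 1\<close>. Both differences are treated because \<open>nonlocal_op\<close> uses the
  compensated one and \<open>levy_op\<close> the symmetric one.\<close>

lemma second_difference_bound:
  fixes f :: "'a::euclidean_space \<Rightarrow> real"
  assumes "test_fun UNIV f"
  obtains C where "C > 0" "\<And>x z. \<bar>f (x + z) + f (x - z) - 2 * f x\<bar> \<le> C * min ((norm z)\<^sup>2) 1"
     "\<And>x z. \<bar>f (x + z) - f x - (if norm z \<le> 1 then dirderiv f z x else 0)\<bar> \<le> C * min ((norm z)\<^sup>2) 1"
proof -
  obtain C where C: "C > 0" "\<And>x z. \<bar>f (x + z) - f x - dirderiv f z x\<bar> \<le> C * (norm z)\<^sup>2"
    by (rule taylor_remainder_bound[OF assms]) blast
  obtain D where D: "D > 0" "\<And>x. \<bar>f x\<bar> \<le> D" by (rule test_fun_bounded[OF assms]) blast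
  show ?thesis
  proof (rule that[of "2 * C + 4 * D"])
    show "2 * C + 4 * D > 0" using C D by simp
    have nn: "0 \<le> C * (norm z)\<^sup>2" "0 \<le> D * (norm z)\<^sup>2" for z :: 'a using C(1) D(1) by auto
    show "\<bar>f (x + z) - f x - (if norm z \<le> 1 then dirderiv f z x else 0)\<bar> \<le> (2 * C + 4 * D) * min ((norm z)\<^sup>2) 1" for x z
    proof (cases "norm z \<le> 1")
      case True
      then have "min ((norm z)\<^sup>2) 1 = (norm z)\<^sup>2" by (simp add: power_le_one)
      moreover have "C * (norm z)\<^sup>2 \<le> (2 * C + 4 * D) * (norm z)\<^sup>2" using C(1) D(1) by (intro mult_right_mono) auto
      ultimately show ?thesis using True C(2)[of x z] by simp
    next
      case False
      then have "min ((norm z)\<^sup>2) 1 = 1" by (simp add: one_le_power)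
      then show ?thesis using False D(2)[of "x + z"] D(2)[of x] C(1) D(1) by simp
    qed
    show "\<bar>f (x + z) + f (x - z) - 2 * f x\<bar> \<le> (2 * C + 4 * D) * min ((norm z)\<^sup>2) 1" for x z
    proof (cases "norm z \<le> 1")
      case True
      have "\<bar>f (x + z) + f (x - z) - 2 * f x\<bar> \<le> 2 * (C * (norm z)\<^sup>2)"
        using C(2)[of x z] C(2)[of x "- z"] dirderiv_uminus_direction[OF test_fun_smooth[OF assms], of z x]
        by simp
      also have "\<dots> \<le> (2 * C + 4 * D) * (norm z)\<^sup>2" using nn[of z] by (simp add: algebra_simps)
      also have "(norm z)\<^sup>2 = min ((norm z)\<^sup>2) 1" using True by (simp add: power_le_one)
      finally show ?thesis .
    next
      case False
      then have "min ((norm z)\<^sup>2) 1 = 1" by (simp add: one_le_power)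
      then show ?thesis using D(2)[of "x + z"] D(2)[of "x - z"] D(2)[of x] C(1) D(1) by simp
    qed
  qed
qed

text \<open>Second derivatives become difference quotients and jumps of size at most
  \<open>h\<close> are dropped, which leaves finitely many point masses and a finite measure. All
  errors come from steps of bounded length, so they live in a ball independent of \<open>e\<close>.
  A uniformly small error is therefore also small in \<open>L1\<close>, which is how
  \<open>generator_approx\<close> uses it.\<close>

lemma levy_op_approx:
  fixes Sg :: "real^'p::finite^'n::finite" and mu :: "(real^'n) measure"
  assumes mu: "levy_measure mu" and f: "test_fun UNIV f"
  obtains R where "\<And>e. e > 0 \<Longrightarrow> \<exists>T m. sym_op T m \<and>
    (\<forall>x. \<bar>levy_op Sg mu f x - (T f x - m * f x)\<bar> \<le> e * indicator (cball 0 R) x)"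
proof -
  have [measurable_cong]: "sets mu = sets borel" using mu by (rule levy_measure_sets)
  note sm = test_fun_smooth[OF f]
  have fb [measurable]: "f \<in> borel_measurable borel" by (rule smooth_fun_borel[OF sm])
  have bb: "bounded_borel f"
    using fb test_fun_bounded[OF f] unfolding bounded_borel_def by metis
  define \<sigma> where "\<sigma> i = column i Sg" for i
  let ?dd = "\<lambda>i. dirderiv (dirderiv f (\<sigma> i)) (\<sigma> i)"
  let ?sd = "\<lambda>x z. f (x + z) + f (x - z) - 2 * f x"
  obtain K where K: "K > 0" "\<And>x z. \<bar>?sd x z\<bar> \<le> K * min ((norm z)\<^sup>2) 1"
    by (rule second_difference_bound[OF f]) blast
  have "\<forall>i. \<exists>C>0. \<forall>x h. h > 0 \<longrightarrow> \<bar>?sd x (h *\<^sub>R \<sigma> i) / h\<^sup>2 - ?dd i x\<bar> \<le> C * h"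
    by (metis second_difference_quotient[OF f])
  then obtain C where C: "\<And>i. C i > 0" "\<And>i x h. h > 0 \<Longrightarrow> \<bar>?sd x (h *\<^sub>R \<sigma> i) / h\<^sup>2 - ?dd i x\<bar> \<le> C i * h"
    by metis
  obtain R0 where R0: "R0 > 0" "\<And>x. norm x > R0 \<Longrightarrow> f x = 0" by (rule test_fun_support[OF f]) blast
  have "\<forall>i. \<exists>R>0. \<forall>x. norm x > R \<longrightarrow> ?dd i x = 0"
    by (metis test_fun_support[OF test_fun_dirderiv[OF test_fun_dirderiv[OF f]]])
  then obtain R1 where R1: "\<And>i. R1 i > 0" "\<And>i x. norm x > R1 i \<Longrightarrow> ?dd i x = 0" by metis
  \<comment> \<open>\<open>R0 + 1\<close> covers the dropped jumps, as \<open>h <= 1\<close>;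
    \<open>R0 + norm (\<sigma> i)\<close> covers the difference quotients and \<open>R1 i\<close>
    the second derivatives themselves.\<close>
  define R where "R = R0 + 1 + (\<Sum>i\<in>UNIV. norm (\<sigma> i)) + (\<Sum>i\<in>UNIV. R1 i)"
  have Rge: "R \<ge> R0 + 1" "R \<ge> R0 + norm (\<sigma> i)" "R \<ge> R1 i" for i
  proof -
    have "norm (\<sigma> i) \<le> (\<Sum>i\<in>UNIV. norm (\<sigma> i))" "R1 i \<le> (\<Sum>i\<in>UNIV. R1 i)"
      by (rule member_le_sum; use R1(1) in \<open>auto intro: less_imp_le\<close>)+
    moreover have "0 \<le> (\<Sum>i\<in>UNIV. norm (\<sigma> i))" "0 \<le> (\<Sum>i\<in>UNIV. R1 i)"
      by (rule sum_nonneg; use R1(1) in \<open>auto intro: less_imp_le\<close>)+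
    ultimately show "R \<ge> R0 + 1" "R \<ge> R0 + norm (\<sigma> i)" "R \<ge> R1 i"
      using R0(1) unfolding R_def by linarith+
  qed
  have sd0: "?sd x z = 0" if "norm x > R0 + norm z" for x z
  proof -
    have "norm (x + z) > R0" "norm (x - z) > R0" "norm x > R0"
      using that norm_triangle_ineq2[of x "- z"] norm_triangle_ineq2[of x z] norm_ge_zero[of z] by (simp_all del: norm_ge_zero)
    then show ?thesis using R0(2) by simp
  qed
  \<comment> \<open>\<open>K * \<omega> h\<close> bounds the contribution of the dropped jumps. It
    tends to \<open>0\<close> along \<open>h = 1 / Suc n\<close> by dominated convergence, the
    weight being zero at the origin.\<close>
  define \<omega> where "\<omega> h = (\<integral>z. indicator {z. norm z \<le> h} z * min ((norm z)\<^sup>2) 1 \<partial>mu)" for h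
  have iK: "integrable mu (\<lambda>z. indicator {z. norm z \<le> h} z * min ((norm z)\<^sup>2) 1)" for h
    by (rule Bochner_Integration.integrable_bound[OF levy_measure_integrable[OF mu]])
       (auto simp: indicator_def)
  have "(\<lambda>n. \<omega> (1 / Suc n)) \<longlonglongrightarrow> (\<integral>z. 0 \<partial>mu)"
    unfolding \<omega>_def
  proof (rule integral_dominated_convergence[where w="\<lambda>z. min ((norm z)\<^sup>2) 1"])
    show "AE z in mu. (\<lambda>n. indicator {z. norm z \<le> 1 / Suc n} z * min ((norm z)\<^sup>2) 1) \<longlonglongrightarrow> 0"
    proof (rule AE_I2)
      fix z :: "real^'n"
      show "(\<lambda>n. indicator {z. norm z \<le> 1 / Suc n} z * min ((norm z)\<^sup>2) 1) \<longlonglongrightarrow> 0"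
      proof (cases "z = 0")
        case False
        then obtain N where N: "1 / real (Suc N) < norm z"
          using reals_Archimedean[of "norm z"] by (auto simp: inverse_eq_divide)
        have "indicator {z. norm z \<le> 1 / Suc n} z = (0::real)" if "n \<ge> N" for n
        proof -
          have "1 / real (Suc n) \<le> 1 / real (Suc N)" using that by (simp add: field_simps)
          then show ?thesis using N by simp
        qed
        then show ?thesis by (intro tendsto_eventually eventually_sequentiallyI[of N]) simp
      qed simp
    qed
  qed (use levy_measure_integrable[OF mu] in \<open>auto simp: indicator_def\<close>)
  then have \<omega>: "(\<lambda>n. \<omega> (1 / Suc n)) \<longlonglongrightarrow> 0" by simp
  define Cs where "Cs = (\<Sum>i\<in>UNIV. C i)"
  have lim: "(\<lambda>n. Cs * (1 / Suc n) + K * \<omega> (1 / Suc n)) \<longlonglongrightarrow> Cs * 0 + K * 0"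
    by (intro tendsto_add tendsto_mult tendsto_const \<omega>)
       (use LIMSEQ_inverse_real_of_nat in \<open>simp add: inverse_eq_divide\<close>)
  show ?thesis
  proof (rule that[of R])
    fix e :: real assume "e > 0"
    have "\<forall>\<^sub>F n in sequentially. Cs * (1 / Suc n) + K * \<omega> (1 / Suc n) < e"
      using order_tendstoD(2)[OF lim, of e] \<open>e > 0\<close> by simp
    then obtain n where n: "Cs * (1 / Suc n) + K * \<omega> (1 / Suc n) < e"
      by (auto simp: eventually_sequentially)
    define h where "h = 1 / real (Suc n)"
    have h: "h > 0" "h \<le> 1" by (auto simp: h_def)
    define \<nu> where "\<nu> = density mu (\<lambda>z. ennreal (indicator {z. norm z > h} z / 2))"
    note \<nu> = truncated_levy_measure[OF mu h(1), folded \<nu>_def]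
    interpret \<nu>: finite_measure \<nu> by (rule \<nu>(1))
    \<comment> \<open>The point mass at \<open>h *\<^sub>R \<sigma> i\<close>, as the image of a
      one-point counting measure. Weighted by \<open>1 / h^2\<close>, its translation average gives
      the second difference quotient once its share of \<open>m\<close> is subtracted.\<close>
    define \<delta> where "\<delta> i = distr (count_space {()}) borel (\<lambda>_. h *\<^sub>R \<sigma> i)" for i
    have \<delta>: "finite_measure (\<delta> i)" "sets (\<delta> i) = sets borel" "measure (\<delta> i) UNIV = 1" for i
      by (auto simp: \<delta>_def measure_distr measure_count_space
          intro!: finite_measure.finite_measure_distr finite_measure_count_space)
    define T where "T g x = 1 * (\<Sum>i\<in>UNIV. (1 / h\<^sup>2) * (\<integral>z. g (x + z) + g (x - z) \<partial>\<delta> i) + 0 * g x)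
        + 1 * (\<integral>z. g (x + z) + g (x - z) \<partial>\<nu>)" for g and x :: "real^'n"
    define m where "m = 1 * (\<Sum>i\<in>(UNIV::'p set). (1 / h\<^sup>2) * (2 * measure (\<delta> i) UNIV) + 0 * 1) + 1 * (2 * measure \<nu> UNIV)"
    have T: "sym_op T m"
      unfolding T_def[abs_def] m_def
      by (intro sym_op_lincomb sym_op_sum sym_op_translations \<nu> \<delta> sym_op_id) auto
    have Tf: "T f x - m * f x = (\<Sum>i\<in>UNIV. ?sd x (h *\<^sub>R \<sigma> i) / h\<^sup>2) + (\<integral>z. indicator {z. norm z > h} z * ?sd x z \<partial>mu) / 2" for x
    proof -
      have \<nu>i: "integrable \<nu> (\<lambda>z. f (x + z) + f (x - z))"
      proof -
        obtain D where "\<And>x. \<bar>f x\<bar> \<le> D" using bb by (auto simp: bounded_borel_def)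
        then have "\<bar>f (x + z) + f (x - z)\<bar> \<le> D + D" for z
          by (intro order_trans[OF abs_triangle_ineq] add_mono)
        then show ?thesis
          using \<nu>(2) by (intro \<nu>.integrable_const_bound[where B="D + D"]) (auto cong: measurable_cong_sets)
      qed
      have "space \<nu> = UNIV" using sets_eq_imp_space_eq[OF \<nu>(2)] by simp
      then have "(\<integral>z. f (x + z) + f (x - z) \<partial>\<nu>) - 2 * measure \<nu> UNIV * f x = (\<integral>z. ?sd x z \<partial>\<nu>)"
        using \<nu>i by simp
      also have "\<dots> = (\<integral>z. indicator {z. norm z > h} z * ?sd x z \<partial>mu) / 2"
        by (rule \<nu>(3)) measurable
      finally have 1: "(\<integral>z. f (x + z) + f (x - z) \<partial>\<nu>) - 2 * measure \<nu> UNIV * f x = (\<integral>z. indicator {z. norm z > h} z * ?sd x z \<partial>mu) / 2" .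
      have "(\<integral>z. f (x + z) + f (x - z) \<partial>\<delta> i) = f (x + h *\<^sub>R \<sigma> i) + f (x - h *\<^sub>R \<sigma> i)" for i
        unfolding \<delta>_def by (subst integral_distr) (auto simp: lebesgue_integral_count_space_finite)
      then have "T f x - m * f x = (\<Sum>i\<in>UNIV. (f (x + h *\<^sub>R \<sigma> i) + f (x - h *\<^sub>R \<sigma> i)) / h\<^sup>2) - (\<Sum>i\<in>(UNIV::'p set). 2 * f x / h\<^sup>2)
         + ((\<integral>z. f (x + z) + f (x - z) \<partial>\<nu>) - 2 * measure \<nu> UNIV * f x)"
        by (simp add: T_def m_def \<delta>(3) algebra_simps add_divide_distrib)
      then show ?thesis unfolding 1 by (simp only: sum_subtractf diff_divide_distrib)
    qed
    have sdi: "integrable mu (?sd x)" for x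
      by (rule Bochner_Integration.integrable_bound[where f="\<lambda>z. K * min ((norm z)\<^sup>2) 1"])
         (use K levy_measure_integrable[OF mu] in auto)
    have ind: "integrable mu (\<lambda>z. indicator {z. norm z > h} z * ?sd x z)" "integrable mu (\<lambda>z. indicator {z. norm z \<le> h} z * ?sd x z)" for x
      by (rule Bochner_Integration.integrable_bound[OF sdi]; auto simp: indicator_def)+
    have diff: "levy_op Sg mu f x - (T f x - m * f x) =
        (\<Sum>i\<in>UNIV. ?dd i x - ?sd x (h *\<^sub>R \<sigma> i) / h\<^sup>2) + (\<integral>z. indicator {z. norm z \<le> h} z * ?sd x z \<partial>mu) / 2" for x
    proof -
      have "(\<integral>z. ?sd x z \<partial>mu) = (\<integral>z. indicator {z. norm z > h} z * ?sd x z + indicator {z. norm z \<le> h} z * ?sd x z \<partial>mu)"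
        by (rule Bochner_Integration.integral_cong) (auto simp: indicator_def)
      also have "\<dots> = (\<integral>z. indicator {z. norm z > h} z * ?sd x z \<partial>mu) + (\<integral>z. indicator {z. norm z \<le> h} z * ?sd x z \<partial>mu)"
        by (rule Bochner_Integration.integral_add[OF ind])
      finally have eq: "(\<integral>z. ?sd x z \<partial>mu) = (\<integral>z. indicator {z. norm z > h} z * ?sd x z \<partial>mu) + (\<integral>z. indicator {z. norm z \<le> h} z * ?sd x z \<partial>mu)" .
      have "a + (A + B) / 2 - (q + A / 2) = a - q + B / 2" for a A B q :: real
        by (simp add: field_simps)
      then show ?thesis unfolding levy_op_def Tf \<sigma>_def[symmetric] eq sum_subtractf .
    qed
    have "\<bar>levy_op Sg mu f x - (T f x - m * f x)\<bar> \<le> e * indicator (cball 0 R) x" for x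
    proof (cases "norm x \<le> R")
      case True
      have 1: "\<bar>\<Sum>i\<in>UNIV. ?dd i x - ?sd x (h *\<^sub>R \<sigma> i) / h\<^sup>2\<bar> \<le> Cs * h"
        unfolding Cs_def sum_distrib_right
        by (rule order_trans[OF sum_abs], rule sum_mono) (use C(2)[OF h(1)] in \<open>simp add: abs_minus_commute\<close>)
      have "\<bar>\<integral>z. indicator {z. norm z \<le> h} z * ?sd x z \<partial>mu\<bar> \<le> (\<integral>z. K * (indicator {z. norm z \<le> h} z * min ((norm z)\<^sup>2) 1) \<partial>mu)"
        by (rule order_trans[OF integral_abs_bound], rule integral_mono)
           (use ind iK K(2) in \<open>auto simp: indicator_def\<close>)
      also have "\<dots> = K * \<omega> h" by (simp add: \<omega>_def)
      finally have 2: "\<bar>\<integral>z. indicator {z. norm z \<le> h} z * ?sd x z \<partial>mu\<bar> \<le> K * \<omega> h" .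
      have "Cs * h + K * \<omega> h < e" using n by (simp add: h_def)
      then have "\<bar>levy_op Sg mu f x - (T f x - m * f x)\<bar> \<le> e" using 1 2 unfolding diff by linarith
      then show ?thesis using True by simp
    next
      case False
      have "h * norm (\<sigma> i) \<le> norm (\<sigma> i)" for i using h by (simp add: mult_left_le_one_le)
      then have "?sd x (h *\<^sub>R \<sigma> i) = 0" for i
        using False Rge(2)[of i] h by (intro sd0) (simp, smt (verit))
      moreover have "?dd i x = 0" for i using False Rge(3)[of i] by (intro R1(2)) simp
      moreover have "indicator {z. norm z \<le> h} z * ?sd x z = 0" for z
        using False Rge(1) h sd0[of z x] by (auto simp: indicator_def)
      then have "(\<integral>z. indicator {z. norm z \<le> h} z * ?sd x z \<partial>mu) = 0" by (simp only: Bochner_Integration.integral_zero)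
      ultimately have "levy_op Sg mu f x - (T f x - m * f x) = 0" unfolding diff by simp
      then show ?thesis using False by simp
    qed
    with T show "\<exists>T m. sym_op T m \<and> (\<forall>x. \<bar>levy_op Sg mu f x - (T f x - m * f x)\<bar> \<le> e * indicator (cball 0 R) x)"
      by blast
  qed
qed

text \<open>The functions \<open>T f - m f\<close> are integrable and converge to
  \<open>levy_op Sg mu f\<close> pointwise, which gives measurability; the difference from one of
  them is bounded and supported in a ball.\<close>

lemma integrable_levy_op:
  fixes Sg :: "real^'p::finite^'n::finite" and mu :: "(real^'n) measure"
  assumes mu: "levy_measure mu" and f: "test_fun UNIV f"
  shows "integrable lborel (levy_op Sg mu f)"
proof -
  have bb: "bounded_borel f"
    using smooth_fun_borel[OF test_fun_smooth[OF f]] test_fun_bounded[OF f] unfolding bounded_borel_def by metis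
  have i: "integrable lborel f" by (rule test_fun_integrable[OF f])
  obtain R where R: "\<And>e. e > 0 \<Longrightarrow> \<exists>T m. sym_op T m \<and>
    (\<forall>x. \<bar>levy_op Sg mu f x - (T f x - m * f x)\<bar> \<le> e * indicator (cball 0 R) x)"
    by (rule levy_op_approx[OF mu f]) blast
  have "\<exists>g. bounded_borel g \<and> integrable lborel g \<and> (\<forall>x. \<bar>levy_op Sg mu f x - g x\<bar> \<le> e * indicator (cball 0 R) x)"
    if e: "e > 0" for e
  proof -
    obtain T m where T: "sym_op T m" "\<And>x. \<bar>levy_op Sg mu f x - (T f x - m * f x)\<bar> \<le> e * indicator (cball 0 R) x"
      using R[OF e] by blast
    have "bounded_borel (\<lambda>x. T f x - m * f x)" "integrable lborel (\<lambda>x. T f x - m * f x)"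
      using sym_op.bounded_borel[OF T(1) bb] sym_op.integrable[OF T(1) bb i] bb i
      by (auto intro!: bounded_borel_diff bounded_borel_cmult)
    with T(2) show ?thesis by blast
  qed
  then have "\<exists>g. bounded_borel g \<and> integrable lborel g \<and> (\<forall>x. \<bar>levy_op Sg mu f x - g x\<bar> \<le> 1 / real (Suc n) * indicator (cball 0 R) x)" for n
    by (meson of_nat_0_less_iff zero_less_Suc zero_less_divide_1_iff)
  then obtain g where g: "\<And>n. bounded_borel (g n)" "\<And>n. integrable lborel (g n)"
     "\<And>n x. \<bar>levy_op Sg mu f x - g n x\<bar> \<le> 1 / real (Suc n) * indicator (cball 0 R) x"
    by metis
  have [measurable]: "levy_op Sg mu f \<in> borel_measurable borel"
  proof (rule borel_measurable_LIMSEQ_real[where u=g])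
    fix x
    have "\<bar>g n x - levy_op Sg mu f x\<bar> \<le> inverse (real (Suc n))" for n
    proof -
      have "1 / real (Suc n) * indicator (cball 0 R) x \<le> 1 / real (Suc n) * 1"
        by (intro mult_left_mono) (auto simp: indicator_def)
      then show ?thesis using g(3)[of x n] unfolding abs_minus_commute[of "g n x"] inverse_eq_divide by linarith
    qed
    then have "(\<lambda>n. g n x - levy_op Sg mu f x) \<longlonglongrightarrow> 0"
      by (intro Lim_null_comparison[OF _ LIMSEQ_inverse_real_of_nat]) simp
    then show "(\<lambda>n. g n x) \<longlonglongrightarrow> levy_op Sg mu f x" by (simp add: LIM_zero_iff)
  qed (use g(1) in auto)
  have "integrable lborel (\<lambda>x. levy_op Sg mu f x - g 0 x)"
  proof (rule Bochner_Integration.integrable_bound)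
    show "integrable lborel (indicator (cball 0 R) :: real^'n \<Rightarrow> real)"
      using emeasure_bounded_finite[OF bounded_cball, of "0::real^'n" R] by (simp add: integrable_indicator_iff)
  qed (use g(3)[of _ 0] g(1)[of 0] in auto)
  from Bochner_Integration.integrable_add[OF this g(2)[of 0]] show "integrable lborel (levy_op Sg mu f)" by simp
qed

section \<open>Product test functions \<open>\<rho>(y - x) \<theta>(t)\<close>\<close>

lemma dirderiv_uminus:
  "f differentiable (at x) \<Longrightarrow> dirderiv (\<lambda>x. - f x) v x = - dirderiv f v x"
  by (rule dirderiv_eqI) (intro has_derivative_minus has_derivative_dirderiv)

lemma
  fixes \<rho> :: "'a::euclidean_space \<Rightarrow> real" and \<theta> :: "real \<Rightarrow> real"
  assumes "smooth_fun \<rho>" "smooth_fun \<theta>"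
  shows smooth_fun_product: "smooth_fun (\<lambda>p. \<rho> (y - fst p) * \<theta> (snd p))"
    and dirderiv_product: "dirderiv (\<lambda>p. \<rho> (y - fst p) * \<theta> (snd p)) (v, s) =
      (\<lambda>p. \<rho> (y - fst p) * dirderiv \<theta> s (snd p) - dirderiv \<rho> v (y - fst p) * \<theta> (snd p))"
proof -
  have A: "bounded_linear (\<lambda>p::'a \<times> real. - fst p)" "bounded_linear (snd :: 'a \<times> real \<Rightarrow> real)"
    by (intro bounded_linear_minus bounded_linear_fst bounded_linear_snd)+
  have s1: "smooth_fun (\<lambda>p::'a \<times> real. \<rho> (y - fst p))"
    using smooth_fun_affine_comp[OF assms(1) A(1), of y] by simp
  have s2: "smooth_fun (\<lambda>p::'a \<times> real. \<theta> (snd p))"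
    using smooth_fun_affine_comp[OF assms(2) A(2), of 0] by simp
  show "smooth_fun (\<lambda>p. \<rho> (y - fst p) * \<theta> (snd p))" by (rule smooth_fun_mult[OF s1 s2])
  have d1: "dirderiv (\<lambda>p::'a \<times> real. \<rho> (y - fst p)) (v, s) p = - dirderiv \<rho> v (y - fst p)" for p
    using dirderiv_affine_comp[OF smooth_fun_differentiable[OF assms(1)] A(1), of y "(v, s)" p]
    by (simp add: dirderiv_uminus_direction[OF assms(1)])
  have d2: "dirderiv (\<lambda>p::'a \<times> real. \<theta> (snd p)) (v, s) p = dirderiv \<theta> s (snd p)" for p
    using dirderiv_affine_comp[OF smooth_fun_differentiable[OF assms(2)] A(2), of 0 "(v, s)" p] by simp
  show "dirderiv (\<lambda>p. \<rho> (y - fst p) * \<theta> (snd p)) (v, s) =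
      (\<lambda>p. \<rho> (y - fst p) * dirderiv \<theta> s (snd p) - dirderiv \<rho> v (y - fst p) * \<theta> (snd p))"
    by (rule ext, subst dirderiv_mult)
       (simp_all add: d1 d2 smooth_fun_differentiable s1 s2)
qed

lemma test_fun_product:
  fixes \<rho> :: "'a::euclidean_space \<Rightarrow> real" and \<theta> :: "real \<Rightarrow> real"
  assumes "test_fun UNIV \<rho>" "test_fun S \<theta>"
  shows "test_fun (UNIV \<times> S) (\<lambda>p. \<rho> (y - fst p) * \<theta> (snd p))"
proof (rule test_funI)
  show "smooth_fun (\<lambda>p. \<rho> (y - fst p) * \<theta> (snd p))"
    by (intro smooth_fun_product test_fun_smooth[OF assms(1)] test_fun_smooth[OF assms(2)])
  show "compact (((\<lambda>x. y - x) ` tsupp \<rho>) \<times> tsupp \<theta>)"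
    using assms by (intro compact_Times compact_continuous_image continuous_intros) (auto simp: test_fun_def)
  show "((\<lambda>x. y - x) ` tsupp \<rho>) \<times> tsupp \<theta> \<subseteq> UNIV \<times> S"
    using assms by (auto simp: test_fun_def)
  fix p assume nz: "\<rho> (y - fst p) * \<theta> (snd p) \<noteq> 0"
  then have "y - fst p \<in> tsupp \<rho>" "snd p \<in> tsupp \<theta>"
    using not_in_tsupp[of "y - fst p" \<rho>] not_in_tsupp[of "snd p" \<theta>] by auto
  then have "y - (y - fst p) \<in> (\<lambda>x. y - x) ` tsupp \<rho>" "snd p \<in> tsupp \<theta>" by blast+
  then show "p \<in> ((\<lambda>x. y - x) ` tsupp \<rho>) \<times> tsupp \<theta>" by (cases p) auto
qed

text \<open>Testing with \<open>\<rho>(y - x)\<close> reverses the jumps. Reflection invariance of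
  \<open>mu\<close> undoes this and also allows \<open>G(z)\<close> and \<open>G(-z)\<close> to be
  averaged, whereupon the compensators cancel. With test functions of this form the weak equation
  becomes a statement about convolutions.\<close>

lemma frakL_product:
  fixes Sg :: "real^'p::finite^'n::finite" and mu :: "(real^'n) measure"
  assumes mu: "levy_measure mu" and \<rho>: "test_fun UNIV \<rho>" and \<theta>: "smooth_fun \<theta>"
  shows "frakL Sg mu (\<lambda>p. \<rho> (y - fst p) * \<theta> (snd p)) p = levy_op Sg mu \<rho> (y - fst p) * \<theta> (snd p)"
proof -
  have [measurable_cong]: "sets mu = sets borel" using mu by (rule levy_measure_sets)
  note sm = test_fun_smooth[OF \<rho>]
  have [measurable]: "\<rho> \<in> borel_measurable borel" by (rule smooth_fun_borel[OF sm])
  have lin: "linear (\<lambda>v. dirderiv \<rho> v x)" for x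
    using has_derivative_linear[OF smooth_fun_has_derivative[OF sm]] .
  have d1: "dirderiv (\<lambda>p. \<rho> (y - fst p) * \<theta> (snd p)) (v, 0) = (\<lambda>p. - dirderiv \<rho> v (y - fst p) * \<theta> (snd p))" for v
  proof -
    have "dirderiv \<theta> 0 t = 0" for t
      using linear_0[OF has_derivative_linear[OF smooth_fun_has_derivative[OF \<theta>]]] .
    then show ?thesis by (simp add: dirderiv_product[OF sm \<theta>])
  qed
  have d1': "dirderiv (\<lambda>p. \<rho> (y - fst p) * \<theta> (snd p)) (v, 0) q = - dirderiv \<rho> v (y - fst q) * \<theta> (snd q)" for v q
    by (simp only: d1)
  have d2: "dirderiv (dirderiv (\<lambda>p. \<rho> (y - fst p) * \<theta> (snd p)) (v, 0)) (v, 0) p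
      = dirderiv (dirderiv \<rho> v) v (y - fst p) * \<theta> (snd p)" for v
  proof -
    note smd = smooth_fun_dirderiv[OF sm, of v]
    have "dirderiv (dirderiv (\<lambda>p. \<rho> (y - fst p) * \<theta> (snd p)) (v, 0)) (v, 0) p
       = dirderiv (\<lambda>p. - (dirderiv \<rho> v (y - fst p) * \<theta> (snd p))) (v, 0) p"
      unfolding d1 by simp
    also have "\<dots> = - dirderiv (\<lambda>p. dirderiv \<rho> v (y - fst p) * \<theta> (snd p)) (v, 0) p"
      by (intro dirderiv_uminus smooth_fun_differentiable smooth_fun_product smd \<theta>)
    also have "dirderiv \<theta> 0 t = 0" for t
      using linear_0[OF has_derivative_linear[OF smooth_fun_has_derivative[OF \<theta>]]] .
    then have "- dirderiv (\<lambda>p. dirderiv \<rho> v (y - fst p) * \<theta> (snd p)) (v, 0) p = dirderiv (dirderiv \<rho> v) v (y - fst p) * \<theta> (snd p)"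
      by (simp add: dirderiv_product[OF smd \<theta>])
    finally show ?thesis .
  qed
  obtain x t where p: "p = (x, t)" by (cases p)
  define w where "w = y - x"
  define G where "G z = \<rho> (w + z) - \<rho> w - (if norm z \<le> 1 then dirderiv \<rho> z w else 0)" for z
  obtain C where C: "C > 0" "\<And>z. \<bar>G z\<bar> \<le> C * min ((norm z)\<^sup>2) 1"
    unfolding G_def by (rule second_difference_bound[OF \<rho>]) blast
  have "(\<lambda>z. dirderiv \<rho> z w) \<in> borel_measurable borel"
    by (intro borel_measurable_continuous_onI linear_continuous_on linear_conv_bounded_linear[THEN iffD1] lin)
  then have [measurable]: "G \<in> borel_measurable borel"
    unfolding G_def[abs_def] by measurable
  have Gi: "integrable mu G"
    by (rule Bochner_Integration.integrable_bound[where f="\<lambda>z. C * min ((norm z)\<^sup>2) 1"])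
       (use C levy_measure_integrable[OF mu] in auto)
  have G': "(\<integral>z. G (- z) \<partial>mu) = (\<integral>z. G z \<partial>mu)" "integrable mu (\<lambda>z. G (- z))"
    using levy_measure_reflect[OF mu, of G] Gi by auto
  have "(\<integral>z. G z \<partial>mu) + (\<integral>z. G (- z) \<partial>mu) = (\<integral>z. G z + G (- z) \<partial>mu)"
    by (rule Bochner_Integration.integral_add[OF Gi G'(2), symmetric])
  also have "\<dots> = (\<integral>z. \<rho> (w + z) + \<rho> (w - z) - 2 * \<rho> w \<partial>mu)"
    by (rule Bochner_Integration.integral_cong) (auto simp: G_def dirderiv_uminus_direction[OF sm])
  finally have sum: "(\<integral>z. G (- z) \<partial>mu) = (\<integral>z. \<rho> (w + z) + \<rho> (w - z) - 2 * \<rho> w \<partial>mu) / 2"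
    using G'(1) by simp
  have "nonlocal_op mu (\<lambda>p. \<rho> (y - fst p) * \<theta> (snd p)) p = (\<integral>z. G (- z) * \<theta> t \<partial>mu)"
    unfolding nonlocal_op_def p d1'
    by (rule Bochner_Integration.integral_cong)
       (auto simp: G_def w_def dirderiv_uminus_direction[OF sm] algebra_simps)
  also have "\<dots> = (\<integral>z. \<rho> (w + z) + \<rho> (w - z) - 2 * \<rho> w \<partial>mu) / 2 * \<theta> t"
    using sum by simp
  finally have nl: "nonlocal_op mu (\<lambda>p. \<rho> (y - fst p) * \<theta> (snd p)) p =
      (\<integral>z. \<rho> (w + z) + \<rho> (w - z) - 2 * \<rho> w \<partial>mu) / 2 * \<theta> t" .
  show ?thesis
    unfolding frakL_def local_op_def d2 levy_op_def nl distrib_right sum_distrib_right by (simp add: p w_def)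
qed

section \<open>Convolution with approximate identities\<close>

text \<open>Translations preserve the \<open>L1\<close> norm, so the property passes to
  \<open>L1\<close> limits. This serves both the indicator case and the limit case of the induction
  in \<open>L1_translation_continuous\<close>.\<close>

lemma L1_translation_approx:
  fixes f :: "'a::euclidean_space \<Rightarrow> real"
  assumes f: "integrable lborel f" and z: "z \<longlonglongrightarrow> 0"
    and approx: "\<And>e. e > 0 \<Longrightarrow> \<exists>g. integrable lborel g \<and> (LBINT x. \<bar>f x - g x\<bar>) \<le> e \<and>
        (\<lambda>n. LBINT x. \<bar>g (z n + x) - g x\<bar>) \<longlonglongrightarrow> 0"
  shows "(\<lambda>n. LBINT x. \<bar>f (z n + x) - f x\<bar>) \<longlonglongrightarrow> 0"
proof (rule LIMSEQ_I)
  fix e :: real assume "e > 0"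
  then have "e / 3 > 0" by simp
  from approx[OF this] obtain g where g: "integrable lborel g" "(LBINT x. \<bar>f x - g x\<bar>) \<le> e / 3"
    "(\<lambda>n. LBINT x. \<bar>g (z n + x) - g x\<bar>) \<longlonglongrightarrow> 0" by blast
  have [measurable]: "f \<in> borel_measurable borel" "g \<in> borel_measurable borel" using f g by auto
  have sh: "integrable lborel (\<lambda>x. f (z n + x))" "integrable lborel (\<lambda>x. g (z n + x))" for n
    using f g by (simp_all add: integrable_shift)
  have le: "(LBINT x. \<bar>f (z n + x) - f x\<bar>) \<le> 2 * (e / 3) + (LBINT x. \<bar>g (z n + x) - g x\<bar>)" for n
  proof -
    have "(LBINT x. \<bar>f (z n + x) - f x\<bar>) \<le>
      (LBINT x. \<bar>f (z n + x) - g (z n + x)\<bar> + \<bar>g (z n + x) - g x\<bar> + \<bar>f x - g x\<bar>)"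
      by (rule integral_mono) (use sh f g in auto)
    also have "\<dots> = (LBINT x. \<bar>f (z n + x) - g (z n + x)\<bar>) + (LBINT x. \<bar>g (z n + x) - g x\<bar>) + (LBINT x. \<bar>f x - g x\<bar>)"
      using sh f g by simp
    also have "(LBINT x. \<bar>f (z n + x) - g (z n + x)\<bar>) = (LBINT x. \<bar>f x - g x\<bar>)"
      by (rule integral_shift[of "\<lambda>x. \<bar>f x - g x\<bar>"]) measurable
    finally show ?thesis using g(2) by linarith
  qed
  obtain N where N: "\<And>n. n \<ge> N \<Longrightarrow> \<bar>LBINT x. \<bar>g (z n + x) - g x\<bar>\<bar> < e / 3"
    using LIMSEQ_D[OF g(3) \<open>e / 3 > 0\<close>] by auto
  have "norm ((LBINT x. \<bar>f (z n + x) - f x\<bar>) - 0) < e" if "n \<ge> N" for n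
  proof -
    have "0 \<le> (LBINT x. \<bar>f (z n + x) - f x\<bar>)" by simp
    then show ?thesis using le[of n] N[OF that] unfolding real_norm_def by linarith
  qed
  then show "\<exists>N. \<forall>n\<ge>N. norm ((LBINT x. \<bar>f (z n + x) - f x\<bar>) - 0) < e" by blast
qed

text \<open>A point \<open>x\<close> of the open set \<open>U\<close> eventually has
  \<open>z n + x\<close> in \<open>U\<close>, so the part of \<open>U\<close> that is lost shrinks
  by dominated convergence. The part gained has the same measure: in
  \<open>|a - b| = 2 b (1 - a) + (a - b)\<close>, valid for \<open>a\<close> and \<open>b\<close> in
  \<open>{0, 1}\<close>, the last bracket integrates to \<open>0\<close>.\<close>

lemma L1_translation_open:
  fixes U :: "'a::euclidean_space set"
  assumes U: "open U" "emeasure lborel U < \<infinity>" and z: "z \<longlonglongrightarrow> 0"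
  shows "(\<lambda>n. LBINT x. \<bar>indicator U (z n + x) - indicator U x :: real\<bar>) \<longlonglongrightarrow> 0"
proof -
  have [measurable]: "U \<in> sets borel" using U by simp
  have i: "integrable lborel (indicator U :: 'a \<Rightarrow> real)" using U by (simp add: integrable_indicator_iff)
  have ish: "integrable lborel (\<lambda>x. indicator U (z n + x) :: real)" for n
    using i integrable_shift[of "indicator U" "z n"] by simp
  have "(\<lambda>n. LBINT x. indicator U x * (1 - indicator U (z n + x) :: real)) \<longlonglongrightarrow> (\<integral>x. 0 \<partial>(lborel :: 'a measure))"
  proof (rule integral_dominated_convergence[where w="indicator U"])
    show "AE x in lborel. (\<lambda>n. indicator U x * (1 - indicator U (z n + x)) :: real) \<longlonglongrightarrow> 0"
    proof (rule AE_I2)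
      fix x :: 'a
      show "(\<lambda>n. indicator U x * (1 - indicator U (z n + x)) :: real) \<longlonglongrightarrow> 0"
      proof (cases "x \<in> U")
        case True
        have "(\<lambda>n. z n + x) \<longlonglongrightarrow> 0 + x" by (intro tendsto_add z tendsto_const)
        then have "\<forall>\<^sub>F n in sequentially. z n + x \<in> U"
          using topological_tendstoD[OF _ U(1)] True by auto
        then have "\<forall>\<^sub>F n in sequentially. indicator U x * (1 - indicator U (z n + x)) = (0::real)"
          by (rule eventually_mono) simp
        then show ?thesis by (rule tendsto_eventually)
      qed simp
    qed
  qed (use i in \<open>auto simp: indicator_def\<close>)
  then have "(\<lambda>n. 2 * (LBINT x. indicator U x * (1 - indicator U (z n + x)))) \<longlonglongrightarrow> 2 * (0::real)"
    by (intro tendsto_mult tendsto_const) simp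
  moreover have "(LBINT x. \<bar>indicator U (z n + x) - indicator U x :: real\<bar>) =
      2 * (LBINT x. indicator U x * (1 - indicator U (z n + x)))" for n
  proof -
    have j: "integrable lborel (\<lambda>x. indicator U x * (1 - indicator U (z n + x)) :: real)"
      by (rule Bochner_Integration.integrable_bound[OF i]) (auto simp: indicator_def)
    have "(LBINT x. \<bar>indicator U (z n + x) - indicator U x :: real\<bar>) =
      (LBINT x. 2 * (indicator U x * (1 - indicator U (z n + x))) + (indicator U (z n + x) - indicator U x))"
      by (rule Bochner_Integration.integral_cong) (auto simp: indicator_def)
    also have "\<dots> = 2 * (LBINT x. indicator U x * (1 - indicator U (z n + x))) +
        ((LBINT x. indicator U (z n + x)) - (LBINT x. indicator U x))"
      using i ish j by simp
    also have "(LBINT x. indicator U (z n + x)) = (LBINT x. (indicator U x :: real))"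
      by (rule integral_shift) simp
    finally show ?thesis by simp
  qed
  ultimately show ?thesis by simp
qed

lemma L1_translation_continuous:
  fixes f :: "'a::euclidean_space \<Rightarrow> real"
  assumes "integrable lborel f" "z \<longlonglongrightarrow> 0"
  shows "(\<lambda>n. LBINT x. \<bar>f (z n + x) - f x\<bar>) \<longlonglongrightarrow> 0"
  using assms(1)
proof (induction rule: integrable_induct)
  case (base A c)
  have [measurable]: "A \<in> sets borel" using base by simp
  have iA: "integrable lborel (\<lambda>x. indicator A x *\<^sub>R c)"
    using base by simp
  show ?case
  proof (rule L1_translation_approx[OF iA assms(2)])
    fix e :: real assume e: "e > 0"
    define d where "d = e / (\<bar>c\<bar> + 1)"
    have d: "d > 0" using e by (simp add: d_def)
    \<comment> \<open>Outer regularity replaces the Borel set by an open one, at an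
      \<open>L1\<close> cost of at most \<open>|c| d <= e\<close>.\<close>
    obtain U where U: "open U" "A \<subseteq> U" "emeasure lborel (U - A) < ennreal d"
      using outer_regular_lborel[OF \<open>A \<in> sets borel\<close> d] by blast
    have "emeasure lborel U \<le> emeasure lborel A + emeasure lborel (U - A)"
      using U(1,2) by (subst plus_emeasure) (auto simp: Un_absorb1)
    also have "\<dots> < \<infinity>" using base(2) U(3) by (auto simp: less_top[symmetric] ennreal_add_eq_top top_unique)
    finally have fU: "emeasure lborel U < \<infinity>" .
    have iU: "integrable lborel (indicator U :: 'a \<Rightarrow> real)" using U fU by (simp add: integrable_indicator_iff)
    have eq: "\<bar>c\<bar> * \<bar>a - b\<bar> = \<bar>a * c - b * c\<bar>" for a b :: real
      by (simp add: abs_mult[symmetric] algebra_simps)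
    have m: "measure lborel (U - A) \<le> d"
      unfolding measure_def by (intro enn2real_leI less_imp_le d U(3))
    show "\<exists>g. integrable lborel g \<and> (LBINT x. \<bar>indicator A x *\<^sub>R c - g x\<bar>) \<le> e \<and>
        (\<lambda>n. LBINT x. \<bar>g (z n + x) - g x\<bar>) \<longlonglongrightarrow> 0"
    proof (intro exI[of _ "\<lambda>x. indicator U x * c"] conjI)
      show "integrable lborel (\<lambda>x. indicator U x * c)" using iU by simp
      have "(LBINT x. \<bar>indicator A x *\<^sub>R c - indicator U x * c\<bar>) = (LBINT x. \<bar>c\<bar> * indicator (U - A) x)"
        using U(2) by (intro Bochner_Integration.integral_cong) (auto simp: indicator_def)
      also have "\<dots> = \<bar>c\<bar> * measure lborel (U - A)" using U(1) by simp
      also have "\<dots> \<le> \<bar>c\<bar> * d" using m by (intro mult_left_mono) auto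
      also have "\<dots> \<le> e" using e by (simp add: d_def field_simps)
      finally show "(LBINT x. \<bar>indicator A x *\<^sub>R c - indicator U x * c\<bar>) \<le> e" .
      have "(\<lambda>n. \<bar>c\<bar> * (LBINT x. \<bar>indicator U (z n + x) - indicator U x\<bar>)) \<longlonglongrightarrow> \<bar>c\<bar> * 0"
        by (intro tendsto_mult tendsto_const L1_translation_open U(1) fU assms(2))
      then show "(\<lambda>n. LBINT x. \<bar>indicator U (z n + x) * c - indicator U x * c\<bar>) \<longlonglongrightarrow> 0"
        by (simp add: eq[symmetric])
    qed
  qed
next
  case (add f g)
  have [measurable]: "f \<in> borel_measurable borel" "g \<in> borel_measurable borel" using add by auto
  have sh: "integrable lborel (\<lambda>x. f (z n + x))" "integrable lborel (\<lambda>x. g (z n + x))" for n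
    using add by (simp_all add: integrable_shift)
  have "(\<lambda>n. (LBINT x. \<bar>f (z n + x) - f x\<bar>) + (LBINT x. \<bar>g (z n + x) - g x\<bar>)) \<longlonglongrightarrow> 0 + 0"
    by (intro tendsto_add add)
  then have l: "(\<lambda>n. LBINT x. \<bar>f (z n + x) - f x\<bar> + \<bar>g (z n + x) - g x\<bar>) \<longlonglongrightarrow> 0"
    using sh add by simp
  show ?case
  proof (rule tendsto_sandwich[OF _ _ tendsto_const l]; rule always_eventually; intro allI)
    show "(LBINT x. \<bar>f (z n + x) + g (z n + x) - (f x + g x)\<bar>) \<le> (LBINT x. \<bar>f (z n + x) - f x\<bar> + \<bar>g (z n + x) - g x\<bar>)" for n
      by (rule integral_mono) (use sh add in auto)
  qed simp
next
  case (lim f s)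
  have [measurable]: "f \<in> borel_measurable borel" "\<And>i. s i \<in> borel_measurable borel" using lim by auto
  have l: "(\<lambda>i. LBINT x. \<bar>f x - s i x\<bar>) \<longlonglongrightarrow> (\<integral>x. 0 \<partial>(lborel :: 'a measure))"
  proof (rule integral_dominated_convergence[where w="\<lambda>x. 3 * \<bar>f x\<bar>"])
    show "AE x in lborel. (\<lambda>i. \<bar>f x - s i x\<bar>) \<longlonglongrightarrow> 0"
    proof (rule AE_I2)
      fix x :: 'a
      have "(\<lambda>i. \<bar>f x - s i x\<bar>) \<longlonglongrightarrow> \<bar>f x - f x\<bar>"
        using lim(2)[of x] by (intro tendsto_intros) simp
      then show "(\<lambda>i. \<bar>f x - s i x\<bar>) \<longlonglongrightarrow> 0" by simp
    qed
    show "AE x in lborel. norm \<bar>f x - s i x\<bar> \<le> 3 * \<bar>f x\<bar>" for i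
    proof (rule AE_I2)
      fix x :: 'a
      show "norm \<bar>f x - s i x\<bar> \<le> 3 * \<bar>f x\<bar>"
        using lim(3)[of x i] abs_triangle_ineq4[of "f x" "s i x"] by simp
    qed
  qed (use lim in auto)
  show ?case
  proof (rule L1_translation_approx[OF lim(4) assms(2)])
    fix e :: real assume "e > 0"
    then obtain i where i: "(LBINT x. \<bar>f x - s i x\<bar>) < e"
      using order_tendstoD(2)[OF l, of e] by (auto simp: eventually_sequentially)
    then show "\<exists>g. integrable lborel g \<and> (LBINT x. \<bar>f x - g x\<bar>) \<le> e \<and>
        (\<lambda>n. LBINT x. \<bar>g (z n + x) - g x\<bar>) \<longlonglongrightarrow> 0"
      using lim(1,5)[of i] by (intro exI[of _ "s i"]) auto
  qed
qed

text \<open>By Fubini the error is at most the average under \<open>k n\<close> of the translation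
  modulus \<open>\<omega>\<close>, and for large \<open>n\<close> the kernel only sees points where
  \<open>\<omega>\<close> is at most \<open>e / 2\<close>.\<close>

lemma approximate_identity:
  fixes f :: "'a::euclidean_space \<Rightarrow> real"
  assumes f: "integrable lborel f"
    and k: "\<And>n. integrable lborel (k n)" "\<And>n x. k n x \<ge> 0" "\<And>n. integral\<^sup>L lborel (k n) = 1"
      "\<And>n x. norm x \<ge> r n \<Longrightarrow> k n x = 0"
    and r: "r \<longlonglongrightarrow> 0"
  shows "(\<lambda>n. LBINT x. \<bar>conv f (k n) x - f x\<bar>) \<longlonglongrightarrow> 0"
proof (rule LIMSEQ_I)
  fix e :: real assume e: "e > 0"
  have [measurable]: "f \<in> borel_measurable borel" "\<And>n. k n \<in> borel_measurable borel" using f k by auto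
  define \<omega> where "\<omega> x = (LBINT y. \<bar>f (y - x) - f y\<bar>)" for x
  have shf: "integrable lborel (\<lambda>y. f (y - x))" "(LBINT y. \<bar>f (y - x)\<bar>) = (LBINT y. \<bar>f y\<bar>)" for x
    using integrable_shift[of f "-x"] integral_shift[of "\<lambda>y. \<bar>f y\<bar>" "-x"] f by simp_all
  \<comment> \<open>A modulus at \<open>0\<close> is extracted from sequential continuity by
    contradiction: otherwise some \<open>x n\<close> tends to \<open>0\<close> with
    \<open>\<omega> (x n) > e / 2\<close>.\<close>
  obtain d where d: "d > 0" "\<And>x. norm x < d \<Longrightarrow> \<omega> x \<le> e / 2"
  proof (rule ccontr)
    assume "\<not> thesis"
    then have "\<forall>d>0. \<exists>x. norm x < d \<and> \<omega> x > e / 2" using that by (meson not_le)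
    then have "\<exists>x. norm x < 1 / real (Suc n) \<and> \<omega> x > e / 2" for n by simp
    then obtain x where x: "\<And>n. norm (x n) < 1 / real (Suc n)" "\<And>n. \<omega> (x n) > e / 2" by metis
    have "(\<lambda>n. - x n) \<longlonglongrightarrow> 0"
      by (rule Lim_null_comparison[OF _ LIMSEQ_inverse_real_of_nat])
         (use x(1) in \<open>auto simp: inverse_eq_divide intro!: always_eventually less_imp_le\<close>)
    from L1_translation_continuous[OF f this] have "(\<lambda>n. \<omega> (x n)) \<longlonglongrightarrow> 0" by (simp add: \<omega>_def)
    then obtain n where "\<omega> (x n) < e / 2"
      using order_tendstoD(2)[of _ 0 sequentially "e / 2"] e by (auto simp: eventually_sequentially)
    then show False using x(2)[of n] by simp
  qed
  obtain N where N: "\<And>n. n \<ge> N \<Longrightarrow> r n < d"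
    using order_tendstoD(2)[OF r d(1)] by (auto simp: eventually_sequentially)
  have "norm ((LBINT x. \<bar>conv f (k n) x - f x\<bar>) - 0) < e" if n: "n \<ge> N" for n
  proof -
    have F: "integrable (lborel \<Otimes>\<^sub>M lborel) (\<lambda>(x, y). k n x * \<bar>f (y - x) - f y\<bar>)"
    proof (rule lborel_pair.Fubini_integrable)
      have 1: "(LBINT y. norm (case (x, y) of (x, y) \<Rightarrow> k n x * \<bar>f (y - x) - f y\<bar>)) = k n x * \<omega> x" for x
        using k(2)[of n x] by (simp add: abs_mult \<omega>_def)
      have [measurable]: "\<omega> \<in> borel_measurable borel" unfolding \<omega>_def[abs_def] by measurable
      have "\<bar>\<omega> x\<bar> \<le> 2 * (LBINT y. \<bar>f y\<bar>)" for x
      proof -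
        have "\<omega> x \<le> (LBINT y. \<bar>f (y - x)\<bar> + \<bar>f y\<bar>)"
          unfolding \<omega>_def by (rule integral_mono) (use shf f in auto)
        also have "\<dots> = 2 * (LBINT y. \<bar>f y\<bar>)" using shf f by simp
        finally show ?thesis by (simp add: \<omega>_def)
      qed
      then have "bounded_borel \<omega>" by (intro bounded_borelI) auto
      from integrable_mult_bounded(1)[OF k(1) this]
      show "integrable lborel (\<lambda>x. LBINT y. norm (case (x, y) of (x, y) \<Rightarrow> k n x * \<bar>f (y - x) - f y\<bar>))"
        unfolding 1 .
      show "AE x in lborel. integrable lborel (\<lambda>y. case (x, y) of (x, y) \<Rightarrow> k n x * \<bar>f (y - x) - f y\<bar>)"
        using shf f by auto
    qed measurable
    have c: "\<bar>conv f (k n) y - f y\<bar> \<le> (LBINT x. k n x * \<bar>f (y - x) - f y\<bar>)"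
      if i: "integrable lborel (\<lambda>x. k n x * \<bar>f (y - x) - f y\<bar>)" for y
    proof -
      have i1: "integrable lborel (\<lambda>x. k n x * (f (y - x) - f y))"
        by (rule Bochner_Integration.integrable_bound[OF i]) (auto simp: abs_mult)
      have i2: "integrable lborel (\<lambda>x. k n x * f y)" using k(1) by simp
      have i3: "integrable lborel (\<lambda>x. k n x * f (y - x))"
        using Bochner_Integration.integrable_add[OF i1 i2] by (simp add: algebra_simps)
      have "conv f (k n) y = (LBINT x. k n x * f (y - x))"
        unfolding conv_def using integral_reflect[of "\<lambda>x. k n x * f (y - x)" y] by (simp add: mult.commute)
      then have "conv f (k n) y - f y = (LBINT x. k n x * f (y - x)) - (LBINT x. k n x * f y)"
        using k(3) by simp
      also have "\<dots> = (LBINT x. k n x * (f (y - x) - f y))"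
        using Bochner_Integration.integral_diff[OF i3 i2] by (simp add: algebra_simps)
      also have "\<bar>\<dots>\<bar> \<le> (LBINT x. \<bar>k n x * (f (y - x) - f y)\<bar>)" by (rule integral_abs_bound)
      also have "\<dots> = (LBINT x. k n x * \<bar>f (y - x) - f y\<bar>)" using k(2) by (simp add: abs_mult)
      finally show ?thesis .
    qed
    have "(LBINT y. \<bar>conv f (k n) y - f y\<bar>) \<le> (LBINT y. LBINT x. k n x * \<bar>f (y - x) - f y\<bar>)"
    proof (rule integral_mono_AE)
      show "integrable lborel (\<lambda>y. \<bar>conv f (k n) y - f y\<bar>)" using integrable_conv[OF f k(1)] f by auto
      show "integrable lborel (\<lambda>y. LBINT x. k n x * \<bar>f (y - x) - f y\<bar>)" using lborel_pair.integrable_snd[OF F] .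
      show "AE y in lborel. \<bar>conv f (k n) y - f y\<bar> \<le> (LBINT x. k n x * \<bar>f (y - x) - f y\<bar>)"
        using lborel_pair.AE_integrable_snd[OF F] by eventually_elim (rule c)
    qed
    also have "\<dots> = (LBINT x. LBINT y. k n x * \<bar>f (y - x) - f y\<bar>)"
      by (rule lborel_pair.Fubini_integral[OF F])
    also have "\<dots> \<le> (LBINT x. k n x * (e / 2))"
    proof (rule integral_mono)
      show "integrable lborel (\<lambda>x. LBINT y. k n x * \<bar>f (y - x) - f y\<bar>)" using lborel_pair.integrable_fst[OF F] .
      show "(LBINT y. k n x * \<bar>f (y - x) - f y\<bar>) \<le> k n x * (e / 2)" for x
      proof (cases "norm x < d")
        case True
        have "(LBINT y. k n x * \<bar>f (y - x) - f y\<bar>) = k n x * \<omega> x" by (simp add: \<omega>_def)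
        also have "\<dots> \<le> k n x * (e / 2)" by (rule mult_left_mono[OF d(2)[OF True] k(2)])
        finally show ?thesis .
      next
        case False
        then have "k n x = 0" using N[OF n] by (intro k(4)) simp
        then show ?thesis by simp
      qed
    qed (use k in simp)
    also have "\<dots> = e / 2" using k(3) by simp
    finally show ?thesis using e by simp
  qed
  then show "\<exists>N. \<forall>n\<ge>N. norm ((LBINT x. \<bar>conv f (k n) x - f x\<bar>) - 0) < e" by blast
qed

text \<open>Fubini, with the reflected kernel as adjoint. It moves a mollifier from a function that
  is merely bounded onto an integrable one, where mollification converges in norm.\<close>

lemma conv_adjoint:
  fixes f w k :: "'a::euclidean_space \<Rightarrow> real"
  assumes f: "integrable lborel f" and w: "bounded_borel w" and k: "integrable lborel k"
  shows "(LBINT x. f x * conv w k x) = (LBINT x. conv f (\<lambda>x. k (- x)) x * w x)"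
proof -
  have [measurable]: "f \<in> borel_measurable borel" "k \<in> borel_measurable borel" "w \<in> borel_measurable borel"
    using f k w by auto
  have k': "integrable lborel (\<lambda>x. k (- x))" using integrable_reflect[of k 0] k by simp
  obtain C where C: "C \<ge> 0" "\<And>x. \<bar>w x\<bar> \<le> C" using w by (auto elim: bounded_borelE)
  have "integrable (lborel \<Otimes>\<^sub>M lborel) (\<lambda>(x, y). f x * k (x - y) * w y)"
  proof (rule Bochner_Integration.integrable_bound)
    show "integrable (lborel \<Otimes>\<^sub>M lborel) (\<lambda>p. C * (case p of (x, y) \<Rightarrow> f x * k (- (y - x))))"
      using integrable_conv_kernel[OF f k'] by simp
    show "AE p in lborel \<Otimes>\<^sub>M lborel. norm (case p of (x, y) \<Rightarrow> f x * k (x - y) * w y) \<le> norm (C * (case p of (x, y) \<Rightarrow> f x * k (- (y - x))))"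
      using C by (intro AE_I2) (auto simp: abs_mult mult.commute[of C] intro!: mult_mono)
  qed measurable
  from lborel_pair.Fubini_integral[OF this]
  have "(LBINT y. LBINT x. f x * k (x - y) * w y) = (LBINT x. LBINT y. f x * k (x - y) * w y)" .
  moreover have "f x * conv w k x = (LBINT y. f x * k (x - y) * w y)" for x
    unfolding conv_def by (subst Bochner_Integration.integral_mult_right_zero[symmetric]) (simp add: mult_ac)
  moreover have "conv f (\<lambda>x. k (- x)) y * w y = (LBINT x. f x * k (x - y) * w y)" for y
    unfolding conv_def by (subst Bochner_Integration.integral_mult_left_zero[symmetric]) simp
  ultimately show ?thesis by (simp only:)
qed

section \<open>The mollified evolution\<close>

lemma borel_measurable_fst [measurable]:
  "(fst :: 'a::second_countable_topology \<times> 'b::second_countable_topology \<Rightarrow> 'a) \<in> borel_measurable borel"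
  and borel_measurable_snd [measurable]:
  "(snd :: 'a \<times> 'b \<Rightarrow> 'b) \<in> borel_measurable borel"
  by (intro borel_measurable_continuous_onI continuous_intros)+

lemma bounded_borel_mult:
  assumes "bounded_borel f" "bounded_borel g" shows "bounded_borel (\<lambda>t. f t * g t)"
proof -
  obtain A where "A \<ge> 0" "\<And>x. \<bar>f x\<bar> \<le> A" using assms(1) by (auto elim: bounded_borelE)
  moreover obtain B where "B \<ge> 0" "\<And>x. \<bar>g x\<bar> \<le> B" using assms(2) by (auto elim: bounded_borelE)
  ultimately have "\<bar>f x * g x\<bar> \<le> A * B" for x by (simp add: abs_mult mult_mono)
  then show ?thesis using assms by (intro bounded_borelI) auto
qed

lemma bounded_borel_comp:
  assumes "bounded_borel f" "g \<in> borel_measurable borel" shows "bounded_borel (\<lambda>t. f (g t))"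
proof -
  have "(\<lambda>t. f (g t)) \<in> borel_measurable borel"
    using assms by (auto intro: measurable_compose)
  then show ?thesis using assms(1) unfolding bounded_borel_def by blast
qed

text \<open>A smoothed Dirac mass \<open>\<beta>\<close> and the matching smoothed Heaviside
  function \<open>\<Theta>\<close>. Such pairs are used at scale \<open>\<kappa>\<close> to mollify
  in time and at scale \<open>h\<close> to cut off at \<open>t = 0\<close>.\<close>

definition mollifier_step :: "real \<Rightarrow> (real \<Rightarrow> real) \<Rightarrow> (real \<Rightarrow> real) \<Rightarrow> bool" where
  "mollifier_step \<kappa> \<beta> \<Theta> \<longleftrightarrow> test_fun UNIV \<beta> \<and> (\<forall>x. 0 \<le> \<beta> x) \<and> (\<forall>x. \<kappa> \<le> \<bar>x\<bar> \<longrightarrow> \<beta> x = 0) \<and>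
     integral\<^sup>L lborel \<beta> = 1 \<and> (\<forall>r. (\<Theta> has_real_derivative \<beta> r) (at r)) \<and> smooth_fun \<Theta> \<and>
     (\<forall>r\<le>-\<kappa>. \<Theta> r = 0) \<and> (\<forall>r\<ge>\<kappa>. \<Theta> r = 1) \<and> (\<forall>r. 0 \<le> \<Theta> r \<and> \<Theta> r \<le> 1)"

lemma mollifier_step_exists:
  assumes "\<kappa> > 0" shows "\<exists>\<beta> \<Theta>. mollifier_step \<kappa> \<beta> \<Theta>"
proof -
  obtain \<beta> :: "real \<Rightarrow> real" where b: "test_fun UNIV \<beta>" "\<And>x. \<beta> x \<ge> 0" "\<And>x. norm x \<ge> \<kappa> \<Longrightarrow> \<beta> x = 0" "integral\<^sup>L lborel \<beta> = 1"
    by (rule bump_function_exists[OF assms]) blast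
  obtain \<Theta> where "\<And>r. (\<Theta> has_real_derivative \<beta> r) (at r)" "smooth_fun \<Theta>"
    "\<And>r. r \<le> - \<kappa> \<Longrightarrow> \<Theta> r = 0" "\<And>r. r \<ge> \<kappa> \<Longrightarrow> \<Theta> r = 1" "\<And>r. 0 \<le> \<Theta> r" "\<And>r. \<Theta> r \<le> 1"
    by (rule smooth_step_exists[OF b(1,2) _ b(4) assms]) (use b(3) in auto)
  with b show ?thesis unfolding mollifier_step_def by (intro exI[of _ \<beta>] exI[of _ \<Theta>]) simp
qed

lemma
  fixes F :: "'a::euclidean_space \<times> 'b::euclidean_space \<Rightarrow> real"
  assumes F: "integrable lborel F"
  shows integrable_lborel_fst: "integrable lborel (\<lambda>x. LBINT t. F (x, t))"
    and integral_lborel_fst: "(LBINT x. LBINT t. F (x, t)) = integral\<^sup>L lborel F"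
    and integrable_lborel_snd: "integrable lborel (\<lambda>t. LBINT x. F (x, t))"
    and integral_lborel_snd: "(LBINT t. LBINT x. F (x, t)) = integral\<^sup>L lborel F"
proof -
  have "integrable (lborel \<Otimes>\<^sub>M lborel) (\<lambda>(x, t). F (x, t))" using F by (simp add: lborel_prod)
  from lborel_pair.integrable_fst[OF this] lborel_pair.integral_fst[OF this]
    lborel_pair.integrable_snd[OF this] lborel_pair.integral_snd[OF this]
  show "integrable lborel (\<lambda>x. LBINT t. F (x, t))" "(LBINT x. LBINT t. F (x, t)) = integral\<^sup>L lborel F"
    "integrable lborel (\<lambda>t. LBINT x. F (x, t))" "(LBINT t. LBINT x. F (x, t)) = integral\<^sup>L lborel F"
    by (simp_all add: lborel_prod)
qed

lemma
  fixes f :: "'a::euclidean_space \<Rightarrow> real" and g :: "'b::euclidean_space \<Rightarrow> real"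
  assumes f: "integrable lborel f" and g: "integrable lborel g"
  shows integrable_lborel_mult: "integrable lborel (\<lambda>p. f (fst p) * g (snd p))"
    and integral_lborel_mult: "(LBINT p. f (fst p) * g (snd p)) = integral\<^sup>L lborel f * integral\<^sup>L lborel g"
proof -
  have [measurable]: "f \<in> borel_measurable borel" "g \<in> borel_measurable borel" using f g by auto
  have "integrable (lborel \<Otimes>\<^sub>M lborel) (\<lambda>p. f (fst p) * g (snd p))"
    by (rule lborel_pair.Fubini_integrable) (use f g in \<open>auto simp: abs_mult\<close>)
  then show i: "integrable lborel (\<lambda>p. f (fst p) * g (snd p))" by (simp add: lborel_prod)
  show "(LBINT p. f (fst p) * g (snd p)) = integral\<^sup>L lborel f * integral\<^sup>L lborel g"
    using integral_lborel_fst[OF i] by simp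
qed

text \<open>The linear problem for \<open>U = u - v\<close> and \<open>W = phi(u) - phi(v)\<close>,
  with Borel representatives extended by zero; \<open>phi\<close>, \<open>g\<close> and
  \<open>u0\<close> have disappeared. \<open>W_finite\<close> carries the decay of \<open>W\<close>,
  which need not be integrable. Only product test functions occur, because the equation is used for
  convolutions alone.\<close>

locale evolution =
  fixes Sg :: "real^'p::finite^'n::finite" and mu :: "(real^'n) measure" and T C :: real
    and U W :: "'n pt \<Rightarrow> real"
  assumes T: "T > 0" and mu: "levy_measure mu"
    and U_int: "integrable lborel U" and W_borel [measurable]: "W \<in> borel_measurable borel"
    and W_bound: "\<And>p. \<bar>W p\<bar> \<le> C"
    and U_zero: "\<And>p. p \<notin> QT T \<Longrightarrow> U p = 0" and W_zero: "\<And>p. p \<notin> QT T \<Longrightarrow> W p = 0"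
    and W_finite: "\<And>\<delta>. \<delta> > 0 \<Longrightarrow> emeasure lborel {p. \<bar>W p\<bar> > \<delta>} < \<infinity>"
    and weak: "\<And>\<rho> \<theta> y. test_fun UNIV \<rho> \<Longrightarrow> test_fun {0<..<T} \<theta> \<Longrightarrow>
      (LBINT p. U p * (\<rho> (y - fst p) * dirderiv \<theta> 1 (snd p)) +
            W p * (levy_op Sg mu \<rho> (y - fst p) * \<theta> (snd p))) = 0"
    and init: "\<And>\<rho> \<theta> y. test_fun UNIV \<rho> \<Longrightarrow> test_fun {..<T} \<theta> \<Longrightarrow>
      ess_lim_0 (\<lambda>t. LBINT x. U (x, t) * (\<rho> (y - x) * \<theta> t)) 0"
begin

lemma U_borel [measurable]: "U \<in> borel_measurable borel"
  using U_int by simp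

lemma W_bounded_borel: "bounded_borel W"
  using W_borel W_bound by (rule bounded_borelI)

lemma C_nonneg: "0 \<le> C"
  using W_bound[of undefined] by linarith

text \<open>Since \<open>W\<close> vanishes outside \<open>QT T\<close>, an indicator of
  \<open>{0<..<T}\<close> may be inserted; it supplies the integrability in time that the bounded
  factor \<open>b\<close> does not give.\<close>

lemma integrable_W:
  assumes r: "integrable lborel r" and b: "bounded_borel b"
  shows "integrable lborel (\<lambda>p. W p * (r (y - fst p) * b (snd p)))"
proof -
  have [measurable]: "r \<in> borel_measurable borel" "b \<in> borel_measurable borel" using r b by auto
  have "integrable lborel (\<lambda>x. r (y - x))" using r by (simp add: integrable_reflect)
  moreover have "integrable lborel (indicator {0<..<T} :: real \<Rightarrow> real)"
    using T by (simp add: integrable_indicator_iff)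
  ultimately have i: "integrable lborel (\<lambda>p. r (y - fst p) * indicator {0<..<T} (snd p))"
    by (rule integrable_lborel_mult)
  obtain B where B: "B \<ge> 0" "\<And>x. \<bar>b x\<bar> \<le> B" using b by (auto elim: bounded_borelE)
  have "bounded_borel (\<lambda>p. W p * b (snd p))"
    by (rule bounded_borelI[where C="C * B"]) (use B W_bound C_nonneg in \<open>auto simp: abs_mult intro!: mult_mono\<close>)
  from integrable_mult_bounded(1)[OF i this]
  have "integrable lborel (\<lambda>p. r (y - fst p) * indicator {0<..<T} (snd p) * (W p * b (snd p)))" .
  moreover have "r (y - fst p) * indicator {0<..<T} (snd p) * (W p * b (snd p)) = W p * (r (y - fst p) * b (snd p))" for p
    using W_zero[of p] by (cases p) (auto simp: QT_def indicator_def)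
  ultimately show ?thesis by simp
qed

lemma integrable_U:
  assumes r: "bounded_borel r" and b: "bounded_borel b"
  shows "integrable lborel (\<lambda>p. U p * (r (y - fst p) * b (snd p)))"
proof (rule integrable_mult_bounded(1)[OF U_int])
  have [measurable]: "r \<in> borel_measurable borel" "b \<in> borel_measurable borel" using r b by auto
  obtain B where B: "B \<ge> 0" "\<And>x. \<bar>b x\<bar> \<le> B" using b by (auto elim: bounded_borelE)
  obtain R where R: "R \<ge> 0" "\<And>x. \<bar>r x\<bar> \<le> R" using r by (auto elim: bounded_borelE)
  show "bounded_borel (\<lambda>p. r (y - fst p) * b (snd p))"
    by (rule bounded_borelI[where C="R * B"]) (use B R in \<open>auto simp: abs_mult intro!: mult_mono\<close>)
qed

end

locale mollified = evolution Sg mu T C U W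
  for Sg :: "real^'p::finite^'n::finite" and mu :: "(real^'n) measure" and T C :: real
    and U W :: "'n pt \<Rightarrow> real" +
  fixes \<kappa> :: real and \<rho> :: "real^'n \<Rightarrow> real" and \<beta> \<Theta> :: "real \<Rightarrow> real"
  assumes \<kappa>: "\<kappa> > 0" and \<rho>_test: "test_fun UNIV \<rho>"
    and \<beta>\<Theta>: "mollifier_step \<kappa> \<beta> \<Theta>"
begin

definition kern :: "'n pt \<Rightarrow> real" where "kern p = \<rho> (fst p) * \<beta> (snd p)"
text \<open>\<open>\<Theta> (\<tau> - t)\<close> is a smoothed indicator of
  \<open>t < \<tau>\<close>, so this is a mollified time integral of \<open>W\<close> up to
  \<open>\<tau>\<close>; \<open>V\<close> mollifies it in space as well.\<close>

definition w :: "real \<Rightarrow> real^'n \<Rightarrow> real" where "w \<tau> x = (LBINT t. W (x, t) * \<Theta> (\<tau> - t))"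
definition V :: "real \<Rightarrow> real^'n \<Rightarrow> real" where "V \<tau> = conv (w \<tau>) \<rho>"

lemma \<beta>: "test_fun UNIV \<beta>" "0 \<le> \<beta> x" "\<kappa> \<le> \<bar>x\<bar> \<Longrightarrow> \<beta> x = 0" "integral\<^sup>L lborel \<beta> = 1"
  and \<Theta>: "(\<Theta> has_real_derivative \<beta> r) (at r)" "smooth_fun \<Theta>" "r \<le> - \<kappa> \<Longrightarrow> \<Theta> r = 0" "\<kappa> \<le> r \<Longrightarrow> \<Theta> r = 1"
    "0 \<le> \<Theta> r" "\<Theta> r \<le> 1"
  using \<beta>\<Theta> by (auto simp: mollifier_step_def)

lemma borel [measurable]: "\<rho> \<in> borel_measurable borel" "\<beta> \<in> borel_measurable borel" "\<Theta> \<in> borel_measurable borel"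
  using smooth_fun_borel test_fun_smooth \<rho>_test \<beta>(1) \<Theta>(2) by blast+

lemma bounded_borel_test: "test_fun UNIV f \<Longrightarrow> bounded_borel f"
  for f :: "'a::euclidean_space \<Rightarrow> real"
  using smooth_fun_borel[OF test_fun_smooth[of UNIV f]] test_fun_bounded[of UNIV f]
  unfolding bounded_borel_def by metis

lemma \<rho>_int: "integrable lborel \<rho>" and \<beta>_int: "integrable lborel \<beta>"
  by (rule test_fun_integrable[OF \<rho>_test], rule test_fun_integrable[OF \<beta>(1)])

lemma \<rho>_bb: "bounded_borel \<rho>" and \<beta>_bb: "bounded_borel \<beta>"
  by (rule bounded_borel_test[OF \<rho>_test], rule bounded_borel_test[OF \<beta>(1)])

lemma kern_int: "integrable lborel kern"
  unfolding kern_def[abs_def] by (rule integrable_lborel_mult[OF \<rho>_int \<beta>_int])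

lemma conv_kern: "conv f kern (y, \<tau>) = (LBINT p. f p * (\<rho> (y - fst p) * \<beta> (\<tau> - snd p)))"
  by (simp add: conv_def kern_def minus_prod_def)

lemma w_borel [measurable]: "w \<tau> \<in> borel_measurable borel"
  unfolding w_def[abs_def] by measurable

lemma \<Theta>_bb: "bounded_borel (\<lambda>t. \<Theta> (\<tau> - t))"
  by (rule bounded_borelI[where C=1]) (use \<Theta>(5,6) in \<open>auto simp: abs_le_iff order_trans[OF _ \<Theta>(5)]\<close>)

lemma slice_bound:
  fixes f :: "'n pt \<Rightarrow> real"
  assumes f: "\<And>p. \<bar>f p\<bar> \<le> D" "\<And>p. p \<notin> QT T \<Longrightarrow> f p = 0"
  shows "\<bar>LBINT t. f (x, t) * \<Theta> (\<tau> - t)\<bar> \<le> D * T"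
proof (cases "integrable lborel (\<lambda>t. f (x, t) * \<Theta> (\<tau> - t))")
  case True
  have D: "D \<ge> 0" using f(1)[of undefined] by linarith
  have i: "integrable lborel (\<lambda>t. D * indicator {0<..<T} t :: real)"
    using T by (intro integrable_mult_right) (simp add: integrable_indicator_iff)
  have "\<bar>LBINT t. f (x, t) * \<Theta> (\<tau> - t)\<bar> \<le> (LBINT t. D * indicator {0<..<T} t)"
  proof (rule order_trans[OF integral_abs_bound], rule integral_mono)
    show "\<bar>f (x, t) * \<Theta> (\<tau> - t)\<bar> \<le> D * indicator {0<..<T} t" for t
    proof (cases "t \<in> {0<..<T}")
      case True
      then show ?thesis using mult_mono[OF f(1)[of "(x, t)"] \<Theta>(6)[of "\<tau> - t"]] D \<Theta>(5) by (simp add: abs_mult)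
    qed (use f(2)[of "(x, t)"] in \<open>simp add: QT_def\<close>)
  qed (use True i in auto)
  also have "\<dots> = D * T" using T by simp
  finally show ?thesis .
qed (use f(1)[of undefined] T in \<open>simp add: not_integrable_integral_eq order_trans[OF abs_ge_zero]\<close>)

lemma w_bound: "\<bar>w \<tau> x\<bar> \<le> C * T"
  unfolding w_def by (rule slice_bound[OF W_bound W_zero])

lemma w_bb: "bounded_borel (w \<tau>)"
  by (rule bounded_borelI[OF w_borel w_bound])

lemma V_bb: "bounded_borel (V \<tau>)"
  unfolding V_def by (rule bounded_borel_conv[OF w_bb \<rho>_int])

lemma conv_w:
  assumes "integrable lborel r"
  shows "conv (w \<tau>) r y = (LBINT p. W p * (r (y - fst p) * \<Theta> (\<tau> - snd p)))"
proof -
  have "conv (w \<tau>) r y = (LBINT x. LBINT t. W (x, t) * (r (y - x) * \<Theta> (\<tau> - t)))"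
    unfolding conv_def w_def
    by (rule Bochner_Integration.integral_cong[OF refl], subst Bochner_Integration.integral_mult_left_zero[symmetric]) (simp add: mult_ac)
  also have "\<dots> = (LBINT p. W p * (r (y - fst p) * \<Theta> (\<tau> - snd p)))"
    using integral_lborel_fst[OF integrable_W[OF assms \<Theta>_bb]] by simp
  finally show ?thesis .
qed

text \<open>Split \<open>W\<close> at height \<open>\<epsilon>\<close>. The large part is bounded
  and lives on a set of finite measure, hence is integrable, and integration in time and convolution
  keep it so. The small part contributes at most \<open>\<epsilon> * T\<close> times the
  \<open>L1\<close> norm of \<open>\<rho>\<close>, which dictates
  \<open>\<epsilon> = \<delta> / (T * I)\<close>.\<close>

lemma vanishing_V: "vanishing (V \<tau>)"
  unfolding vanishing_def
proof (intro allI impI)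
  fix \<delta> :: real assume "\<delta> > 0"
  \<comment> \<open>The summand \<open>1\<close> keeps the divisor positive even when
    \<open>\<rho>\<close> is zero.\<close>
  define I where "I = 1 + (LBINT x. \<bar>\<rho> x\<bar>)"
  have I: "I > 0" "(LBINT x. \<bar>\<rho> x\<bar>) \<le> I" unfolding I_def by (auto intro: add_pos_nonneg)
  define \<epsilon> where "\<epsilon> = \<delta> / (T * I)"
  have \<epsilon>: "\<epsilon> > 0" using \<open>\<delta> > 0\<close> T I by (simp add: \<epsilon>_def)
  define W1 where "W1 p = W p * indicator {p. \<bar>W p\<bar> > \<epsilon>} p" for p
  define W2 where "W2 p = W p * indicator {p. \<bar>W p\<bar> \<le> \<epsilon>} p" for p
  have [measurable]: "W1 \<in> borel_measurable borel" "W2 \<in> borel_measurable borel"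
    unfolding W1_def[abs_def] W2_def[abs_def] by measurable
  have "integrable lborel (indicator {p. \<bar>W p\<bar> > \<epsilon>} :: _ \<Rightarrow> real)"
    using W_finite[OF \<epsilon>] by (simp add: integrable_indicator_iff)
  then have W1i: "integrable lborel W1"
    unfolding W1_def[abs_def] by (rule integrable_mult_bounded(2)[OF _ W_bounded_borel])
  have W1b: "\<bar>W1 p\<bar> \<le> C" "p \<notin> QT T \<Longrightarrow> W1 p = 0" for p
    using W_bound[of p] C_nonneg W_zero[of p] by (auto simp: W1_def indicator_def)
  have W2b: "\<bar>W2 p\<bar> \<le> \<epsilon>" "p \<notin> QT T \<Longrightarrow> W2 p = 0" for p
    using \<epsilon> W_zero[of p] by (auto simp: W2_def indicator_def)
  define a where "a x = (LBINT t. W1 (x, t) * \<Theta> (\<tau> - t))" for x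
  define r where "r x = (LBINT t. W2 (x, t) * \<Theta> (\<tau> - t))" for x
  have [measurable]: "a \<in> borel_measurable borel" "r \<in> borel_measurable borel"
    unfolding a_def[abs_def] r_def[abs_def] by measurable
  have ab: "bounded_borel a" by (rule bounded_borelI[where C="C * T"]) (auto simp: a_def intro!: slice_bound W1b)
  have rb: "\<bar>r x\<bar> \<le> \<epsilon> * T" for x unfolding r_def by (rule slice_bound[OF W2b])
  then have rbb: "bounded_borel r" by (intro bounded_borelI) auto
  have "integrable lborel (\<lambda>p. W1 p * \<Theta> (\<tau> - snd p))"
    by (rule integrable_mult_bounded(1)[OF W1i]) (use \<Theta>_bb[of \<tau>] in \<open>auto simp: bounded_borel_def\<close>)
  from integrable_lborel_fst[OF this] have ai: "integrable lborel a" by (simp add: a_def[abs_def])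
  have wi: "integrable lborel (\<lambda>t. f (x, t) * \<Theta> (\<tau> - t))"
    if "\<And>p. \<bar>f p\<bar> \<le> D" "\<And>p. p \<notin> QT T \<Longrightarrow> f p = 0" "f \<in> borel_measurable borel" for f :: "'n pt \<Rightarrow> real" and D x
  proof (rule Bochner_Integration.integrable_bound)
    note [measurable] = that(3)
    show "integrable lborel (\<lambda>t. D * indicator {0<..<T} t :: real)"
      using T by (intro integrable_mult_right) (simp add: integrable_indicator_iff)
    have D: "D \<ge> 0" using that(1)[of undefined] by linarith
    have "\<bar>f (x, t) * \<Theta> (\<tau> - t)\<bar> \<le> D * indicator {0<..<T} t" for t
    proof (cases "t \<in> {0<..<T}")
      case True
      then show ?thesis using mult_mono[OF that(1)[of "(x, t)"] \<Theta>(6)[of "\<tau> - t"]] D \<Theta>(5) by (simp add: abs_mult)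
    qed (use that(2)[of "(x, t)"] in \<open>simp add: QT_def\<close>)
    then show "AE t in lborel. norm (f (x, t) * \<Theta> (\<tau> - t)) \<le> norm (D * indicator {0<..<T} t :: real)"
      using D by (intro AE_I2) (simp add: order_trans[OF _ abs_ge_self])
    show "(\<lambda>t. f (x, t) * \<Theta> (\<tau> - t)) \<in> borel_measurable lborel" by measurable
  qed
  have split: "w \<tau> x = a x + r x" for x
  proof -
    have "w \<tau> x = (LBINT t. W1 (x, t) * \<Theta> (\<tau> - t) + W2 (x, t) * \<Theta> (\<tau> - t))"
      unfolding w_def by (rule Bochner_Integration.integral_cong) (auto simp: W1_def W2_def indicator_def)
    also have "\<dots> = a x + r x"
      unfolding a_def r_def by (rule Bochner_Integration.integral_add[OF wi[OF W1b] wi[OF W2b]]) measurable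
    finally show ?thesis .
  qed
  show "\<exists>a r. bounded_borel a \<and> integrable lborel a \<and> bounded_borel r \<and> (\<forall>x. V \<tau> x = a x + r x \<and> \<bar>r x\<bar> \<le> \<delta>)"
  proof (intro exI conjI allI)
    show "bounded_borel (conv a \<rho>)" by (rule bounded_borel_conv[OF ab \<rho>_int])
    show "integrable lborel (conv a \<rho>)" by (rule integrable_conv[OF ai \<rho>_int])
    show "bounded_borel (conv r \<rho>)" by (rule bounded_borel_conv[OF rbb \<rho>_int])
    fix y
    have "integrable lborel (\<lambda>x. \<rho> (y - x))" using \<rho>_int by (simp add: integrable_reflect)
    then have "integrable lborel (\<lambda>x. a x * \<rho> (y - x))" "integrable lborel (\<lambda>x. r x * \<rho> (y - x))"
      using ab rbb by (auto intro: integrable_mult_bounded(2))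
    then show "V \<tau> y = conv a \<rho> y + conv r \<rho> y"
      by (simp add: V_def conv_def split distrib_right)
    have "\<bar>conv r \<rho> y\<bar> \<le> (\<epsilon> * T) * (LBINT x. \<bar>\<rho> x\<bar>)" by (rule conv_bound[OF rbb rb \<rho>_int])
    also have "\<dots> \<le> (\<epsilon> * T) * I" using \<epsilon> T I by (intro mult_left_mono) auto
    also have "\<dots> = \<delta>" using T I by (simp add: \<epsilon>_def)
    finally show "\<bar>conv r \<rho> y\<bar> \<le> \<delta>" .
  qed
qed

end

section \<open>The mollified equation integrated in time\<close>

context mollified
begin

lemma \<Theta>_shift_smooth: "smooth_fun (\<lambda>t. \<Theta> (\<tau> - t))"
  using smooth_fun_affine_comp[OF \<Theta>(2), of uminus \<tau>] bounded_linear_minus[OF bounded_linear_ident] by simp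

text \<open>The shift by \<open>2 h\<close> makes the step rise inside \<open>(h, 3 h)\<close>, so the test function is supported in
  \<open>t > 0\<close> and the initial trace is recovered as \<open>h\<close> tends to \<open>0\<close>.\<close>

lemma conv_kern_tested:
  assumes \<tau>: "\<tau> + \<kappa> < T" and S: "mollifier_step h b S" and h: "h > 0"
  shows "(LBINT p. U p * (\<rho> (y - fst p) * (\<Theta> (\<tau> - snd p) * b (snd p - 2 * h))))
      - (LBINT p. U p * (\<rho> (y - fst p) * (\<beta> (\<tau> - snd p) * S (snd p - 2 * h))))
      + (LBINT p. W p * (levy_op Sg mu \<rho> (y - fst p) * (\<Theta> (\<tau> - snd p) * S (snd p - 2 * h)))) = 0"
proof -
  have S': "test_fun UNIV b" "\<And>r. (S has_real_derivative b r) (at r)" "smooth_fun S" "\<And>r. r \<le> - h \<Longrightarrow> S r = 0" "\<And>r. 0 \<le> S r" "\<And>r. S r \<le> 1"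
    using S by (auto simp: mollifier_step_def)
  have [measurable]: "b \<in> borel_measurable borel" "S \<in> borel_measurable borel"
    using smooth_fun_borel S'(3) test_fun_smooth[OF S'(1)] by blast+
  define \<theta> where "\<theta> t = \<Theta> (\<tau> - t) * S (t - 2 * h)" for t
  have sS: "smooth_fun (\<lambda>t. S (t - 2 * h))"
    using smooth_fun_affine_comp[OF S'(3) bounded_linear_ident, of "- 2 * h"] by simp
  have "test_fun {0<..<T} \<theta>"
  proof (rule test_funI[where K="{h..\<tau> + \<kappa>}"])
    show "smooth_fun \<theta>" unfolding \<theta>_def[abs_def] by (rule smooth_fun_mult[OF \<Theta>_shift_smooth sS])
    show "t \<in> {h..\<tau> + \<kappa>}" if "\<theta> t \<noteq> 0" for t
      using that \<Theta>(3)[of "\<tau> - t"] S'(4)[of "t - 2 * h"] by (force simp: \<theta>_def)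
    show "{h..\<tau> + \<kappa>} \<subseteq> {0<..<T}" using h \<tau> by auto
  qed simp
  note wk = weak[OF \<rho>_test this, of y]
  \<comment> \<open>The first term sits near \<open>t = 0\<close> and becomes the initial trace; the
    second sits near \<open>t = \<tau>\<close> and becomes the convolution with
    \<open>kern\<close>.\<close>
  have d: "dirderiv \<theta> 1 t = \<Theta> (\<tau> - t) * b (t - 2 * h) - \<beta> (\<tau> - t) * S (t - 2 * h)" for t
  proof -
    have "(\<theta> has_real_derivative (\<Theta> (\<tau> - t) * b (t - 2 * h) - \<beta> (\<tau> - t) * S (t - 2 * h))) (at t)"
      unfolding \<theta>_def[abs_def]
      by (auto intro!: derivative_eq_intros DERIV_chain2[OF \<Theta>(1)] DERIV_chain2[OF S'(2)])
    from dirderiv_real[OF this] show ?thesis by simp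
  qed
  have bS: "bounded_borel (\<lambda>t. S (t - 2 * h))"
    by (rule bounded_borelI[where C=1]) (use S'(5,6) in \<open>auto simp: abs_le_iff order_trans[OF _ S'(5)]\<close>)
  have bb: "bounded_borel (\<lambda>t. b (t - 2 * h))" "bounded_borel (\<lambda>t. \<beta> (\<tau> - t))"
    using bounded_borel_test[OF S'(1)] \<beta>_bb by (auto simp: bounded_borel_def)
  have li: "integrable lborel (levy_op Sg mu \<rho>)" by (rule integrable_levy_op[OF mu \<rho>_test])
  note i1 = integrable_U[OF \<rho>_bb bounded_borel_mult[OF \<Theta>_bb bb(1)], of y \<tau>]
  note i2 = integrable_U[OF \<rho>_bb bounded_borel_mult[OF bb(2) bS], of y]
  note i3 = integrable_W[OF li bounded_borel_mult[OF \<Theta>_bb bS], of y \<tau>]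
  show ?thesis
    using wk unfolding d \<theta>_def
    by (simp add: right_diff_distrib Bochner_Integration.integral_add[OF Bochner_Integration.integrable_diff[OF i1 i2] i3]
        Bochner_Integration.integral_diff[OF i1 i2])
qed

text \<open>\<open>b j (t - 2 * h j)\<close> is a unit mass on the interval from \<open>h j\<close>
  to \<open>3 * h j\<close>, so the expression averages spatial integrals over small times, and
  these are small for almost every such time by the essential limit.\<close>

lemma initial_trace_vanishes:
  assumes \<tau>: "\<tau> + \<kappa> < T"
    and S: "\<And>j. mollifier_step (h j) (b j) (S j)" and h: "\<And>j. h j > 0" and h0: "h \<longlonglongrightarrow> 0"
  shows "(\<lambda>j. LBINT p. U p * (\<rho> (y - fst p) * (\<Theta> (\<tau> - snd p) * b j (snd p - 2 * h j)))) \<longlonglongrightarrow> 0"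
proof (rule LIMSEQ_I)
  fix e :: real assume e: "e > 0"
  have b: "test_fun UNIV (b j)" "0 \<le> b j x" "h j \<le> \<bar>x\<bar> \<Longrightarrow> b j x = 0" "integral\<^sup>L lborel (b j) = 1" for j x
    using S by (auto simp: mollifier_step_def)
  have [measurable]: "b j \<in> borel_measurable borel" for j
    by (rule smooth_fun_borel[OF test_fun_smooth[OF b(1)]])
  \<comment> \<open>The initial condition is tested with one fixed time factor of compact support.
    \<open>\<Theta> (t + \<kappa>)\<close> equals \<open>1\<close> for \<open>t >= 0\<close> and
    vanishes for \<open>t <= -2 * \<kappa>\<close>, so it secures compactness without altering
    \<open>\<Theta> (\<tau> - t)\<close> at positive times.\<close>
  define \<theta> where "\<theta> t = \<Theta> (\<tau> - t) * \<Theta> (t + \<kappa>)" for t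
  have "test_fun {..<T} \<theta>"
  proof (rule test_funI[where K="{- 2 * \<kappa>..\<tau> + \<kappa>}"])
    have "smooth_fun (\<lambda>t. \<Theta> (t + \<kappa>))"
      using smooth_fun_affine_comp[OF \<Theta>(2) bounded_linear_ident, of \<kappa>] by simp
    then show "smooth_fun \<theta>" unfolding \<theta>_def[abs_def] by (rule smooth_fun_mult[OF \<Theta>_shift_smooth])
    show "t \<in> {- 2 * \<kappa>..\<tau> + \<kappa>}" if "\<theta> t \<noteq> 0" for t
      using that \<Theta>(3)[of "\<tau> - t"] \<Theta>(3)[of "t + \<kappa>"] by (force simp: \<theta>_def)
    show "{- 2 * \<kappa>..\<tau> + \<kappa>} \<subseteq> {..<T}" using \<tau> by auto
  qed simp
  note ini = init[OF \<rho>_test this, of y]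
  define F where "F t = (LBINT x. U (x, t) * (\<rho> (y - x) * \<theta> t))" for t
  have "e / 2 > 0" using e by simp
  then obtain d where d: "d > 0" "AE t in lborel. 0 < t \<and> t < d \<longrightarrow> \<bar>F t\<bar> < e / 2"
    using ini[unfolded ess_lim_0_def, rule_format, OF \<open>e / 2 > 0\<close>] by (auto simp: F_def)
  have h3: "(\<lambda>j. 3 * h j) \<longlonglongrightarrow> 3 * 0" by (intro tendsto_mult tendsto_const h0)
  obtain N where N: "\<And>j. j \<ge> N \<Longrightarrow> 3 * h j < d"
    using order_tendstoD(2)[OF h3, of d] d(1) by (auto simp: eventually_sequentially)
  have "norm ((LBINT p. U p * (\<rho> (y - fst p) * (\<Theta> (\<tau> - snd p) * b j (snd p - 2 * h j)))) - 0) < e"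
    if j: "j \<ge> N" for j
  proof -
    have bb: "bounded_borel (\<lambda>t. \<Theta> (\<tau> - t) * b j (t - 2 * h j))"
      by (intro bounded_borel_mult[OF \<Theta>_bb] bounded_borel_comp[OF bounded_borel_test[OF b(1)]]) measurable
    note i = integrable_U[OF \<rho>_bb bb, of y]
    have bi: "integrable lborel (\<lambda>t. b j (t - 2 * h j))" "(LBINT t. b j (t - 2 * h j)) = 1"
      using test_fun_integrable[OF b(1)[of j]] b(4)[of j] integrable_shift[of "b j" "- 2 * h j"] integral_shift[of "b j" "- 2 * h j"]
      by simp_all
    define G where "G t = (LBINT x. U (x, t) * (\<rho> (y - x) * (\<Theta> (\<tau> - t) * b j (t - 2 * h j))))" for t
    have Gi: "integrable lborel G" and Geq: "(LBINT p. U p * (\<rho> (y - fst p) * (\<Theta> (\<tau> - snd p) * b j (snd p - 2 * h j)))) = (LBINT t. G t)"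
      using integrable_lborel_snd[OF i] integral_lborel_snd[OF i] by (simp_all add: G_def[abs_def])
    have "\<bar>LBINT t. G t\<bar> \<le> (LBINT t. b j (t - 2 * h j) * (e / 2))"
    proof (rule order_trans[OF integral_abs_bound], rule integral_mono_AE)
      show "AE t in lborel. \<bar>G t\<bar> \<le> b j (t - 2 * h j) * (e / 2)"
        using d(2)
      proof eventually_elim
        case (elim t)
        show ?case
        proof (cases "\<bar>t - 2 * h j\<bar> < h j")
          case True
          then have t: "t > 0" "t < d" using h[of j] N[OF j] by linarith+
          then have "\<theta> t = \<Theta> (\<tau> - t)" using \<Theta>(4)[of "t + \<kappa>"] by (simp add: \<theta>_def)
          then have "G t = (LBINT x. b j (t - 2 * h j) * (U (x, t) * (\<rho> (y - x) * \<theta> t)))"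
            by (simp add: G_def mult_ac)
          also have "\<dots> = b j (t - 2 * h j) * F t" unfolding F_def by simp
          finally have "\<bar>G t\<bar> = b j (t - 2 * h j) * \<bar>F t\<bar>" using b(2) by (simp add: abs_mult)
          also have "\<dots> \<le> b j (t - 2 * h j) * (e / 2)"
            using elim t by (intro mult_left_mono b(2)) simp
          finally show ?thesis .
        next
          case False
          then have "b j (t - 2 * h j) = 0" by (intro b(3)) simp
          then show ?thesis by (simp add: G_def)
        qed
      qed
    qed (use Gi bi in auto)
    also have "\<dots> < e" using bi e by simp
    finally show ?thesis unfolding Geq by simp
  qed
  then show "\<exists>N. \<forall>j\<ge>N. norm ((LBINT p. U p * (\<rho> (y - fst p) * (\<Theta> (\<tau> - snd p) * b j (snd p - 2 * h j)))) - 0) < e"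
    by blast
qed

text \<open>Let the cut-off \<open>S j\<close> tend to \<open>1\<close> on \<open>t > 0\<close>: the
  initial term disappears and the derivative of \<open>\<Theta> (\<tau> - t)\<close> leaves
  \<open>\<beta>\<close>. The outcome is the mollified \<open>U = L V\<close>, with the operator
  resting on the kernel \<open>\<rho>\<close>. The kernel reaches up to time
  \<open>\<tau> + \<kappa>\<close>, which must stay below \<open>T\<close> for the test function to
  be admissible.\<close>

lemma conv_kern_eq:
  assumes \<tau>: "\<tau> + \<kappa> < T"
  shows "conv U kern (y, \<tau>) = conv (w \<tau>) (levy_op Sg mu \<rho>) y"
proof -
  define h where "h j = 1 / real (Suc j)" for j
  have h: "h j > 0" for j by (simp add: h_def)
  have h0: "h \<longlonglongrightarrow> 0" unfolding h_def[abs_def] using LIMSEQ_inverse_real_of_nat by (simp add: inverse_eq_divide)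
  have "\<forall>j. \<exists>b S. mollifier_step (h j) b S" using mollifier_step_exists[OF h] by blast
  then obtain b S where S: "\<And>j. mollifier_step (h j) (b j) (S j)" by metis
  have S': "smooth_fun (S j)" "h j \<le> r \<Longrightarrow> S j r = 1" "0 \<le> S j r" "S j r \<le> 1" for j r
    using S[of j] by (auto simp: mollifier_step_def)
  have [measurable]: "S j \<in> borel_measurable borel" for j
    by (rule smooth_fun_borel[OF S'(1)])
  have li: "integrable lborel (levy_op Sg mu \<rho>)" by (rule integrable_levy_op[OF mu \<rho>_test])
  then have [measurable]: "levy_op Sg mu \<rho> \<in> borel_measurable borel" by simp
  have step_lim: "(\<lambda>j. S j (t - 2 * h j)) \<longlonglongrightarrow> 1" if "t > 0" for t
  proof -
    have "(\<lambda>j. 3 * h j) \<longlonglongrightarrow> 3 * 0" by (intro tendsto_mult tendsto_const h0)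
    then have "\<forall>\<^sub>F j in sequentially. 3 * h j < t" using order_tendstoD(2)[of _ 0 sequentially t] that by simp
    then have "\<forall>\<^sub>F j in sequentially. S j (t - 2 * h j) = 1" by (rule eventually_mono) (simp add: S'(2))
    then show ?thesis by (rule tendsto_eventually)
  qed
  have lim: "(\<lambda>j. LBINT p. f p * (r (y - fst p) * (c (snd p) * S j (snd p - 2 * h j)))) \<longlonglongrightarrow>
      (LBINT p. f p * (r (y - fst p) * c (snd p)))"
    if i: "integrable lborel (\<lambda>p. f p * (r (y - fst p) * c (snd p)))" and z: "\<And>p. p \<notin> QT T \<Longrightarrow> f p = 0"
      and m [measurable]: "f \<in> borel_measurable borel" "r \<in> borel_measurable borel" "c \<in> borel_measurable borel"
    for f :: "'n pt \<Rightarrow> real" and r and c :: "real \<Rightarrow> real"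
  proof (rule integral_dominated_convergence[where w="\<lambda>p. \<bar>f p * (r (y - fst p) * c (snd p))\<bar>"])
    show "(\<lambda>p. f p * (r (y - fst p) * c (snd p))) \<in> borel_measurable lborel" by measurable
    show "(\<lambda>p. f p * (r (y - fst p) * (c (snd p) * S j (snd p - 2 * h j)))) \<in> borel_measurable lborel" for j by measurable
    show "AE p in lborel. norm (f p * (r (y - fst p) * (c (snd p) * S j (snd p - 2 * h j)))) \<le> \<bar>f p * (r (y - fst p) * c (snd p))\<bar>" for j
    proof (rule AE_I2)
      fix p :: "'n pt"
      have "\<bar>f p * (r (y - fst p) * c (snd p))\<bar> * S j (snd p - 2 * h j) \<le> \<bar>f p * (r (y - fst p) * c (snd p))\<bar> * 1"
        using S'(4) by (intro mult_left_mono) auto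
      then show "norm (f p * (r (y - fst p) * (c (snd p) * S j (snd p - 2 * h j)))) \<le> \<bar>f p * (r (y - fst p) * c (snd p))\<bar>"
        using S'(3)[of j "snd p - 2 * h j"] by (simp add: abs_mult mult_ac)
    qed
    show "AE p in lborel. (\<lambda>j. f p * (r (y - fst p) * (c (snd p) * S j (snd p - 2 * h j)))) \<longlonglongrightarrow> f p * (r (y - fst p) * c (snd p))"
    proof (rule AE_I2)
      fix p :: "'n pt"
      show "(\<lambda>j. f p * (r (y - fst p) * (c (snd p) * S j (snd p - 2 * h j)))) \<longlonglongrightarrow> f p * (r (y - fst p) * c (snd p))"
      proof (cases "snd p > 0")
        case True
        have "(\<lambda>j. f p * (r (y - fst p) * (c (snd p) * S j (snd p - 2 * h j)))) \<longlonglongrightarrow> f p * (r (y - fst p) * (c (snd p) * 1))"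
          by (intro tendsto_mult tendsto_const step_lim True)
        then show ?thesis by simp
      next
        case False
        then have "f p = 0" by (intro z) (auto simp: QT_def)
        then show ?thesis by simp
      qed
    qed
  qed (use i in auto)
  have b\<tau>: "bounded_borel (\<lambda>t. \<beta> (\<tau> - t))" using \<beta>_bb by (auto simp: bounded_borel_def)
  have L1: "(\<lambda>j. LBINT p. U p * (\<rho> (y - fst p) * (\<beta> (\<tau> - snd p) * S j (snd p - 2 * h j)))) \<longlonglongrightarrow> conv U kern (y, \<tau>)"
    unfolding conv_kern by (rule lim[OF integrable_U[OF \<rho>_bb b\<tau>] U_zero]) measurable
  have L2: "(\<lambda>j. LBINT p. W p * (levy_op Sg mu \<rho> (y - fst p) * (\<Theta> (\<tau> - snd p) * S j (snd p - 2 * h j)))) \<longlonglongrightarrow> conv (w \<tau>) (levy_op Sg mu \<rho>) y"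
    unfolding conv_w[OF li] by (rule lim[OF integrable_W[OF li \<Theta>_bb] W_zero]) measurable
  have "(\<lambda>j. (LBINT p. U p * (\<rho> (y - fst p) * (\<Theta> (\<tau> - snd p) * b j (snd p - 2 * h j))))
      - (LBINT p. U p * (\<rho> (y - fst p) * (\<beta> (\<tau> - snd p) * S j (snd p - 2 * h j))))
      + (LBINT p. W p * (levy_op Sg mu \<rho> (y - fst p) * (\<Theta> (\<tau> - snd p) * S j (snd p - 2 * h j)))))
     \<longlonglongrightarrow> 0 - conv U kern (y, \<tau>) + conv (w \<tau>) (levy_op Sg mu \<rho>) y"
    by (intro tendsto_add tendsto_diff L1 L2 initial_trace_vanishes[OF \<tau> S h h0])
  then have "(\<lambda>j. 0) \<longlonglongrightarrow> 0 - conv U kern (y, \<tau>) + conv (w \<tau>) (levy_op Sg mu \<rho>) y"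
    unfolding conv_kern_tested[OF \<tau> S h] .
  from LIMSEQ_unique[OF this tendsto_const] show ?thesis by simp
qed

end

section \<open>The energy inequality for the mollified evolution\<close>

context mollified
begin

lemma conv_kern_int: "integrable lborel (conv U kern)"
  by (rule integrable_conv[OF U_int kern_int])

lemma conv_kern_borel [measurable]: "conv U kern \<in> borel_measurable borel"
  using conv_kern_int by simp

lemma conv_kern_slice_bb: "bounded_borel (\<lambda>y. conv U kern (y, \<tau>))"
proof -
  obtain R where R: "R \<ge> 0" "\<And>x. \<bar>\<rho> x\<bar> \<le> R" using \<rho>_bb by (auto elim: bounded_borelE)
  obtain B where B: "B \<ge> 0" "\<And>x. \<bar>\<beta> x\<bar> \<le> B" using \<beta>_bb by (auto elim: bounded_borelE)
  have "\<bar>conv U kern (y, \<tau>)\<bar> \<le> R * B * (LBINT p. \<bar>U p\<bar>)" for y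
    unfolding conv_kern
  proof (rule abs_integral_mult_le[OF U_int])
    show bd: "\<bar>\<rho> (y - fst p) * \<beta> (\<tau> - snd p)\<bar> \<le> R * B" for p
      unfolding abs_mult by (intro mult_mono R B) auto
    show "bounded_borel (\<lambda>p. \<rho> (y - fst p) * \<beta> (\<tau> - snd p))"
      by (rule bounded_borelI[OF _ bd]) measurable
  qed
  then show ?thesis by (intro bounded_borelI) auto
qed

lemma conv_kern_slice_int: "integrable lborel (\<lambda>y. conv U kern (y, \<tau>))"
proof -
  define u where "u x = (LBINT t. U (x, t) * \<beta> (\<tau> - t))" for x
  have b: "bounded_borel (\<lambda>t. \<beta> (\<tau> - t))" using \<beta>_bb by (auto simp: bounded_borel_def)
  have "bounded_borel (\<lambda>_::real^'n. 1::real)" by (rule bounded_borelI[where C=1]) auto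
  from integrable_U[OF this b] have "integrable lborel (\<lambda>p. U p * \<beta> (\<tau> - snd p))" by simp
  from integrable_lborel_fst[OF this] have u: "integrable lborel u" by (simp add: u_def[abs_def])
  have "conv U kern (y, \<tau>) = conv u \<rho> y" for y
  proof -
    have "conv U kern (y, \<tau>) = (LBINT x. LBINT t. U (x, t) * (\<rho> (y - x) * \<beta> (\<tau> - t)))"
      using integral_lborel_fst[OF integrable_U[OF \<rho>_bb b, of y]] by (simp add: conv_kern)
    also have "\<dots> = conv u \<rho> y"
      unfolding conv_def u_def
      by (rule Bochner_Integration.integral_cong[OF refl], subst Bochner_Integration.integral_mult_left_zero[symmetric]) (simp add: mult_ac)
    finally show ?thesis .
  qed
  then show ?thesis using integrable_conv[OF u \<rho>_int] by (simp add: fun_eq_iff[symmetric])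
qed

text \<open>\<open>S\<close> commutes with convolution, so the whole error is the convolution of
  \<open>w\<close> with the error \<open>D\<close> made on \<open>\<rho>\<close>; an
  \<open>L1\<close>-small \<open>D\<close> against the bound \<open>C * T\<close> on
  \<open>w\<close> gives a uniform estimate. One \<open>S\<close> serves both times because it is
  chosen for \<open>\<rho>\<close> alone.\<close>

lemma generator_approx:
  assumes \<tau>: "\<And>i::bool. \<tau> i + \<kappa> < T" and e: "e > 0"
  shows "\<exists>S m. sym_op S m \<and> (\<forall>i x. \<bar>conv U kern (x, \<tau> i) - (S (V (\<tau> i)) x - m * V (\<tau> i) x)\<bar> \<le> e)"
proof -
  let ?L = "levy_op Sg mu \<rho>"
  obtain R where R: "\<And>e. e > 0 \<Longrightarrow> \<exists>S m. sym_op S m \<and>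
    (\<forall>x. \<bar>?L x - (S \<rho> x - m * \<rho> x)\<bar> \<le> e * indicator (cball 0 R) x)"
    by (rule levy_op_approx[OF mu \<rho>_test]) blast
  \<comment> \<open>The error comes out as \<open>d * (v - 1)\<close>; the added \<open>1\<close>
    keeps the divisor in \<open>d\<close> positive.\<close>
  define v where "v = C * T * measure lborel (cball (0::real^'n) R) + 1"
  have v: "v > 0" unfolding v_def using C_nonneg T by (intro add_nonneg_pos) auto
  define d where "d = e / v"
  have "d > 0" using e v by (simp add: d_def)
  from R[OF this] obtain S m where S: "sym_op S m"
     "\<And>x. \<bar>?L x - (S \<rho> x - m * \<rho> x)\<bar> \<le> d * indicator (cball 0 R) x" by blast
  define D where "D x = ?L x - (S \<rho> x - m * \<rho> x)" for x
  have ii: "integrable lborel (S \<rho>)" by (rule sym_op.integrable[OF S(1) \<rho>_bb \<rho>_int])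
  have li: "integrable lborel ?L" by (rule integrable_levy_op[OF mu \<rho>_test])
  have Di: "integrable lborel D" unfolding D_def[abs_def] using ii li \<rho>_int by simp
  have "(LBINT x. \<bar>D x\<bar>) \<le> (LBINT x. d * indicator (cball (0::real^'n) R) x)"
  proof (rule integral_mono)
    show "integrable lborel (\<lambda>x. d * indicator (cball (0::real^'n) R) x :: real)"
      using emeasure_bounded_finite[OF bounded_cball, of "0::real^'n" R]
      by (intro integrable_mult_right) (simp add: integrable_indicator_iff)
    show "integrable lborel (\<lambda>x. \<bar>D x\<bar>)" using Di by simp
  qed (use S(2) in \<open>simp add: D_def\<close>)
  also have "\<dots> = d * measure lborel (cball (0::real^'n) R)" by simp
  finally have Dn: "(LBINT x. \<bar>D x\<bar>) \<le> d * measure lborel (cball (0::real^'n) R)" .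
  have "\<bar>conv U kern (x, \<tau> i) - (S (V (\<tau> i)) x - m * V (\<tau> i) x)\<bar> \<le> e" for i x
  proof -
    have c: "integrable lborel (\<lambda>z. w (\<tau> i) z * r (x - z))" if "integrable lborel r" for r
    proof (rule integrable_mult_bounded(2)[OF _ w_bb])
      have "r \<in> borel_measurable borel" using that by simp
      then show "integrable lborel (\<lambda>z. r (x - z))" using that by (simp add: integrable_reflect)
    qed
    have "S (V (\<tau> i)) x = conv (w (\<tau> i)) (S \<rho>) x"
      unfolding V_def by (rule sym_op.conv[OF S(1) w_bb \<rho>_bb \<rho>_int])
    then have "conv U kern (x, \<tau> i) - (S (V (\<tau> i)) x - m * V (\<tau> i) x)
       = conv (w (\<tau> i)) ?L x - (conv (w (\<tau> i)) (S \<rho>) x - m * conv (w (\<tau> i)) \<rho> x)"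
      by (simp add: conv_kern_eq[OF \<tau>] V_def)
    also have "\<dots> = conv (w (\<tau> i)) D x"
      unfolding conv_def D_def using c[OF li] c[OF ii] c[OF \<rho>_int]
      by (simp add: right_diff_distrib mult.left_commute)
    also have "\<bar>\<dots>\<bar> \<le> C * T * (LBINT x. \<bar>D x\<bar>)" by (rule conv_bound[OF w_bb w_bound Di])
    also have "\<dots> \<le> C * T * (d * measure lborel (cball (0::real^'n) R))"
      using Dn C_nonneg T by (intro mult_left_mono) auto
    also have "\<dots> = d * (v - 1)" by (simp add: v_def)
    also have "\<dots> \<le> d * v" using \<open>d > 0\<close> by (intro mult_left_mono) auto
    also have "\<dots> = e" using v by (simp add: d_def)
    finally show ?thesis .
  qed
  with S(1) show ?thesis by blast
qed

text \<open>By \<open>conv_kern_eq\<close> this is formally \<open>\<integral> V L V\<close> at time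
  \<open>\<tau>\<close>, that is, minus a Dirichlet energy. It is defined for all
  \<open>\<tau>\<close>, but that identity and the sign are available only for
  \<open>\<tau> + \<kappa> < T\<close>.\<close>

definition q :: "real \<Rightarrow> real" where "q \<tau> = (LBINT y. conv U kern (y, \<tau>) * V \<tau> y)"

lemma q_nonpos: "\<tau> + \<kappa> < T \<Longrightarrow> q \<tau> \<le> 0"
  unfolding q_def
  by (rule pairing_nonpos[of "\<lambda>_. V \<tau>" "\<lambda>_ y. conv U kern (y, \<tau>)"])
     (intro V_bb vanishing_V conv_kern_slice_bb conv_kern_slice_int generator_approx | assumption)+

lemma q_increment:
  assumes "\<tau> + \<kappa> < T" "h > 0"
  shows "(LBINT y. conv U kern (y, \<tau>) * (V \<tau> y - V (\<tau> - h) y)) \<le> (q \<tau> - q (\<tau> - h)) / 2"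
proof -
  define s where "s i = (if i then \<tau> else \<tau> - h)" for i
  have "s i + \<kappa> < T" for i using assms by (simp add: s_def)
  note ga = generator_approx[OF this]
  from pairing_increment[of "\<lambda>i. V (s i)" "\<lambda>i y. conv U kern (y, s i)", OF V_bb vanishing_V conv_kern_slice_bb conv_kern_slice_int ga]
  show ?thesis by (simp add: s_def q_def)
qed

lemma V_bound: "\<bar>V \<tau> y\<bar> \<le> C * T * (LBINT x. \<bar>\<rho> x\<bar>)"
  unfolding V_def by (rule conv_bound[OF w_bb w_bound \<rho>_int])

lemma V_pair_borel [measurable]: "(\<lambda>p. V (snd p - h) (fst p)) \<in> borel_measurable borel"
  unfolding V_def conv_def w_def by measurable

lemma V_pair_bb: "bounded_borel (\<lambda>p. V (snd p - h) (fst p))"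
  by (rule bounded_borelI[OF V_pair_borel V_bound])

lemma V_eq: "V \<tau> y = (LBINT p. W p * (\<rho> (y - fst p) * \<Theta> (\<tau> - snd p)))"
  unfolding V_def by (rule conv_w[OF \<rho>_int])

lemma V_quotient:
  assumes h: "h > 0"
  shows "(V \<tau> y - V (\<tau> - h) y) / h =
    (LBINT p. W p * (\<rho> (y - fst p) * ((\<Theta> (\<tau> - snd p) - \<Theta> (\<tau> - h - snd p)) / h)))"
proof -
  note i = integrable_W[OF \<rho>_int \<Theta>_bb, of y]
  have "V \<tau> y - V (\<tau> - h) y = (LBINT p. W p * (\<rho> (y - fst p) * \<Theta> (\<tau> - snd p)) - W p * (\<rho> (y - fst p) * \<Theta> (\<tau> - h - snd p)))"
    unfolding V_eq using Bochner_Integration.integral_diff[OF i i] by simp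
  then have "(V \<tau> y - V (\<tau> - h) y) / h = (LBINT p. (W p * (\<rho> (y - fst p) * \<Theta> (\<tau> - snd p)) - W p * (\<rho> (y - fst p) * \<Theta> (\<tau> - h - snd p))) / h)"
    by simp
  then show ?thesis by (simp add: right_diff_distrib diff_divide_distrib)
qed

lemma \<Theta>_lipschitz:
  assumes B: "\<And>x. \<bar>\<beta> x\<bar> \<le> B" and h: "h > 0"
  shows "\<bar>(\<Theta> s - \<Theta> (s - h)) / h\<bar> \<le> B"
proof -
  obtain z where "\<Theta> s - \<Theta> (s - h) = (s - (s - h)) * \<beta> z"
    using MVT2[of "s - h" s \<Theta> \<beta>] h \<Theta>(1) by auto
  then have "(\<Theta> s - \<Theta> (s - h)) / h = \<beta> z" using h by simp
  then show ?thesis using B by simp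
qed

text \<open>The derivative of \<open>\<Theta>\<close> is \<open>\<beta>\<close>, so the time
  derivative of \<open>V\<close> is the mollified \<open>W\<close>. The mean value theorem bounds
  the quotients of \<open>\<Theta>\<close> by the supremum of \<open>|\<beta>|\<close>, which gives
  the majorant.\<close>

lemma V_quotient_tendsto:
  assumes h: "\<And>j. h j > 0" "h \<longlonglongrightarrow> 0"
  shows "(\<lambda>j. (V \<tau> y - V (\<tau> - h j) y) / h j) \<longlonglongrightarrow> conv W kern (y, \<tau>)"
proof -
  obtain B where B: "B \<ge> 0" "\<And>x. \<bar>\<beta> x\<bar> \<le> B" using \<beta>_bb by (auto elim: bounded_borelE)
  have one: "bounded_borel (\<lambda>_::real. B)" by (rule bounded_borelI[where C=B]) (use B in auto)
  have der: "(\<lambda>j. (\<Theta> s - \<Theta> (s - h j)) / h j) \<longlonglongrightarrow> \<beta> s" for s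
  proof -
    have "((\<lambda>x. (\<Theta> (s + x) - \<Theta> s) / x) \<longlongrightarrow> \<beta> s) (at 0)"
      using \<Theta>(1)[of s] by (simp add: DERIV_def)
    moreover have "filterlim (\<lambda>j. - h j) (at 0) sequentially"
      using h by (intro filterlim_atI tendsto_minus_cancel_left[THEN iffD1] always_eventually allI)
        (auto simp: less_imp_neq[symmetric] intro: tendsto_eq_intros)
    ultimately have "(\<lambda>j. (\<Theta> (s + - h j) - \<Theta> s) / - h j) \<longlonglongrightarrow> \<beta> s"
      by (rule filterlim_compose)
    then show ?thesis by (simp add: minus_divide_right[symmetric] minus_divide_left)
  qed
  show ?thesis
    unfolding V_quotient[OF h(1)] conv_kern
  proof (rule integral_dominated_convergence[where w="\<lambda>p. \<bar>W p * (\<rho> (y - fst p) * B)\<bar>"])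
    show "integrable lborel (\<lambda>p. \<bar>W p * (\<rho> (y - fst p) * B)\<bar>)"
      using integrable_W[OF \<rho>_int one, of y] by simp
    show "AE p in lborel. (\<lambda>j. W p * (\<rho> (y - fst p) * ((\<Theta> (\<tau> - snd p) - \<Theta> (\<tau> - h j - snd p)) / h j))) \<longlonglongrightarrow> W p * (\<rho> (y - fst p) * \<beta> (\<tau> - snd p))"
    proof (intro AE_I2 tendsto_mult tendsto_const)
      fix p :: "'n pt"
      have "\<tau> - h j - snd p = \<tau> - snd p - h j" for j by simp
      then show "(\<lambda>j. (\<Theta> (\<tau> - snd p) - \<Theta> (\<tau> - h j - snd p)) / h j) \<longlonglongrightarrow> \<beta> (\<tau> - snd p)"
        using der[of "\<tau> - snd p"] by (simp only:)
    qed
    show "AE p in lborel. norm (W p * (\<rho> (y - fst p) * ((\<Theta> (\<tau> - snd p) - \<Theta> (\<tau> - h j - snd p)) / h j))) \<le> \<bar>W p * (\<rho> (y - fst p) * B)\<bar>" for j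
    proof (rule AE_I2)
      fix p :: "'n pt"
      have "\<bar>(\<Theta> (\<tau> - snd p) - \<Theta> (\<tau> - h j - snd p)) / h j\<bar> \<le> B"
        using \<Theta>_lipschitz[OF B(2) h(1), of "\<tau> - snd p" j] by (simp add: algebra_simps)
      then have "\<bar>W p\<bar> * (\<bar>\<rho> (y - fst p)\<bar> * \<bar>(\<Theta> (\<tau> - snd p) - \<Theta> (\<tau> - h j - snd p)) / h j\<bar>) \<le> \<bar>W p\<bar> * (\<bar>\<rho> (y - fst p)\<bar> * B)"
        by (intro mult_left_mono) auto
      then show "norm (W p * (\<rho> (y - fst p) * ((\<Theta> (\<tau> - snd p) - \<Theta> (\<tau> - h j - snd p)) / h j))) \<le> \<bar>W p * (\<rho> (y - fst p) * B)\<bar>"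
        using B(1) by (simp only: real_norm_def abs_mult abs_of_nonneg)
    qed
  qed measurable
qed

text \<open>Uniformity in \<open>\<tau>\<close>, \<open>y\<close> and \<open>h\<close> provides the
  majorant for the passage to the limit in \<open>energy_inequality\<close>.\<close>

lemma V_quotient_bounded:
  obtains D where "\<And>\<tau> y h. h > 0 \<Longrightarrow> \<bar>(V \<tau> y - V (\<tau> - h) y) / h\<bar> \<le> D"
proof -
  obtain B where B: "B \<ge> 0" "\<And>x. \<bar>\<beta> x\<bar> \<le> B" using \<beta>_bb by (auto elim: bounded_borelE)
  define D where "D = C * (B * (T * (LBINT x. \<bar>\<rho> x\<bar>)))"
  show ?thesis
  proof (rule that[of D])
    fix \<tau> y h assume h: "(h::real) > 0"
    \<comment> \<open>\<open>W\<close> vanishes outside \<open>QT T\<close>, so the indicator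
      changes nothing and makes the time factor integrable with a norm independent of
      \<open>\<tau>\<close> and \<open>h\<close>, up to the constant \<open>B\<close>.\<close>
    define b where "b t = indicator {0<..<T} t * ((\<Theta> (\<tau> - t) - \<Theta> (\<tau> - h - t)) / h)" for t
    have [measurable]: "b \<in> borel_measurable borel" unfolding b_def[abs_def] by measurable
    have "\<bar>(\<Theta> (\<tau> - t) - \<Theta> (\<tau> - h - t)) / h\<bar> \<le> B" for t
      using \<Theta>_lipschitz[OF B(2) h, of "\<tau> - t"] by (simp add: algebra_simps)
    then have bt: "\<bar>b t\<bar> \<le> B * indicator {0<..<T} t" for t by (auto simp: b_def indicator_def abs_mult)
    have ind: "integrable lborel (\<lambda>t. B * indicator {0<..<T} t :: real)"
      using T by (intro integrable_mult_right) (simp add: integrable_indicator_iff)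
    have ri: "integrable lborel (\<lambda>x. \<rho> (y - x))" using \<rho>_int by (simp add: integrable_reflect)
    have bi: "integrable lborel b"
      by (rule Bochner_Integration.integrable_bound[OF ind]) (use bt B in \<open>auto intro!: AE_I2 simp: order_trans[OF _ abs_ge_self]\<close>)
    have i: "integrable lborel (\<lambda>p. \<rho> (y - fst p) * b (snd p))" by (rule integrable_lborel_mult[OF ri bi])
    have "(V \<tau> y - V (\<tau> - h) y) / h = (LBINT p. (\<rho> (y - fst p) * b (snd p)) * W p)"
      unfolding V_quotient[OF h]
    proof (rule Bochner_Integration.integral_cong[OF refl])
      fix p :: "'n pt"
      show "W p * (\<rho> (y - fst p) * ((\<Theta> (\<tau> - snd p) - \<Theta> (\<tau> - h - snd p)) / h)) = \<rho> (y - fst p) * b (snd p) * W p"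
        using W_zero[of p] by (cases p) (auto simp: b_def QT_def indicator_def)
    qed
    also have "\<bar>\<dots>\<bar> \<le> C * (LBINT p. \<bar>\<rho> (y - fst p) * b (snd p)\<bar>)"
      by (rule abs_integral_mult_le[OF i W_bounded_borel W_bound])
    also have "(LBINT p. \<bar>\<rho> (y - fst p) * b (snd p)\<bar>) = (LBINT x. \<bar>\<rho> (y - x)\<bar>) * (LBINT t. \<bar>b t\<bar>)"
      using integral_lborel_mult[of "\<lambda>x. \<bar>\<rho> (y - x)\<bar>" "\<lambda>t. \<bar>b t\<bar>"] ri bi by (simp add: abs_mult)
    also have "(LBINT x. \<bar>\<rho> (y - x)\<bar>) = (LBINT x. \<bar>\<rho> x\<bar>)"
      by (rule integral_reflect[of "\<lambda>x. \<bar>\<rho> x\<bar>"]) measurable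
    finally have 1: "\<bar>(V \<tau> y - V (\<tau> - h) y) / h\<bar> \<le> C * ((LBINT x. \<bar>\<rho> x\<bar>) * (LBINT t. \<bar>b t\<bar>))" .
    have "(LBINT t. \<bar>b t\<bar>) \<le> (LBINT t. B * indicator {0<..<T} t)"
      by (rule integral_mono) (use bi ind bt in auto)
    also have "\<dots> = B * T" using T by simp
    finally have "(LBINT x. \<bar>\<rho> x\<bar>) * (LBINT t. \<bar>b t\<bar>) \<le> (LBINT x. \<bar>\<rho> x\<bar>) * (B * T)"
      by (intro mult_left_mono) auto
    then have "C * ((LBINT x. \<bar>\<rho> x\<bar>) * (LBINT t. \<bar>b t\<bar>)) \<le> C * ((LBINT x. \<bar>\<rho> x\<bar>) * (B * T))"
      by (rule mult_left_mono) (rule C_nonneg)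
    also have "\<dots> = D" by (simp add: D_def)
    finally show "\<bar>(V \<tau> y - V (\<tau> - h) y) / h\<bar> \<le> D" using 1 by linarith
  qed
qed

lemma q_int: "integrable lborel q"
proof -
  have "integrable lborel (\<lambda>p. conv U kern p * V (snd p - 0) (fst p))"
    by (rule integrable_mult_bounded(1)[OF conv_kern_int V_pair_bb])
  from integrable_lborel_snd[OF this] show ?thesis by (simp add: q_def[abs_def])
qed

text \<open>Integrate \<open>q_increment\<close> over all \<open>\<tau> < T - \<kappa>\<close> and
  shift the second term by \<open>h\<close>: what remains is the integral of \<open>q\<close> over
  the last interval of length \<open>h\<close>, where \<open>q <= 0\<close>. No term arises at the
  initial end, because the range extends to minus infinity and \<open>q\<close> is
  integrable.\<close>

lemma energy_difference_quotient:
  assumes h: "h > 0"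
  shows "(LBINT p. indicator {..<T - \<kappa>} (snd p) * (conv U kern p * ((V (snd p) (fst p) - V (snd p - h) (fst p)) / h))) \<le> 0"
proof -
  let ?I = "indicator {..<T - \<kappa>} :: real \<Rightarrow> real"
  obtain D where D: "\<And>\<tau> y h. h > 0 \<Longrightarrow> \<bar>(V \<tau> y - V (\<tau> - h) y) / h\<bar> \<le> D" by (rule V_quotient_bounded) blast
  have bb: "bounded_borel (\<lambda>p. ?I (snd p) * ((V (snd p) (fst p) - V (snd p - h) (fst p)) / h))"
  proof (rule bounded_borelI[where C=D])
    have "(\<lambda>p. V (snd p) (fst p)) \<in> borel_measurable borel" using V_pair_borel[of 0] by simp
    note [measurable] = this
    show "(\<lambda>p. ?I (snd p) * ((V (snd p) (fst p) - V (snd p - h) (fst p)) / h)) \<in> borel_measurable borel" by measurable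
    have "0 \<le> D" using D[OF h, of 0 0] by linarith
    then show "\<bar>?I (snd p) * ((V (snd p) (fst p) - V (snd p - h) (fst p)) / h)\<bar> \<le> D" for p
      using D[OF h, of "snd p" "fst p"] by (simp add: indicator_def)
  qed
  have i: "integrable lborel (\<lambda>p. ?I (snd p) * (conv U kern p * ((V (snd p) (fst p) - V (snd p - h) (fst p)) / h)))"
    using integrable_mult_bounded(1)[OF conv_kern_int bb] by (simp add: mult_ac)
  have qi: "integrable lborel (\<lambda>\<tau>. ?I \<tau> * q \<tau>)" "integrable lborel (\<lambda>\<tau>. ?I \<tau> * q (\<tau> - h))"
    "integrable lborel (\<lambda>\<tau>. ?I (\<tau> + h) * q \<tau>)"
  proof -
    have [measurable]: "q \<in> borel_measurable borel" using q_int by simp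
    have b: "bounded_borel (\<lambda>\<tau>. ?I (\<tau> + c))" for c by (rule bounded_borelI[where C=1]) auto
    have "integrable lborel (\<lambda>\<tau>. q (\<tau> - h))" using q_int integrable_shift[of q "-h"] by simp
    then show "integrable lborel (\<lambda>\<tau>. ?I \<tau> * q \<tau>)" "integrable lborel (\<lambda>\<tau>. ?I \<tau> * q (\<tau> - h))"
      "integrable lborel (\<lambda>\<tau>. ?I (\<tau> + h) * q \<tau>)"
      using integrable_mult_bounded(2)[OF q_int b[of 0]] integrable_mult_bounded(2)[OF _ b[of 0]] integrable_mult_bounded(2)[OF q_int b[of h]]
      by simp_all
  qed
  have "(LBINT p. ?I (snd p) * (conv U kern p * ((V (snd p) (fst p) - V (snd p - h) (fst p)) / h)))
     = (LBINT \<tau>. LBINT y. ?I \<tau> * (conv U kern (y, \<tau>) * ((V \<tau> y - V (\<tau> - h) y) / h)))"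
    by (subst integral_lborel_snd[OF i, symmetric]) (simp only: fst_conv snd_conv)
  also have "\<dots> \<le> (LBINT \<tau>. (1 / (2 * h)) * (?I \<tau> * q \<tau> - ?I \<tau> * q (\<tau> - h)))"
  proof (rule integral_mono)
    show "integrable lborel (\<lambda>\<tau>. LBINT y. ?I \<tau> * (conv U kern (y, \<tau>) * ((V \<tau> y - V (\<tau> - h) y) / h)))"
      using integrable_lborel_snd[OF i] by simp
    show "integrable lborel (\<lambda>\<tau>. (1 / (2 * h)) * (?I \<tau> * q \<tau> - ?I \<tau> * q (\<tau> - h)))" using qi by simp
    fix \<tau>
    show "(LBINT y. ?I \<tau> * (conv U kern (y, \<tau>) * ((V \<tau> y - V (\<tau> - h) y) / h))) \<le> (1 / (2 * h)) * (?I \<tau> * q \<tau> - ?I \<tau> * q (\<tau> - h))"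
    proof (cases "\<tau> < T - \<kappa>")
      case True
      then have "\<tau> + \<kappa> < T" by simp
      from divide_right_mono[OF q_increment[OF this h], of h] h
      have "(LBINT y. conv U kern (y, \<tau>) * (V \<tau> y - V (\<tau> - h) y)) / h \<le> (q \<tau> - q (\<tau> - h)) / 2 / h" by simp
      then show ?thesis using True by simp
    qed simp
  qed
  also have "\<dots> = (1 / (2 * h)) * ((LBINT \<tau>. ?I \<tau> * q \<tau>) - (LBINT \<tau>. ?I \<tau> * q (\<tau> - h)))"
    using qi by simp
  also have "(LBINT \<tau>. ?I \<tau> * q (\<tau> - h)) = (LBINT \<tau>. ?I (\<tau> + h) * q \<tau>)"
  proof -
    have [measurable]: "q \<in> borel_measurable borel" using q_int by simp
    show ?thesis using integral_shift[of "\<lambda>\<tau>. ?I \<tau> * q (\<tau> - h)" h] by (simp add: add.commute)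
  qed
  also have "(LBINT \<tau>. ?I \<tau> * q \<tau>) - (LBINT \<tau>. ?I (\<tau> + h) * q \<tau>) = (LBINT \<tau>. ?I \<tau> * q \<tau> - ?I (\<tau> + h) * q \<tau>)"
    using qi by simp
  finally have le: "(LBINT p. ?I (snd p) * (conv U kern p * ((V (snd p) (fst p) - V (snd p - h) (fst p)) / h)))
     \<le> (1 / (2 * h)) * (LBINT \<tau>. ?I \<tau> * q \<tau> - ?I (\<tau> + h) * q \<tau>)" .
  have "(LBINT \<tau>. ?I \<tau> * q \<tau> - ?I (\<tau> + h) * q \<tau>) \<le> (\<integral>\<tau>. 0 \<partial>(lborel :: real measure))"
  proof (rule integral_mono)
    show "?I \<tau> * q \<tau> - ?I (\<tau> + h) * q \<tau> \<le> 0" for \<tau>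
      using h q_nonpos[of \<tau>] by (auto simp: indicator_def)
  qed (use qi in auto)
  then have "(1 / (2 * h)) * (LBINT \<tau>. ?I \<tau> * q \<tau> - ?I (\<tau> + h) * q \<tau>) \<le> 0"
    using h by (intro mult_nonneg_nonpos) auto
  with le show ?thesis by linarith
qed

lemma energy_inequality:
  "(LBINT p. indicator {..<T - \<kappa>} (snd p) * (conv U kern p * conv W kern p)) \<le> 0"
proof (rule LIMSEQ_le_const2)
  define h where "h j = 1 / real (Suc j)" for j
  have h: "h j > 0" for j by (simp add: h_def)
  have h0: "h \<longlonglongrightarrow> 0" unfolding h_def[abs_def] using LIMSEQ_inverse_real_of_nat by (simp add: inverse_eq_divide)
  obtain D where D: "\<And>\<tau> y h. h > 0 \<Longrightarrow> \<bar>(V \<tau> y - V (\<tau> - h) y) / h\<bar> \<le> D" by (rule V_quotient_bounded) blast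
  have "0 \<le> D" using D[OF h[of 0], of 0 0] by linarith
  have [measurable]: "(\<lambda>p. V (snd p) (fst p)) \<in> borel_measurable borel" using V_pair_borel[of 0] by simp
  have [measurable]: "conv W kern \<in> borel_measurable borel" using kern_int by (intro borel_measurable_conv) auto
  show "(\<lambda>j. LBINT p. indicator {..<T - \<kappa>} (snd p) * (conv U kern p * ((V (snd p) (fst p) - V (snd p - h j) (fst p)) / h j)))
     \<longlonglongrightarrow> (LBINT p. indicator {..<T - \<kappa>} (snd p) * (conv U kern p * conv W kern p))"
  proof (rule integral_dominated_convergence[where w="\<lambda>p. \<bar>conv U kern p\<bar> * D"])
    show "integrable lborel (\<lambda>p. \<bar>conv U kern p\<bar> * D)" using conv_kern_int by simp
    show "AE p in lborel. (\<lambda>j. indicator {..<T - \<kappa>} (snd p) * (conv U kern p * ((V (snd p) (fst p) - V (snd p - h j) (fst p)) / h j)))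
        \<longlonglongrightarrow> indicator {..<T - \<kappa>} (snd p) * (conv U kern p * conv W kern p)"
    proof (rule AE_I2)
      fix p :: "'n pt"
      have "(\<lambda>j. (V (snd p) (fst p) - V (snd p - h j) (fst p)) / h j) \<longlonglongrightarrow> conv W kern p"
        using V_quotient_tendsto[OF h h0, of "snd p" "fst p"] by simp
      then show "(\<lambda>j. indicator {..<T - \<kappa>} (snd p) * (conv U kern p * ((V (snd p) (fst p) - V (snd p - h j) (fst p)) / h j)))
        \<longlonglongrightarrow> indicator {..<T - \<kappa>} (snd p) * (conv U kern p * conv W kern p)"
        by (intro tendsto_mult tendsto_const)
    qed
    show "AE p in lborel. norm (indicator {..<T - \<kappa>} (snd p) * (conv U kern p * ((V (snd p) (fst p) - V (snd p - h j) (fst p)) / h j)))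
       \<le> \<bar>conv U kern p\<bar> * D" for j
    proof (rule AE_I2)
      fix p :: "'n pt"
      have "\<bar>conv U kern p\<bar> * \<bar>(V (snd p) (fst p) - V (snd p - h j) (fst p)) / h j\<bar> \<le> \<bar>conv U kern p\<bar> * D"
        by (intro mult_left_mono D h) auto
      then have "\<bar>conv U kern p * ((V (snd p) (fst p) - V (snd p - h j) (fst p)) / h j)\<bar> \<le> \<bar>conv U kern p\<bar> * D"
        by (simp only: abs_mult)
      moreover have "0 \<le> \<bar>conv U kern p\<bar> * D" using \<open>0 \<le> D\<close> by simp
      ultimately show "norm (indicator {..<T - \<kappa>} (snd p) * (conv U kern p * ((V (snd p) (fst p) - V (snd p - h j) (fst p)) / h j)))
       \<le> \<bar>conv U kern p\<bar> * D" by (simp add: indicator_def)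
    qed
  qed measurable
  show "\<exists>N. \<forall>n\<ge>N. (LBINT p. indicator {..<T - \<kappa>} (snd p) * (conv U kern p * ((V (snd p) (fst p) - V (snd p - h n) (fst p)) / h n))) \<le> 0"
    using energy_difference_quotient[OF h] by blast
qed

end

section \<open>Removing the mollification\<close>

context mollified
begin

context
  assumes \<rho>: "\<And>x. 0 \<le> \<rho> x" "\<And>x. norm x \<ge> \<kappa> \<Longrightarrow> \<rho> x = 0" "integral\<^sup>L lborel \<rho> = 1"
begin

lemma kern_nonneg: "0 \<le> kern p"
  using \<rho>(1) \<beta>(2) by (simp add: kern_def)

lemma kern_integral: "integral\<^sup>L lborel kern = 1"
  unfolding kern_def using integral_lborel_mult[OF \<rho>_int \<beta>_int] \<rho>(3) \<beta>(4) by simp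

lemma kern_support:
  assumes "norm p \<ge> 2 * \<kappa>" shows "kern p = 0"
proof -
  have "norm p \<le> norm (fst p) + norm (snd p)" by (metis norm_Pair_le prod.collapse)
  then have "norm (fst p) \<ge> \<kappa> \<or> norm (snd p) \<ge> \<kappa>" using assms by linarith
  then show ?thesis using \<rho>(2) \<beta>(3) by (auto simp: kern_def)
qed

lemma kern_bb: "bounded_borel kern"
  unfolding kern_def[abs_def]
  by (intro bounded_borel_mult bounded_borel_comp[OF \<rho>_bb] bounded_borel_comp[OF \<beta>_bb]) measurable

text \<open>Mollification loses the sign of \<open>U * W\<close>, and \<open>W\<close> need not be
  integrable, so the energy inequality is compared with the plain pairing through \<open>L1\<close>
  errors of \<open>U\<close> alone: \<open>conv U kern\<close> is replaced by \<open>U\<close>, then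
  the kernel on \<open>W\<close> is moved by \<open>conv_adjoint\<close> onto the truncated
  \<open>U\<close>, where it appears reflected as \<open>k'\<close>.\<close>

lemma pairing_le:
  fixes c :: "'n pt \<Rightarrow> real"
  defines "c \<equiv> \<lambda>p. indicator {..<T - \<kappa>} (snd p)" and "k' \<equiv> \<lambda>p. kern (- p)"
  shows "(LBINT p. U p * W p) \<le> C * ((LBINT p. \<bar>conv U kern p - U p\<bar>) +
      (LBINT p. \<bar>c p * U p - U p\<bar>) + (LBINT p. \<bar>conv U k' p - U p\<bar>))"
proof -
  have [measurable]: "c \<in> borel_measurable borel" unfolding c_def by measurable
  have [measurable]: "kern \<in> borel_measurable borel" using kern_int by simp
  have cb: "\<bar>c p\<bar> \<le> 1" for p by (simp add: c_def)
  then have cbb: "bounded_borel c" by (intro bounded_borelI) auto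
  have k'i: "integrable lborel k'" using kern_int integrable_reflect[of kern 0] by (simp add: k'_def)
  then have [measurable]: "k' \<in> borel_measurable borel" by simp
  have k'n: "(LBINT p. \<bar>k' p\<bar>) = 1"
    using kern_integral integral_reflect[of kern 0] kern_nonneg by (simp add: k'_def)
  have kn: "(LBINT p. \<bar>kern p\<bar>) = 1" using kern_integral kern_nonneg by simp
  have Wk: "bounded_borel (conv W kern)" by (rule bounded_borel_conv[OF W_bounded_borel kern_int])
  have Wkb: "\<bar>conv W kern p\<bar> \<le> C" for p using conv_bound[OF W_bounded_borel W_bound kern_int, of p] kn by simp
  have cWk: "bounded_borel (\<lambda>p. c p * conv W kern p)" by (rule bounded_borel_mult[OF cbb Wk])
  have cWkb: "\<bar>c p * conv W kern p\<bar> \<le> C" for p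
    using mult_mono[OF cb[of p] Wkb[of p]] by (simp add: abs_mult)
  have cU: "integrable lborel (\<lambda>p. c p * U p)" by (rule integrable_mult_bounded(2)[OF U_int cbb])
  have 1: "\<bar>LBINT p. (conv U kern p - U p) * (c p * conv W kern p)\<bar> \<le> C * (LBINT p. \<bar>conv U kern p - U p\<bar>)"
    by (rule abs_integral_mult_le[OF _ cWk cWkb]) (use conv_kern_int U_int in simp)
  have ic: "integrable lborel (conv (\<lambda>p. c p * U p) k')" "integrable lborel (conv U k')" "integrable lborel (conv (\<lambda>p. c p * U p - U p) k')"
    by (intro integrable_conv cU U_int k'i Bochner_Integration.integrable_diff)+
  have 2: "\<bar>LBINT p. (conv (\<lambda>p. c p * U p) k' p - U p) * W p\<bar> \<le> C * (LBINT p. \<bar>conv (\<lambda>p. c p * U p) k' p - U p\<bar>)"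
    by (rule abs_integral_mult_le[OF _ W_bounded_borel W_bound]) (use ic U_int in simp)
  have lin: "conv (\<lambda>p. c p * U p) k' p = conv (\<lambda>p. c p * U p - U p) k' p + conv U k' p" for p
  proof -
    have b: "bounded_borel (\<lambda>x. k' (p - x))"
      unfolding k'_def by (rule bounded_borel_comp[OF kern_bb]) measurable
    have "integrable lborel (\<lambda>x. (c x * U x - U x) * k' (p - x))" "integrable lborel (\<lambda>x. U x * k' (p - x))"
      by (intro integrable_mult_bounded(1)[OF _ b] Bochner_Integration.integrable_diff cU U_int)+
    from Bochner_Integration.integral_add[OF this] show ?thesis
      unfolding conv_def by (simp add: algebra_simps)
  qed
  have 3: "(LBINT p. \<bar>conv (\<lambda>p. c p * U p) k' p - U p\<bar>) \<le>
      (LBINT p. \<bar>c p * U p - U p\<bar>) + (LBINT p. \<bar>conv U k' p - U p\<bar>)"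
  proof -
    have "(LBINT p. \<bar>conv (\<lambda>p. c p * U p) k' p - U p\<bar>) \<le>
        (LBINT p. \<bar>conv (\<lambda>p. c p * U p - U p) k' p\<bar> + \<bar>conv U k' p - U p\<bar>)"
      by (rule integral_mono) (use ic U_int in \<open>auto simp: lin\<close>)
    also have "\<dots> = (LBINT p. \<bar>conv (\<lambda>p. c p * U p - U p) k' p\<bar>) + (LBINT p. \<bar>conv U k' p - U p\<bar>)"
      using ic U_int by simp
    also have "(LBINT p. \<bar>conv (\<lambda>p. c p * U p - U p) k' p\<bar>) \<le> (LBINT p. \<bar>c p * U p - U p\<bar>)"
      using conv_norm_le[OF _ k'i, of "\<lambda>p. c p * U p - U p"] cU U_int k'n by simp
    finally show ?thesis by simp
  qed
  have adj: "(LBINT p. (c p * U p) * conv W kern p) = (LBINT p. conv (\<lambda>p. c p * U p) k' p * W p)"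
    unfolding k'_def by (rule conv_adjoint[OF cU W_bounded_borel kern_int])
  have i1: "integrable lborel (\<lambda>p. (conv U kern p - U p) * (c p * conv W kern p))"
    by (rule integrable_mult_bounded(1)[OF _ cWk]) (use conv_kern_int U_int in simp)
  have i2: "integrable lborel (\<lambda>p. (c p * U p) * conv W kern p)"
    by (rule integrable_mult_bounded(1)[OF cU Wk])
  have i3: "integrable lborel (\<lambda>p. conv (\<lambda>p. c p * U p) k' p * W p)" "integrable lborel (\<lambda>p. U p * W p)"
    by (rule integrable_mult_bounded(1)[OF _ W_bounded_borel]; use ic U_int in simp)+
  have "(LBINT p. c p * (conv U kern p * conv W kern p)) =
      (LBINT p. (conv U kern p - U p) * (c p * conv W kern p) + (c p * U p) * conv W kern p)"
    by (simp add: algebra_simps)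
  also have "\<dots> = (LBINT p. (conv U kern p - U p) * (c p * conv W kern p)) + (LBINT p. (c p * U p) * conv W kern p)"
    by (rule Bochner_Integration.integral_add[OF i1 i2])
  finally have 4: "(LBINT p. (conv U kern p - U p) * (c p * conv W kern p)) + (LBINT p. conv (\<lambda>p. c p * U p) k' p * W p) \<le> 0"
    using energy_inequality adj by (simp add: c_def)
  have 5: "(LBINT p. (conv (\<lambda>p. c p * U p) k' p - U p) * W p) =
      (LBINT p. conv (\<lambda>p. c p * U p) k' p * W p) - (LBINT p. U p * W p)"
    unfolding left_diff_distrib by (rule Bochner_Integration.integral_diff[OF i3])
  have "C * (LBINT p. \<bar>conv (\<lambda>p. c p * U p) k' p - U p\<bar>) \<le>
      C * ((LBINT p. \<bar>c p * U p - U p\<bar>) + (LBINT p. \<bar>conv U k' p - U p\<bar>))"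
    by (rule mult_left_mono[OF 3 C_nonneg])
  then show ?thesis using 1 2 4 5 unfolding distrib_left by linarith
qed

text \<open>Where \<open>phi\<close> is constant, \<open>W = 0\<close> carries no pointwise
  information on \<open>U\<close>; the equation does. With \<open>W = 0\<close> the right-hand side
  of \<open>conv_kern_eq\<close> is zero, so \<open>conv U kern\<close> vanishes before time
  \<open>T - \<kappa>\<close>, and the two \<open>L1\<close> errors account for all of
  \<open>U\<close>.\<close>

lemma norm_le_if_W_vanishes:
  fixes c :: "'n pt \<Rightarrow> real"
  defines "c \<equiv> \<lambda>p. indicator {..<T - \<kappa>} (snd p)"
  assumes W0: "AE p in lborel. W p = 0"
  shows "(LBINT p. \<bar>U p\<bar>) \<le> (LBINT p. \<bar>conv U kern p - U p\<bar>) + (LBINT p. \<bar>c p * U p - U p\<bar>)"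
proof -
  have [measurable]: "c \<in> borel_measurable borel" unfolding c_def by measurable
  have "bounded_borel c" by (rule bounded_borelI[where C=1]) (auto simp: c_def)
  then have cU: "integrable lborel (\<lambda>p. c p * U p)" by (rule integrable_mult_bounded(2)[OF U_int])
  have z: "conv U kern p = 0" if "snd p < T - \<kappa>" for p
  proof -
    have "snd p + \<kappa> < T" using that by simp
    from conv_kern_eq[OF this, of "fst p"]
    have "conv U kern p = (LBINT q. W q * (levy_op Sg mu \<rho> (fst p - fst q) * \<Theta> (snd p - snd q)))"
      by (simp add: conv_w[OF integrable_levy_op[OF mu \<rho>_test]])
    also have "\<dots> = (\<integral>q. 0 \<partial>(lborel :: 'n pt measure))"
    proof (rule integral_cong_AE)
      show "(\<lambda>q. W q * (levy_op Sg mu \<rho> (fst p - fst q) * \<Theta> (snd p - snd q))) \<in> borel_measurable lborel"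
        by (rule borel_measurable_integrable[OF integrable_W[OF integrable_levy_op[OF mu \<rho>_test] \<Theta>_bb]])
      show "AE q in lborel. W q * (levy_op Sg mu \<rho> (fst p - fst q) * \<Theta> (snd p - snd q)) = 0"
        using W0 by eventually_elim simp
    qed simp
    finally show ?thesis by simp
  qed
  have "(LBINT p. \<bar>U p\<bar>) \<le> (LBINT p. \<bar>conv U kern p - U p\<bar> + \<bar>c p * U p - U p\<bar>)"
  proof (rule integral_mono)
    show "\<bar>U p\<bar> \<le> \<bar>conv U kern p - U p\<bar> + \<bar>c p * U p - U p\<bar>" for p
      using z[of p] by (cases "snd p < T - \<kappa>") (auto simp: c_def)
  qed (use U_int conv_kern_int cU in auto)
  also have "\<dots> = (LBINT p. \<bar>conv U kern p - U p\<bar>) + (LBINT p. \<bar>c p * U p - U p\<bar>)"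
    using U_int conv_kern_int cU by simp
  finally show ?thesis .
qed

end

end

text \<open>The errors in \<open>pairing_le\<close> and \<open>norm_le_if_W_vanishes\<close> tend to
  \<open>0\<close> along \<open>\<kappa> = 1 / Suc n\<close>, the cut-off error because
  \<open>U\<close> is zero for \<open>t >= T\<close>. The first bound gives
  \<open>U * W = 0\<close>, the assumption \<open>WU\<close> turns this into \<open>W = 0\<close>,
  and the second bound yields \<open>U = 0\<close>.\<close>

lemma (in evolution) vanishes:
  assumes sign: "AE p in lborel. 0 \<le> U p * W p" and WU: "AE p in lborel. U p = 0 \<longrightarrow> W p = 0"
  shows "AE p in lborel. U p = 0"
proof -
  define \<kappa> where "\<kappa> n = 1 / real (Suc n)" for n
  have \<kappa>: "\<kappa> n > 0" for n by (simp add: \<kappa>_def)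
  have \<kappa>0: "\<kappa> \<longlonglongrightarrow> 0" unfolding \<kappa>_def[abs_def] using LIMSEQ_inverse_real_of_nat by (simp add: inverse_eq_divide)
  have "\<forall>n. \<exists>\<rho>::real^'n \<Rightarrow> real. test_fun UNIV \<rho> \<and> (\<forall>x. \<rho> x \<ge> 0) \<and> (\<forall>x. norm x \<ge> \<kappa> n \<longrightarrow> \<rho> x = 0) \<and> integral\<^sup>L lborel \<rho> = 1"
    using bump_function_exists[OF \<kappa>] by metis
  then obtain \<rho> :: "nat \<Rightarrow> real^'n \<Rightarrow> real" where \<rho>: "\<And>n. test_fun UNIV (\<rho> n)" "\<And>n x. 0 \<le> \<rho> n x"
      "\<And>n x. norm x \<ge> \<kappa> n \<Longrightarrow> \<rho> n x = 0" "\<And>n. integral\<^sup>L lborel (\<rho> n) = 1"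
    by metis
  have "\<forall>n. \<exists>\<beta> \<Theta>. mollifier_step (\<kappa> n) \<beta> \<Theta>" using mollifier_step_exists[OF \<kappa>] by blast
  then obtain \<beta> \<Theta> where \<beta>\<Theta>: "\<And>n. mollifier_step (\<kappa> n) (\<beta> n) (\<Theta> n)" by metis
  have m: "mollified Sg mu T C U W (\<kappa> n) (\<rho> n) (\<beta> n) (\<Theta> n)" for n
    by unfold_locales (rule \<kappa> \<rho>(1) \<beta>\<Theta>)+
  define k where "k n = mollified.kern (\<rho> n) (\<beta> n)" for n
  define c :: "nat \<Rightarrow> 'n pt \<Rightarrow> real" where "c n p = indicator {..<T - \<kappa> n} (snd p)" for n p
  have k: "integrable lborel (k n)" "k n p \<ge> 0" "integral\<^sup>L lborel (k n) = 1" "norm p \<ge> 2 * \<kappa> n \<Longrightarrow> k n p = 0" for n p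
    unfolding k_def
    using mollified.kern_int[OF m] mollified.kern_nonneg[OF m \<rho>(2,3,4)] mollified.kern_integral[OF m \<rho>(2,3,4)] mollified.kern_support[OF m \<rho>(2,3,4)]
    by auto
  then have [measurable]: "k n \<in> borel_measurable borel" for n by auto
  have k': "integrable lborel (\<lambda>p. k n (- p))" "integral\<^sup>L lborel (\<lambda>p. k n (- p)) = 1" for n
    using integrable_reflect[of "k n" 0] integral_reflect[of "k n" 0] k by simp_all
  have \<kappa>2: "(\<lambda>n. 2 * \<kappa> n) \<longlonglongrightarrow> 0" using tendsto_mult[OF tendsto_const \<kappa>0, of 2] by simp
  have L1: "(\<lambda>n. LBINT p. \<bar>conv U (k n) p - U p\<bar>) \<longlonglongrightarrow> 0"
    by (rule approximate_identity[OF U_int k \<kappa>2])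
  have L2: "(\<lambda>n. LBINT p. \<bar>conv U (\<lambda>p. k n (- p)) p - U p\<bar>) \<longlonglongrightarrow> 0"
    by (rule approximate_identity[OF U_int k'(1) _ k'(2) _ \<kappa>2]) (use k in auto)
  have L3: "(\<lambda>n. LBINT p. \<bar>c n p * U p - U p\<bar>) \<longlonglongrightarrow> 0"
  proof -
    have "(\<lambda>n. LBINT p. \<bar>c n p * U p - U p\<bar>) \<longlonglongrightarrow> (\<integral>p. 0 \<partial>(lborel :: 'n pt measure))"
    proof (rule integral_dominated_convergence[where w="\<lambda>p. \<bar>U p\<bar>"])
      show "(\<lambda>p. \<bar>c n p * U p - U p\<bar>) \<in> borel_measurable lborel" for n unfolding c_def by measurable
      show "AE p in lborel. norm \<bar>c n p * U p - U p\<bar> \<le> \<bar>U p\<bar>" for n by (intro AE_I2) (simp add: c_def indicator_def)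
      show "AE p in lborel. (\<lambda>n. \<bar>c n p * U p - U p\<bar>) \<longlonglongrightarrow> 0"
      proof (rule AE_I2)
        fix p :: "'n pt"
        show "(\<lambda>n. \<bar>c n p * U p - U p\<bar>) \<longlonglongrightarrow> 0"
        proof (cases "snd p < T")
          case True
          have "\<forall>\<^sub>F n in sequentially. \<kappa> n < T - snd p" using order_tendstoD(2)[OF \<kappa>0] True by simp
          then have "\<forall>\<^sub>F n in sequentially. \<bar>c n p * U p - U p\<bar> = 0" by (rule eventually_mono) (simp add: c_def)
          then show ?thesis by (rule tendsto_eventually)
        next
          case False
          then have "U p = 0" by (intro U_zero) (auto simp: QT_def)
          then show ?thesis by simp
        qed
      qed
    qed (use U_int in auto)
    then show ?thesis by simp
  qed
  have "(\<lambda>n. C * ((LBINT p. \<bar>conv U (k n) p - U p\<bar>) + (LBINT p. \<bar>c n p * U p - U p\<bar>) +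
      (LBINT p. \<bar>conv U (\<lambda>p. k n (- p)) p - U p\<bar>))) \<longlonglongrightarrow> C * (0 + 0 + 0)"
    by (intro tendsto_mult tendsto_add tendsto_const L1 L2 L3)
  then have le: "(LBINT p. U p * W p) \<le> C * (0 + 0 + 0)"
    by (rule LIMSEQ_le_const)
       (use mollified.pairing_le[OF m \<rho>(2,3,4)] in \<open>auto simp: c_def[abs_def] k_def\<close>)
  have UWi: "integrable lborel (\<lambda>p. U p * W p)" by (rule integrable_mult_bounded(1)[OF U_int W_bounded_borel])
  have "(LBINT p. U p * W p) \<ge> 0" using sign by (rule integral_nonneg_AE)
  with le have "(LBINT p. U p * W p) = 0" by simp
  then have "AE p in lborel. U p * W p = 0" using integral_nonneg_eq_0_iff_AE[OF UWi sign] by simp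
  with WU have W0: "AE p in lborel. W p = 0" by eventually_elim auto
  have "(\<lambda>n. (LBINT p. \<bar>conv U (k n) p - U p\<bar>) + (LBINT p. \<bar>c n p * U p - U p\<bar>)) \<longlonglongrightarrow> 0 + 0"
    by (intro tendsto_add L1 L3)
  then have "(LBINT p. \<bar>U p\<bar>) \<le> 0 + 0"
    by (rule LIMSEQ_le_const)
       (use mollified.norm_le_if_W_vanishes[OF m \<rho>(2,3,4) W0] in \<open>auto simp: c_def[abs_def] k_def\<close>)
  moreover have "(LBINT p. \<bar>U p\<bar>) \<ge> 0" by simp
  ultimately have "(LBINT p. \<bar>U p\<bar>) = 0" by linarith
  then have "AE p in lborel. \<bar>U p\<bar> = 0"
    using integral_nonneg_eq_0_iff_AE[of lborel "\<lambda>p. \<bar>U p\<bar>"] U_int by simp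
  then show ?thesis by simp
qed

section \<open>Borel representatives of distributional solutions\<close>

text \<open>By completeness every subset of the exceptional null set is Lebesgue measurable, so each
  sublevel set differs from a Borel one by a measurable set.\<close>

lemma borel_measurable_lebesgue_AE:
  fixes f f' :: "'a::euclidean_space \<Rightarrow> real"
  assumes [measurable]: "f' \<in> borel_measurable borel" and AE: "AE x in lborel. f x = f' x"
  shows "f \<in> borel_measurable lebesgue"
proof (rule borel_measurable_iff_le[THEN iffD2], intro allI)
  fix a
  have [measurable]: "f' \<in> borel_measurable lebesgue" by (rule measurable_completion) simp
  have [measurable]: "Measurable.pred lebesgue (\<lambda>x. f x \<noteq> f' x)"
    by (rule sets_completion_AE) (use AE in auto)
  have [measurable]: "Measurable.pred lebesgue (\<lambda>x. f x \<le> a \<and> f x \<noteq> f' x)"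
    by (rule sets_completion_AE) (use AE in auto)
  have "(\<lambda>x. f x \<le> a) = (\<lambda>x. (f' x \<le> a \<and> \<not> (f x \<noteq> f' x)) \<or> (f x \<le> a \<and> f x \<noteq> f' x))" by auto
  also have "Measurable.pred lebesgue \<dots>" by measurable
  finally show "{w \<in> space lebesgue. f w \<le> a} \<in> sets lebesgue" by (simp add: pred_def)
qed

lemma
  fixes f f' :: "'a::euclidean_space \<Rightarrow> real"
  assumes f': "f' \<in> borel_measurable borel" and AE: "AE x in lborel. f x = f' x"
  shows integral_lebesgue_AE: "integral\<^sup>L lebesgue f = integral\<^sup>L lborel f'"
    and integrable_lebesgue_AE: "integrable lebesgue f \<longleftrightarrow> integrable lborel f'"
proof -
  note m = borel_measurable_lebesgue_AE[OF f' AE]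
  have m': "f' \<in> borel_measurable lebesgue" by (rule measurable_completion) (simp add: f')
  have "integral\<^sup>L lebesgue f = integral\<^sup>L lebesgue f'"
    using AE_completion[OF AE] by (rule integral_cong_AE[OF m m'])
  then show "integral\<^sup>L lebesgue f = integral\<^sup>L lborel f'" using f' by (simp add: integral_completion)
  have "integrable lebesgue f \<longleftrightarrow> integrable lebesgue f'"
    using AE_completion[OF AE] by (rule integrable_cong_AE[OF m m'])
  then show "integrable lebesgue f \<longleftrightarrow> integrable lborel f'" using f' by (simp add: integrable_completion)
qed

lemma
  fixes f f' :: "'a::euclidean_space \<Rightarrow> real"
  assumes S: "S \<in> sets borel" and f': "f' \<in> borel_measurable borel"
    and AE: "AE p in lborel. p \<in> S \<longrightarrow> f p = f' p" and z: "\<And>p. p \<notin> S \<Longrightarrow> f' p = 0"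
  shows integrable_lebesgue_on_AE: "integrable (lebesgue_on S) f \<longleftrightarrow> integrable lborel f'"
    and integral_lebesgue_on_AE: "integral\<^sup>L (lebesgue_on S) f = integral\<^sup>L lborel f'"
proof -
  have S': "S \<in> sets lebesgue" using S by simp
  have AE': "AE p in lborel. (if p \<in> S then f p else 0) = f' p"
    using AE by eventually_elim (use z in auto)
  show "integrable (lebesgue_on S) f \<longleftrightarrow> integrable lborel f'"
    using integrable_lebesgue_AE[OF f' AE'] Lebesgue_Measure.integrable_restrict_UNIV[OF S', of f] by simp
  show "integral\<^sup>L (lebesgue_on S) f = integral\<^sup>L lborel f'"
    using integral_lebesgue_AE[OF f' AE'] Lebesgue_Measure.integral_restrict_UNIV[OF S', of f] by simp
qed

lemma AE_lebesgue_on_iff: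
  "S \<in> sets borel \<Longrightarrow> (AE x in lebesgue_on S. P x) \<longleftrightarrow> (AE x in lborel. x \<in> S \<longrightarrow> P x)"
  by (subst AE_restrict_space_iff) (auto simp: AE_completion_iff)

text \<open>The completion provides a Borel version; truncating it at \<open>|C|\<close> alters it
  on \<open>S\<close> only in a null set and makes the bound hold everywhere.\<close>

lemma Linf_borel_representative:
  fixes f :: "'a::euclidean_space \<Rightarrow> real"
  assumes S: "S \<in> sets borel" and f: "Linf S f"
  obtains f' C where "f' \<in> borel_measurable borel" "\<And>x. \<bar>f' x\<bar> \<le> C" "\<And>x. x \<notin> S \<Longrightarrow> f' x = 0"
    "AE x in lborel. x \<in> S \<longrightarrow> f x = f' x"
proof -
  have S': "S \<in> sets lebesgue" using S by simp
  obtain C where C: "AE x in lborel. x \<in> S \<longrightarrow> \<bar>f x\<bar> \<le> C"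
    using f unfolding Linf_def AE_lebesgue_on_iff[OF S] by blast
  have "(\<lambda>x. if x \<in> S then f x else 0) \<in> borel_measurable lebesgue"
  proof -
    have "S \<inter> space lebesgue \<in> sets lebesgue" using S' by simp
    then have "(\<lambda>x. indicator S x *\<^sub>R f x) \<in> borel_measurable lebesgue"
      using f by (simp add: Linf_def borel_measurable_restrict_space_iff)
    moreover have "(\<lambda>x. indicator S x *\<^sub>R f x) = (\<lambda>x. if x \<in> S then f x else 0)"
      by (auto simp: indicator_def)
    ultimately show ?thesis by (simp only:)
  qed
  from completion_ex_borel_measurable_real[OF this] obtain h
    where h: "h \<in> borel_measurable borel" "AE x in lborel. (if x \<in> S then f x else 0) = h x" by auto
  define f' where "f' x = indicator S x * max (- \<bar>C\<bar>) (min \<bar>C\<bar> (h x))" for x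
  show ?thesis
  proof (rule that[of f' "\<bar>C\<bar>"])
    show "f' \<in> borel_measurable borel" unfolding f'_def[abs_def] using h(1) S by measurable
    show "\<bar>f' x\<bar> \<le> \<bar>C\<bar>" for x by (auto simp: f'_def indicator_def)
    show "AE x in lborel. x \<in> S \<longrightarrow> f x = f' x"
      using C h(2) by eventually_elim (auto simp: f'_def)
  qed (simp add: f'_def)
qed

text \<open>The exceptional set is first enlarged to a Borel null set, since \<open>P\<close> need
  not be measurable; Fubini then applies.\<close>

lemma AE_slice_snd:
  fixes P :: "'a::euclidean_space \<times> 'b::euclidean_space \<Rightarrow> bool"
  assumes "AE p in lborel. P p"
  shows "AE t in lborel. AE x in lborel. P (x, t)"
proof -
  obtain N where N: "N \<in> null_sets lborel" "{p. \<not> P p} \<subseteq> N"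
    using assms by (auto simp: eventually_ae_filter)
  have "AE p in lborel \<Otimes>\<^sub>M lborel. (fst p, snd p) \<notin> N"
    unfolding lborel_prod using AE_not_in[OF N(1)] by simp
  moreover have "{p \<in> space (lborel \<Otimes>\<^sub>M lborel). (fst p, snd p) \<notin> N} \<in> sets (lborel \<Otimes>\<^sub>M lborel)"
    unfolding lborel_prod using N(1) by (auto simp: Compl_eq[symmetric] null_sets_def intro: borel_comp)
  ultimately have "AE t in lborel. AE x in lborel. (x, t) \<notin> N"
    using lborel_pair.AE_commute[of "\<lambda>x t. (x, t) \<notin> N"] lborel_pair.AE_pair_iff[of "\<lambda>x t. (x, t) \<notin> N"] by simp
  then show ?thesis by eventually_elim (use N(2) in \<open>auto elim: eventually_mono\<close>)
qed

lemma QT_borel: "QT T \<in> sets borel"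
proof (rule borel_open)
  show "open (QT T)" unfolding QT_def by (intro open_Times open_UNIV open_greaterThanLessThan)
qed

lemma ess_lim_0_diff:
  assumes "ess_lim_0 F L" "ess_lim_0 G L"
    and AE: "AE t in lborel. 0 < t \<and> t < T \<longrightarrow> H t = F t - G t" and T: "T > 0"
  shows "ess_lim_0 H 0"
  unfolding ess_lim_0_def
proof (intro allI impI)
  fix e :: real assume "e > 0"
  then have "e / 2 > 0" by simp
  obtain d1 where d1: "d1 > 0" "AE t in lborel. 0 < t \<and> t < d1 \<longrightarrow> \<bar>F t - L\<bar> < e / 2"
    using assms(1)[unfolded ess_lim_0_def, rule_format, OF \<open>e / 2 > 0\<close>] by blast
  obtain d2 where d2: "d2 > 0" "AE t in lborel. 0 < t \<and> t < d2 \<longrightarrow> \<bar>G t - L\<bar> < e / 2"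
    using assms(2)[unfolded ess_lim_0_def, rule_format, OF \<open>e / 2 > 0\<close>] by blast
  show "\<exists>d>0. AE t in lborel. 0 < t \<and> t < d \<longrightarrow> \<bar>H t - 0\<bar> < e"
  proof (intro exI[of _ "min T (min d1 d2)"] conjI)
    show "min T (min d1 d2) > 0" using T d1 d2 by simp
    show "AE t in lborel. 0 < t \<and> t < min T (min d1 d2) \<longrightarrow> \<bar>H t - 0\<bar> < e"
      using AE d1(2) d2(2)
    proof eventually_elim
      case (elim t)
      show ?case
      proof
        assume "0 < t \<and> t < min T (min d1 d2)"
        then have "H t = F t - G t" "\<bar>F t - L\<bar> < e / 2" "\<bar>G t - L\<bar> < e / 2" using elim by auto
        then show "\<bar>H t - 0\<bar> < e" by linarith
      qed
    qed
  qed
qed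

lemma test_fun_snd_zero: "test_fun S \<theta> \<Longrightarrow> t \<notin> S \<Longrightarrow> \<theta> t = 0 \<and> dirderiv \<theta> v t = 0"
  using not_in_tsupp[of t \<theta>] dirderiv_not_in_tsupp[of t \<theta> v] by (auto simp: test_fun_def)

text \<open>Integrability is part of the claim: a non-integrable integrand has integral \<open>0\<close>, so without it the
  weak formulations of two solutions could not be subtracted.\<close>

lemma dist_sol_product_test:
  fixes Sg :: "real^'p::finite^'n::finite" and mu :: "(real^'n) measure"
  assumes mu: "levy_measure mu" and phi: "continuous_on UNIV phi" and g: "L1loc (QT T) g"
    and sol: "dist_sol Sg mu phi g u0 T u"
    and u': "u' \<in> borel_measurable borel" "\<And>p. \<bar>u' p\<bar> \<le> C" "AE p in lborel. p \<in> QT T \<longrightarrow> u p = u' p"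
    and phi_bound: "\<And>p. \<bar>phi (u' p)\<bar> \<le> D"
    and \<rho>: "test_fun UNIV \<rho>" and \<theta>: "test_fun {0<..<T} \<theta>"
  shows "integrable lborel (\<lambda>p. u' p * (\<rho> (y - fst p) * dirderiv \<theta> 1 (snd p)) + phi (u' p) * (levy_op Sg mu \<rho> (y - fst p) * \<theta> (snd p)))"
    and "(LBINT p. u' p * (\<rho> (y - fst p) * dirderiv \<theta> 1 (snd p)) + phi (u' p) * (levy_op Sg mu \<rho> (y - fst p) * \<theta> (snd p)))
      = - (\<integral>p. g p * (\<rho> (y - fst p) * \<theta> (snd p)) \<partial>(lebesgue_on (QT T)))"
proof -
  let ?L = "levy_op Sg mu \<rho>"
  define psi where "psi p = \<rho> (y - fst p) * \<theta> (snd p)" for p :: "'n pt"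
  have sm: "smooth_fun \<rho>" "smooth_fun \<theta>" using \<rho> \<theta> by (auto dest: test_fun_smooth)
  have test: "test_fun (QT T) psi"
    unfolding psi_def[abs_def] QT_def by (rule test_fun_product[OF \<rho> \<theta>])
  have d1: "dirderiv psi (0, 1) p = \<rho> (y - fst p) * dirderiv \<theta> 1 (snd p)" for p
  proof -
    have "dirderiv \<rho> 0 x = 0" for x
      using linear_0[OF has_derivative_linear[OF smooth_fun_has_derivative[OF sm(1)]]] .
    then show ?thesis unfolding psi_def[abs_def] dirderiv_product[OF sm] by simp
  qed
  have d2: "frakL Sg mu psi p = ?L (y - fst p) * \<theta> (snd p)" for p
    unfolding psi_def[abs_def] by (rule frakL_product[OF mu \<rho> sm(2)])
  have "(\<integral>p. u p * dirderiv psi (0, 1) p + phi (u p) * frakL Sg mu psi p + g p * psi p \<partial>(lebesgue_on (QT T))) = 0"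
    using sol test unfolding dist_sol_def by blast
  then have eq: "(\<integral>p. u p * (\<rho> (y - fst p) * dirderiv \<theta> 1 (snd p)) + phi (u p) * (?L (y - fst p) * \<theta> (snd p)) + g p * psi p \<partial>(lebesgue_on (QT T))) = 0"
    by (simp only: d1 d2)
  have \<theta>': "test_fun {0<..<T} (dirderiv \<theta> 1)" by (rule test_fun_dirderiv[OF \<theta>])
  have [measurable]: "\<rho> \<in> borel_measurable borel" "u' \<in> borel_measurable borel" using smooth_fun_borel[OF sm(1)] u' by auto
  have [measurable]: "phi \<in> borel_measurable borel" by (rule borel_measurable_continuous_onI[OF phi])
  have Li: "integrable lborel ?L" by (rule integrable_levy_op[OF mu \<rho>])
  then have [measurable]: "?L \<in> borel_measurable borel" by simp
  have "integrable lborel (\<lambda>x. \<rho> (y - x))" "integrable lborel (\<lambda>x. ?L (y - x))"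
    using test_fun_integrable[OF \<rho>] Li by (simp_all add: integrable_reflect)
  then have i: "integrable lborel (\<lambda>p. \<rho> (y - fst p) * dirderiv \<theta> 1 (snd p))" "integrable lborel (\<lambda>p. ?L (y - fst p) * \<theta> (snd p))"
    using test_fun_integrable[OF \<theta>] test_fun_integrable[OF \<theta>'] by (auto intro: integrable_lborel_mult)
  define F where "F p = u' p * (\<rho> (y - fst p) * dirderiv \<theta> 1 (snd p)) + phi (u' p) * (?L (y - fst p) * \<theta> (snd p))" for p
  have bb: "bounded_borel u'" "bounded_borel (\<lambda>p. phi (u' p))"
    by (rule bounded_borelI[OF _ u'(2)], measurable, rule bounded_borelI[OF _ phi_bound], measurable)
  have Fi: "integrable lborel F"
    unfolding F_def[abs_def]
    by (rule Bochner_Integration.integrable_add[OF integrable_mult_bounded(2)[OF i(1) bb(1)]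
          integrable_mult_bounded(2)[OF i(2) bb(2)]])
  then show "integrable lborel (\<lambda>p. u' p * (\<rho> (y - fst p) * dirderiv \<theta> 1 (snd p)) + phi (u' p) * (?L (y - fst p) * \<theta> (snd p)))"
    by (simp add: F_def[abs_def])
  have FAE: "AE p in lborel. p \<in> QT T \<longrightarrow>
      u p * (\<rho> (y - fst p) * dirderiv \<theta> 1 (snd p)) + phi (u p) * (?L (y - fst p) * \<theta> (snd p)) = F p"
    using u'(3) by eventually_elim (simp add: F_def)
  have Fz: "F p = 0" if "p \<notin> QT T" for p
    using that test_fun_snd_zero[OF \<theta>, of "snd p"] by (cases p) (auto simp: F_def QT_def)
  have Fm: "F \<in> borel_measurable borel" using Fi by simp
  note tr = integrable_lebesgue_on_AE[OF QT_borel Fm FAE Fz] integral_lebesgue_on_AE[OF QT_borel Fm FAE Fz]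
  \<comment> \<open>\<open>g\<close> is known to be integrable only on compact subsets of
    \<open>QT T\<close>; the support of \<open>psi\<close> is one, and \<open>psi\<close> is
    bounded.\<close>
  have gi: "integrable (lebesgue_on (QT T)) (\<lambda>p. g p * psi p)"
  proof -
    let ?K = "tsupp psi"
    have K: "compact ?K" "?K \<subseteq> QT T" using test by (auto simp: test_fun_def)
    then have "closed ?K" by (intro compact_imp_closed)
    then have Kb: "?K \<in> sets lebesgue" by simp
    have "integrable (lebesgue_on ?K) g" using g K by (auto simp: L1loc_def)
    then have gK: "integrable lebesgue (\<lambda>p. indicator ?K p *\<^sub>R g p)"
      using Kb by (subst (asm) integrable_restrict_space) auto
    obtain B where B: "B > 0" "\<And>p. \<bar>psi p\<bar> \<le> B" by (rule test_fun_bounded[OF test]) blast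
    have pm: "psi \<in> borel_measurable lebesgue"
      by (rule measurable_completion) (use smooth_fun_borel[OF test_fun_smooth[OF test]] in simp)
    have "integrable lebesgue (\<lambda>p. indicator ?K p *\<^sub>R g p * psi p)"
    proof (rule Bochner_Integration.integrable_bound)
      show "integrable lebesgue (\<lambda>p. B * (indicator ?K p *\<^sub>R g p))" using gK by (rule integrable_mult_right)
      show "(\<lambda>p. indicator ?K p *\<^sub>R g p * psi p) \<in> borel_measurable lebesgue"
        using gK pm by (intro borel_measurable_times) auto
      show "AE p in lebesgue. norm (indicator ?K p *\<^sub>R g p * psi p) \<le> norm (B * (indicator ?K p *\<^sub>R g p))"
        using B by (intro AE_I2) (auto simp: indicator_def abs_mult mult.commute[of B] intro!: mult_left_mono)
    qed
    moreover have "(\<lambda>p. indicator ?K p *\<^sub>R g p * psi p) = (\<lambda>p. indicator (QT T) p *\<^sub>R (g p * psi p))"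
      using K(2) not_in_tsupp[of _ psi] by (auto simp: fun_eq_iff indicator_def)
    ultimately show ?thesis
      using QT_borel[of T] by (subst integrable_restrict_space) auto
  qed
  have "(\<integral>p. u p * (\<rho> (y - fst p) * dirderiv \<theta> 1 (snd p)) + phi (u p) * (?L (y - fst p) * \<theta> (snd p)) \<partial>(lebesgue_on (QT T)))
      + (\<integral>p. g p * psi p \<partial>(lebesgue_on (QT T))) = 0"
    using eq Bochner_Integration.integral_add[OF _ gi] tr(1) Fi by simp
  then show "(LBINT p. u' p * (\<rho> (y - fst p) * dirderiv \<theta> 1 (snd p)) + phi (u' p) * (?L (y - fst p) * \<theta> (snd p)))
      = - (\<integral>p. g p * (\<rho> (y - fst p) * \<theta> (snd p)) \<partial>(lebesgue_on (QT T)))"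
    using tr(2) unfolding F_def psi_def by linarith
qed

text \<open>Passing from \<open>u\<close> to a Borel representative affects the slice integrals only
  for \<open>t\<close> in a null set, which the essential limit does not see.\<close>

lemma dist_sol_initial_slices:
  fixes u u' :: "'n::finite pt \<Rightarrow> real"
  assumes u': "u' \<in> borel_measurable borel" "AE p in lborel. p \<in> QT T \<longrightarrow> u p = u' p"
    and \<rho>: "smooth_fun \<rho>"
  shows "AE t in lborel. 0 < t \<and> t < T \<longrightarrow>
    (\<integral>x. u (x, t) * (\<rho> (y - x) * \<theta> t) \<partial>lebesgue) = (LBINT x. u' (x, t) * (\<rho> (y - x) * \<theta> t))"
  using AE_slice_snd[OF u'(2)]
proof eventually_elim
  case (elim t)
  have [measurable]: "\<rho> \<in> borel_measurable borel" "u' \<in> borel_measurable borel" using smooth_fun_borel[OF \<rho>] u' by auto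
  show ?case
  proof
    assume "0 < t \<and> t < T"
    then have "AE x in lborel. u (x, t) * (\<rho> (y - x) * \<theta> t) = u' (x, t) * (\<rho> (y - x) * \<theta> t)"
      using elim by (auto simp: QT_def elim: eventually_mono)
    then show "(\<integral>x. u (x, t) * (\<rho> (y - x) * \<theta> t) \<partial>lebesgue) = (LBINT x. u' (x, t) * (\<rho> (y - x) * \<theta> t))"
      by (intro integral_lebesgue_AE) measurable
  qed
qed

theorem theorem2:
  fixes Sg :: "real^'p::finite^'n::finite"
    and mu :: "(real^'n) measure"
    and phi :: "real \<Rightarrow> real"
    and g :: "'n pt \<Rightarrow> real"
    and u0 :: "real^'n \<Rightarrow> real"
    and T :: real
    and u v :: "'n pt \<Rightarrow> real"
  assumes "T > 0"
    and "levy_measure mu"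
    and "mono phi" and "continuous_on UNIV phi"
    and "L1loc (QT T) g"
    and "Linf UNIV u0"
    and "dist_sol Sg mu phi g u0 T u"
    and "integrable (lebesgue_on (QT T)) (\<lambda>p. u p - u0 (fst p))"
    and "dist_sol Sg mu phi g u0 T v"
    and "integrable (lebesgue_on (QT T)) (\<lambda>p. v p - u0 (fst p))"
  shows "AE p in lebesgue_on (QT T). u p = v p"
proof -
  have [measurable]: "phi \<in> borel_measurable borel" by (rule borel_measurable_continuous_onI[OF assms(4)])
  obtain u' Cu where u': "u' \<in> borel_measurable borel" "\<And>x. \<bar>u' x\<bar> \<le> Cu" "\<And>x. x \<notin> QT T \<Longrightarrow> u' x = 0"
    "AE x in lborel. x \<in> QT T \<longrightarrow> u x = u' x"
    by (rule Linf_borel_representative[OF QT_borel, of T u]) (use assms(7) in \<open>auto simp: dist_sol_def\<close>)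
  obtain v' Cv where v': "v' \<in> borel_measurable borel" "\<And>x. \<bar>v' x\<bar> \<le> Cv" "\<And>x. x \<notin> QT T \<Longrightarrow> v' x = 0"
    "AE x in lborel. x \<in> QT T \<longrightarrow> v x = v' x"
    by (rule Linf_borel_representative[OF QT_borel, of T v]) (use assms(9) in \<open>auto simp: dist_sol_def\<close>)
  note [measurable] = u'(1) v'(1)
  define R where "R = max Cu Cv"
  have R: "\<bar>u' p\<bar> \<le> R" "\<bar>v' p\<bar> \<le> R" for p using u'(2)[of p] v'(2)[of p] by (auto simp: R_def)
  \<comment> \<open>By monotonicity the values of \<open>phi\<close> on \<open>[-R, R]\<close> lie
    between the values at the end points.\<close>
  define D where "D = \<bar>phi R\<bar> + \<bar>phi (- R)\<bar>"
  have phiD: "\<bar>phi a\<bar> \<le> D" if "\<bar>a\<bar> \<le> R" for a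
  proof -
    have "phi (- R) \<le> phi a" "phi a \<le> phi R" using that by (intro monoD[OF assms(3)]; simp)+
    then show ?thesis unfolding D_def by linarith
  qed
  define U where "U p = u' p - v' p" for p
  define W where "W p = phi (u' p) - phi (v' p)" for p
  have [measurable]: "U \<in> borel_measurable borel" "W \<in> borel_measurable borel" unfolding U_def[abs_def] W_def[abs_def] by measurable
  have Uz: "U p = 0" "W p = 0" if "p \<notin> QT T" for p using u'(3) v'(3) that by (auto simp: U_def W_def)
  have Ui: "integrable lborel U"
  proof -
    \<comment> \<open>The initial datum cancels, so \<open>u - v\<close> is integrable although
      neither solution need be.\<close>
    have "integrable (lebesgue_on (QT T)) (\<lambda>p. (u p - u0 (fst p)) - (v p - u0 (fst p)))"
      by (rule Bochner_Integration.integrable_diff[OF assms(8,10)])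
    moreover have "AE p in lborel. p \<in> QT T \<longrightarrow> (u p - u0 (fst p)) - (v p - u0 (fst p)) = U p"
      using u'(4) v'(4) by eventually_elim (simp add: U_def)
    ultimately show ?thesis
      by (subst (asm) integrable_lebesgue_on_AE[OF QT_borel, where f'=U]) (use Uz in auto)
  qed
  \<comment> \<open>By uniform continuity of \<open>phi\<close> on \<open>[-R, R]\<close>,
    \<open>|W| > \<delta>\<close> forces \<open>|U| >= \<eta>\<close>; Chebyshev's inequality for
    the integrable \<open>U\<close> bounds the measure.\<close>
  have small: "emeasure lborel {p. \<bar>W p\<bar> > \<delta>} < \<infinity>" if "\<delta> > 0" for \<delta>
  proof -
    have "uniformly_continuous_on {-R..R} phi"
      by (rule compact_uniformly_continuous[OF continuous_on_subset[OF assms(4)]]) auto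
    then obtain \<eta> where \<eta>: "\<eta> > 0" "\<And>a b. \<bar>a\<bar> \<le> R \<Longrightarrow> \<bar>b\<bar> \<le> R \<Longrightarrow> \<bar>a - b\<bar> < \<eta> \<Longrightarrow> \<bar>phi a - phi b\<bar> < \<delta>"
    proof -
      assume *: "\<And>\<eta>. \<eta> > 0 \<Longrightarrow> (\<And>a b. \<bar>a\<bar> \<le> R \<Longrightarrow> \<bar>b\<bar> \<le> R \<Longrightarrow> \<bar>a - b\<bar> < \<eta> \<Longrightarrow> \<bar>phi a - phi b\<bar> < \<delta>) \<Longrightarrow> thesis"
      obtain d where "d > 0" "\<And>x x'. x \<in> {-R..R} \<Longrightarrow> x' \<in> {-R..R} \<Longrightarrow> dist x' x < d \<Longrightarrow> dist (phi x') (phi x) < \<delta>"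
        using \<open>uniformly_continuous_on {-R..R} phi\<close> \<open>\<delta> > 0\<close> unfolding uniformly_continuous_on_def by meson
      then show thesis by (intro *[of d]) (auto simp: dist_real_def abs_le_iff)
    qed
    have "integrable lborel (indicator {p. \<bar>W p\<bar> > \<delta>} :: 'n pt \<Rightarrow> real)"
    proof (rule Bochner_Integration.integrable_bound)
      show "integrable lborel (\<lambda>p. U p / \<eta>)" using Ui by simp
      have "\<bar>U p\<bar> \<ge> \<eta>" if "\<bar>W p\<bar> > \<delta>" for p
        using \<eta>(2)[OF R, of p p] that by (auto simp: U_def W_def not_less[symmetric])
      then show "AE p in lborel. norm (indicator {p. \<bar>W p\<bar> > \<delta>} p :: real) \<le> norm (U p / \<eta>)"
        using \<eta>(1) by (intro AE_I2) (auto simp: indicator_def)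
    qed measurable
    then show ?thesis by (simp add: integrable_indicator_iff)
  qed
  interpret evolution Sg mu T "2 * D" U W
  proof
    show "T > 0" "levy_measure mu" "integrable lborel U" by fact+
    show "\<bar>W p\<bar> \<le> 2 * D" for p
      using phiD[OF R(1), of p] phiD[OF R(2), of p] unfolding W_def by linarith
  next
    fix \<rho> :: "real^'n \<Rightarrow> real" and \<theta> y assume \<rho>: "test_fun UNIV \<rho>" and \<theta>: "test_fun {0<..<T} \<theta>"
    \<comment> \<open>Both weak identities have the same right-hand side, namely the
      \<open>g\<close> term, which cancels in the difference.\<close>
    note U1 = dist_sol_product_test[OF assms(2,4,5,7) u'(1) R(1) u'(4) phiD[OF R(1)] \<rho> \<theta>, of y]
    note V1 = dist_sol_product_test[OF assms(2,4,5,9) v'(1) R(2) v'(4) phiD[OF R(2)] \<rho> \<theta>, of y]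
    have "(LBINT p. U p * (\<rho> (y - fst p) * dirderiv \<theta> 1 (snd p)) + W p * (levy_op Sg mu \<rho> (y - fst p) * \<theta> (snd p)))
      = (LBINT p. (u' p * (\<rho> (y - fst p) * dirderiv \<theta> 1 (snd p)) + phi (u' p) * (levy_op Sg mu \<rho> (y - fst p) * \<theta> (snd p)))
         - (v' p * (\<rho> (y - fst p) * dirderiv \<theta> 1 (snd p)) + phi (v' p) * (levy_op Sg mu \<rho> (y - fst p) * \<theta> (snd p))))"
      by (simp add: U_def W_def algebra_simps)
    also have "\<dots> = 0" unfolding Bochner_Integration.integral_diff[OF U1(1) V1(1)] U1(2) V1(2) by simp
    finally show "(LBINT p. U p * (\<rho> (y - fst p) * dirderiv \<theta> 1 (snd p)) + W p * (levy_op Sg mu \<rho> (y - fst p) * \<theta> (snd p))) = 0" .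
  next
    fix \<rho> :: "real^'n \<Rightarrow> real" and \<theta> y assume \<rho>: "test_fun UNIV \<rho>" and \<theta>: "test_fun {..<T} \<theta>"
    have test: "test_fun (UNIV \<times> {..<T}) (\<lambda>p. \<rho> (y - fst p) * \<theta> (snd p))" by (rule test_fun_product[OF \<rho> \<theta>])
    have l: "ess_lim_0 (\<lambda>t. \<integral>x. u (x, t) * (\<rho> (y - x) * \<theta> t) \<partial>lebesgue) (\<integral>x. u0 x * (\<rho> (y - x) * \<theta> 0) \<partial>lebesgue)"
      "ess_lim_0 (\<lambda>t. \<integral>x. v (x, t) * (\<rho> (y - x) * \<theta> t) \<partial>lebesgue) (\<integral>x. u0 x * (\<rho> (y - x) * \<theta> 0) \<partial>lebesgue)"
      using assms(7,9) test unfolding dist_sol_def by force+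
    have ri: "integrable lborel (\<lambda>x. \<rho> (y - x))"
      using test_fun_integrable[OF \<rho>] by (subst integrable_reflect) auto
    have i: "integrable lborel (\<lambda>x. f (x, t) * (\<rho> (y - x) * \<theta> t))"
      if "f \<in> borel_measurable borel" "\<And>p. \<bar>f p\<bar> \<le> R" for f :: "'n pt \<Rightarrow> real" and t
    proof (rule integrable_mult_bounded(2))
      note [measurable] = that(1)
      show "bounded_borel (\<lambda>x. f (x, t))" by (rule bounded_borelI[OF _ that(2)]) measurable
    qed (use ri in simp)
    show "ess_lim_0 (\<lambda>t. LBINT x. U (x, t) * (\<rho> (y - x) * \<theta> t)) 0"
    proof (rule ess_lim_0_diff[OF l _ \<open>T > 0\<close>])
      show "AE t in lborel. 0 < t \<and> t < T \<longrightarrow> (LBINT x. U (x, t) * (\<rho> (y - x) * \<theta> t)) =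
         (\<integral>x. u (x, t) * (\<rho> (y - x) * \<theta> t) \<partial>lebesgue) - (\<integral>x. v (x, t) * (\<rho> (y - x) * \<theta> t) \<partial>lebesgue)"
        using dist_sol_initial_slices[OF u'(1,4) test_fun_smooth[OF \<rho>], of y \<theta>]
          dist_sol_initial_slices[OF v'(1,4) test_fun_smooth[OF \<rho>], of y \<theta>]
      proof eventually_elim
        case (elim t)
        have "(LBINT x. U (x, t) * (\<rho> (y - x) * \<theta> t)) =
          (LBINT x. u' (x, t) * (\<rho> (y - x) * \<theta> t)) - (LBINT x. v' (x, t) * (\<rho> (y - x) * \<theta> t))"
          unfolding U_def left_diff_distrib
          by (rule Bochner_Integration.integral_diff[OF i[OF u'(1) R(1)] i[OF v'(1) R(2)]])
        then show ?case using elim by simp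
      qed
    qed
  qed (use Uz small in auto)
  have "AE p in lborel. U p = 0"
  proof (rule vanishes)
    show "AE p in lborel. 0 \<le> U p * W p"
    proof (rule AE_I2)
      fix p
      have "phi (u' p) \<le> phi (v' p)" if "u' p \<le> v' p" using monoD[OF assms(3) that] .
      moreover have "phi (v' p) \<le> phi (u' p)" if "v' p \<le> u' p" using monoD[OF assms(3) that] .
      ultimately show "0 \<le> U p * W p"
        unfolding U_def W_def zero_le_mult_iff by (cases "u' p \<le> v' p") auto
    qed
    show "AE p in lborel. U p = 0 \<longrightarrow> W p = 0" by (rule AE_I2) (simp add: U_def W_def)
  qed
  with u'(4) v'(4) have "AE p in lborel. p \<in> QT T \<longrightarrow> u p = v p"
    by eventually_elim (simp add: U_def)
  then show ?thesis by (simp add: AE_lebesgue_on_iff[OF QT_borel])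
qed

end
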